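(* Let $k\in\mathfrak{C}_2$ and let $g$ be a generator of the two-qubit Clifford group written as a ZX-diagram, i.e. $g$ is one of $u\otimes \mathrm{id}$, $\mathrm{id}\otimes u$ (where $u$ is the ZX-diagram of a generator of the one-qubit Clifford group), $\mathrm{CNOT}$, or the swap $\sigma$. Then $g\circ k \stackrel{*}{\leftrightarrow} k'$ for some $k'\in\mathfrak{C}_2$.
   Context: **ZX-diagrams.** A ZX-diagram $D:m\to n$ is a finite undirected open graph (edges may have open ends) whose open ends are partitioned into a linearly ordered list of $m$ inputs (drawn on the left) and a linearly ordered list of $n$ outputs (drawn on the right), with interior vertices of three kinds: $Z(\alpha)$ (green) and $X(\beta)$ (red) vertices of arbitrary degree, labelled by angles (arithmetic modulo $2\pi$), and $H$ vertices of degree exactly 2. Two diagrams are equal if they are isomorphic as labelled framed open graphs. Diagrams compose ($\circ$; $g\circ k$ means $k$ first) and tensor ($\otimes$), forming a PROP with swap $\sigma:2\to 2$. Here all angles are in $\{0,\pi/2,\pi,3\pi/2\}$. **Equivalence.** $\stackrel{*}{\leftrightarrow}$ is the least equivalence relation on diagrams containing one-step replacement of a subdiagram using the following rules and their colour-swapped ($Z\leftrightarrow X$) versions, applicable in either direction. Everything is taken up to non-zero scalars, i.e. non-zero subdiagrams without boundary are ignored. - spider: two $Z$ vertices $Z(\alpha),Z(\beta)$ joined by an edge merge into one vertex $Z(\alpha+\beta)$; - anti-loop: a self-loop on a $Z(\alpha)$ vertex may be deleted; - identity: a degree-2 vertex $Z(0)$ equals a plain wire; - copying: $(Z(0):1\to2)\circ(X(0):0\to1)\leftrightarrow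 (X(0):0\to 1)\otimes (X(0):0\to1)$; - $\pi$-commute: $(Z(\alpha):1\to n)\circ (X(\pi):1\to1)\leftrightarrow (X(\pi):1\to 1)^{\otimes n}\circ (Z(-\alpha):1\to n)$; - hopf: $(X(0):2\to1)\circ(Z(0):1\to2)\leftrightarrow (X(0):0\to1)\circ(Z(0):1\to0)$; - bialgebra: $(Z(0):1\to2)\circ(X(0):2\to1)\leftrightarrow (X(0)\otimes X(0))\circ(\mathrm{id}\otimes\sigma\otimes \mathrm{id})\circ(Z(0)\otimes Z(0))$, with $Z(0):1\to2$ and $X(0):2\to1$ on the right; - $H$-commute: a $Z(\alpha)$ vertex with an $H$ on every leg equals an $X(\alpha)$ vertex; - $H$-euler: $H\leftrightarrow Z(\pi/2)\circ X(\pi/2)\circ Z(\pi/2)$. **One-qubit notation.** $z_+,z,z_-$ denote the $1\to1$ diagrams consisting of a single vertex $Z(\pi/2),Z(\pi),Z(3\pi/2)$ respectively, and $x_+,x,x_-$ those consisting of $X(\pi/2),X(\pi),X(3\pi/2)$. A word such as $[z_+,x_-]$ denotes the line diagram whose vertices are, read from input to output, $z_+$ then $x_-$. The generators of the one-qubit Clifford group, as ZX-diagrams, are $z_+$ (the gate $S$), $x_+$ ($V$), $z$, $x$ and $H$. $\mathrm{CNOT}$ is the $2\to 2$ diagram with a $Z(0)$ vertex on the first wire joined by an edge to an $X(0)$ vertex on the second wire. **The set $\mathfrak{C}_1$** consists of the following 24 line diagrams: the plain wire; $[z_+],[z],[z_-],[x_+],[x],[x_-]$; $[z,x],[z,x_-],[z,x_+],[x,z_-],[x,z_+]$;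 $[z_-,x_-],[z_-,x_+],[z_+,x_-],[z_+,x_+],[x_-,z_-],[x_-,z_+],[x_+,z_-],[x_+,z_+]$; $[z_+,x_-,z_-],[z_+,x_-,z_+],[z_+,x_+,z_-],[z_+,x_+,z_+]$. **The set $\mathfrak{C}_2$.** Let $\mathfrak{A}=\{\mathrm{id},[x_+],[x_+,z_+]\}$ and $\mathfrak{B}=\{\mathrm{id},[z_+],[z_+,x_+]\}$. $\mathfrak{C}_2$ is the set of all $2\to2$ diagrams of one of the forms $$C_1\otimes C_2,\qquad \sigma\circ(C_1\otimes C_2),\qquad (A\otimes B)\circ\mathrm{CNOT}\circ(C_1\otimes C_2),\qquad (B\otimes A)\circ\sigma\circ\mathrm{CNOT}\circ(C_1\otimes C_2),$$ with $C_1,C_2\in\mathfrak{C}_1$, $A\in\mathfrak{A}$, $B\in\mathfrak{B}$. *)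

theory Defs
  imports Complex_Main "HOL-Library.Numeral_Type"
begin

section \<open>ZX-diagrams as labelled framed open graphs\<close>

text \<open>The numeral type \<open>4\<close> is the ring of integers modulo 4; \<open>a :: 4\<close> stands for
  the angle \<open>a * pi / 2\<close>, so its arithmetic is that of multiples of \<open>pi / 2\<close> modulo \<open>2 * pi\<close>.\<close>

datatype zx_label = Zl 4 | Xl 4 | Hl

text \<open>Interior vertices are numbered from 0. \<open>Leg v i\<close> is the end at vertex \<open>v\<close> of the \<open>i\<close>-th edge
  incident to it. The numbering of vertices and of legs is bookkeeping only and is forgotten by
  isomorphism.\<close>

datatype zx_port = In nat | Out nat | Leg nat nat

text \<open>\<open>verts\<close> lists label and degree of each interior vertex. \<open>wires\<close> is the symmetric relation that
  pairs the two ends of each edge, so an edge is an unordered pair of ports: self-loops, parallel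
  edges and edges with two open ends are all allowed. \<open>circles\<close> counts closed edges without any
  vertex, which arise from composition.\<close>

record zx_diagram =
  ins :: nat
  outs :: nat
  verts :: "(zx_label \<times> nat) list"
  wires :: "(zx_port \<times> zx_port) set"
  circles :: nat

definition ports :: "zx_diagram \<Rightarrow> zx_port set" where
  "ports D = In ` {..<ins D} \<union> Out ` {..<outs D} \<union>
     {Leg v i | v i. v < length (verts D) \<and> i < snd (verts D ! v)}"

definition is_diagram :: "zx_diagram \<Rightarrow> bool" where
  "is_diagram D \<longleftrightarrow>
     wires D \<subseteq> ports D \<times> ports D \<and> sym (wires D) \<and> irrefl (wires D) \<and>
     (\<forall>p\<in>ports D. \<exists>!q. (p, q) \<in> wires D) \<and>
     (\<forall>d. (Hl, d) \<in> set (verts D) \<longrightarrow> d = 2)"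

fun map_port :: "(nat \<Rightarrow> nat) \<Rightarrow> (nat \<Rightarrow> nat \<Rightarrow> nat) \<Rightarrow> zx_port \<Rightarrow> zx_port" where
  "map_port \<pi> \<phi> (In i) = In i"
| "map_port \<pi> \<phi> (Out i) = Out i"
| "map_port \<pi> \<phi> (Leg v i) = Leg (\<pi> v) (\<phi> v i)"

definition zx_iso :: "zx_diagram \<Rightarrow> zx_diagram \<Rightarrow> bool" (infix "\<simeq>\<^sub>z" 50) where
  "D \<simeq>\<^sub>z D' \<longleftrightarrow> is_diagram D \<and> is_diagram D' \<and>
     ins D = ins D' \<and> outs D = outs D' \<and> circles D = circles D' \<and>
     (\<exists>\<pi> \<phi>. bij_betw \<pi> {..<length (verts D)} {..<length (verts D')} \<and>
        (\<forall>v<length (verts D). fst (verts D ! v) = fst (verts D' ! \<pi> v) \<and>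
           bij_betw (\<phi> v) {..<snd (verts D ! v)} {..<snd (verts D' ! \<pi> v)}) \<and>
        wires D' = map_prod (map_port \<pi> \<phi>) (map_port \<pi> \<phi>) ` wires D)"


section \<open>The PROP structure\<close>

definition wire_id :: "nat \<Rightarrow> zx_diagram" where
  "wire_id n = \<lparr>ins = n, outs = n, verts = [],
     wires = (\<Union>i<n. {(In i, Out i), (Out i, In i)}), circles = 0\<rparr>"

definition wire_swap :: zx_diagram where
  "wire_swap = \<lparr>ins = 2, outs = 2, verts = [],
     wires = {(In 0, Out 1), (Out 1, In 0), (In 1, Out 0), (Out 0, In 1)}, circles = 0\<rparr>"

definition wire_cup :: zx_diagram where
  "wire_cup = \<lparr>ins = 0, outs = 2, verts = [],
     wires = {(Out 0, Out 1), (Out 1, Out 0)}, circles = 0\<rparr>"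

definition vertex :: "zx_label \<Rightarrow> nat \<Rightarrow> nat \<Rightarrow> zx_diagram" where
  "vertex l m n = \<lparr>ins = m, outs = n, verts = [(l, m + n)],
     wires = (\<Union>i<m. {(In i, Leg 0 i), (Leg 0 i, In i)}) \<union>
             (\<Union>j<n. {(Out j, Leg 0 (m + j)), (Leg 0 (m + j), Out j)}), circles = 0\<rparr>"

abbreviation Z_vertex :: "4 \<Rightarrow> nat \<Rightarrow> nat \<Rightarrow> zx_diagram" where
  "Z_vertex \<alpha> \<equiv> vertex (Zl \<alpha>)"

abbreviation X_vertex :: "4 \<Rightarrow> nat \<Rightarrow> nat \<Rightarrow> zx_diagram" where
  "X_vertex \<alpha> \<equiv> vertex (Xl \<alpha>)"

abbreviation H_vertex :: zx_diagram where
  "H_vertex \<equiv> vertex Hl 1 1"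

text \<open>\<open>g \<circ>\<^sub>z k\<close> glues output \<open>i\<close> of \<open>k\<close> to input \<open>i\<close> of \<open>g\<close>, both of which become the point \<open>Inl i\<close>
  of \<open>glue_wires\<close>. The edges of the composite are the paths through these points; the components
  consisting of such points only are new circles.\<close>

fun lower_port :: "zx_port \<Rightarrow> nat + zx_port" where
  "lower_port (In i) = Inr (In i)"
| "lower_port (Out i) = Inl i"
| "lower_port (Leg v i) = Inr (Leg v i)"

fun upper_port :: "nat \<Rightarrow> zx_port \<Rightarrow> nat + zx_port" where
  "upper_port s (In i) = Inl i"
| "upper_port s (Out i) = Inr (Out i)"
| "upper_port s (Leg v i) = Inr (Leg (s + v) i)"

definition glue_wires :: "zx_diagram \<Rightarrow> zx_diagram \<Rightarrow> ((nat + zx_port) \<times> (nat + zx_port)) set" where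
  "glue_wires g k = map_prod lower_port lower_port ` wires k \<union>
     map_prod (upper_port (length (verts k))) (upper_port (length (verts k))) ` wires g"

definition zx_comp :: "zx_diagram \<Rightarrow> zx_diagram \<Rightarrow> zx_diagram" (infixr "\<circ>\<^sub>z" 65) where
  "g \<circ>\<^sub>z k = \<lparr>ins = ins k, outs = outs g, verts = verts k @ verts g,
     wires = {(p, q). p \<noteq> q \<and> (Inr p, Inr q) \<in> (glue_wires g k)\<^sup>*},
     circles = circles k + circles g +
       card {C. \<exists>i<outs k. C = (glue_wires g k)\<^sup>* `` {Inl i} \<and> C \<subseteq> range Inl}\<rparr>"

fun shift_port :: "nat \<Rightarrow> nat \<Rightarrow> nat \<Rightarrow> zx_port \<Rightarrow> zx_port" where
  "shift_port m n s (In i) = In (m + i)"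
| "shift_port m n s (Out i) = Out (n + i)"
| "shift_port m n s (Leg v i) = Leg (s + v) i"

definition zx_tensor :: "zx_diagram \<Rightarrow> zx_diagram \<Rightarrow> zx_diagram" (infixr "\<otimes>\<^sub>z" 70) where
  "D \<otimes>\<^sub>z E = (let sh = shift_port (ins D) (outs D) (length (verts D)) in
     \<lparr>ins = ins D + ins E, outs = outs D + outs E, verts = verts D @ verts E,
      wires = wires D \<union> map_prod sh sh ` wires E, circles = circles D + circles E\<rparr>)"

primrec tensor_power :: "zx_diagram \<Rightarrow> nat \<Rightarrow> zx_diagram" where
  "tensor_power D 0 = wire_id 0"
| "tensor_power D (Suc n) = D \<otimes>\<^sub>z tensor_power D n"


section \<open>The value of a diagram without boundary\<close>

text \<open>The standard interpretation: an edge carries a bit, a \<open>Z\<close> vertex is the tensor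
  \<open>|0..0> + exp(i * alpha) |1..1>\<close>, an \<open>X\<close> vertex is \<open>|+..+> + exp(i * alpha) |-..->\<close>, \<open>H\<close> is the
  Hadamard matrix, and edges are contracted. \<open>vertex_weight\<close> gives the entries of these tensors.\<close>

definition phase :: "4 \<Rightarrow> complex" where
  "phase \<alpha> = \<i> ^ nat (Rep_bit0 \<alpha>)"

fun vertex_weight :: "zx_label \<Rightarrow> bool list \<Rightarrow> complex" where
  "vertex_weight (Zl \<alpha>) bs =
     (if True \<in> set bs then 0 else 1) + (if False \<in> set bs then 0 else phase \<alpha>)"
| "vertex_weight (Xl \<alpha>) bs =
     (1 + phase \<alpha> * (-1) ^ count_list bs True) / complex_of_real (sqrt 2) ^ length bs"
| "vertex_weight Hl bs = (if False \<in> set bs then 1 else -1) / complex_of_real (sqrt 2)"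

definition edge_bits :: "zx_diagram \<Rightarrow> (zx_port \<Rightarrow> bool) set" where
  "edge_bits S = {b. (\<forall>p. p \<notin> ports S \<longrightarrow> \<not> b p) \<and> (\<forall>(p, q)\<in>wires S. b p = b q)}"

definition scalar_value :: "zx_diagram \<Rightarrow> complex" where
  "scalar_value S = 2 ^ circles S *
     (\<Sum>b\<in>edge_bits S. \<Prod>v<length (verts S).
        vertex_weight (fst (verts S ! v)) (map (\<lambda>i. b (Leg v i)) [0..<snd (verts S ! v)]))"


section \<open>Equivalence of diagrams\<close>

text \<open>A subdiagram can be bent by its context (see \<open>zx_step\<close>), so it does not matter which
  of the legs of a left-hand side are inputs and which are outputs. Parallel edges
  between two merged vertices become self-loops.\<close>

inductive zx_rule :: "zx_diagram \<Rightarrow> zx_diagram \<Rightarrow> bool" where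
  spider: "zx_rule (Z_vertex \<beta> 1 n \<circ>\<^sub>z Z_vertex \<alpha> m 1) (Z_vertex (\<alpha> + \<beta>) m n)"
| anti_loop: "zx_rule (Z_vertex \<alpha> (n + 2) 0 \<circ>\<^sub>z (wire_id n \<otimes>\<^sub>z wire_cup)) (Z_vertex \<alpha> n 0)"
| identity: "zx_rule (Z_vertex 0 1 1) (wire_id 1)"
| copying: "zx_rule (Z_vertex 0 1 2 \<circ>\<^sub>z X_vertex 0 0 1) (X_vertex 0 0 1 \<otimes>\<^sub>z X_vertex 0 0 1)"
| pi_commute: "zx_rule (Z_vertex \<alpha> 1 n \<circ>\<^sub>z X_vertex 2 1 1)
    (tensor_power (X_vertex 2 1 1) n \<circ>\<^sub>z Z_vertex (- \<alpha>) 1 n)"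
| hopf: "zx_rule (X_vertex 0 2 1 \<circ>\<^sub>z Z_vertex 0 1 2) (X_vertex 0 0 1 \<circ>\<^sub>z Z_vertex 0 1 0)"
| bialgebra: "zx_rule (Z_vertex 0 1 2 \<circ>\<^sub>z X_vertex 0 2 1)
    ((X_vertex 0 2 1 \<otimes>\<^sub>z X_vertex 0 2 1) \<circ>\<^sub>z (wire_id 1 \<otimes>\<^sub>z wire_swap \<otimes>\<^sub>z wire_id 1) \<circ>\<^sub>z
     (Z_vertex 0 1 2 \<otimes>\<^sub>z Z_vertex 0 1 2))"
| H_commute: "zx_rule (tensor_power H_vertex n \<circ>\<^sub>z Z_vertex \<alpha> m n \<circ>\<^sub>z tensor_power H_vertex m)
    (X_vertex \<alpha> m n)"
| H_euler: "zx_rule H_vertex (Z_vertex 1 1 1 \<circ>\<^sub>z X_vertex 1 1 1 \<circ>\<^sub>z Z_vertex 1 1 1)"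

fun swap_label :: "zx_label \<Rightarrow> zx_label" where
  "swap_label (Zl \<alpha>) = Xl \<alpha>"
| "swap_label (Xl \<alpha>) = Zl \<alpha>"
| "swap_label Hl = Hl"

definition colour_swap :: "zx_diagram \<Rightarrow> zx_diagram" where
  "colour_swap D = D\<lparr>verts := map (map_prod swap_label id) (verts D)\<rparr>"

inductive zx_replace :: "zx_diagram \<Rightarrow> zx_diagram \<Rightarrow> bool" where
  rule: "zx_rule L R \<Longrightarrow> zx_replace L R"
| swapped: "zx_rule L R \<Longrightarrow> zx_replace (colour_swap L) (colour_swap R)"
| scalar: "is_diagram S \<Longrightarrow> ins S = 0 \<Longrightarrow> outs S = 0 \<Longrightarrow> scalar_value S \<noteq> 0 \<Longrightarrow>
    zx_replace S (wire_id 0)"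

text \<open>\<open>D\<close> contains \<open>L\<close> as a subdiagram iff it is isomorphic to some \<open>g \<circ>\<^sub>z (L \<otimes>\<^sub>z wire_id n) \<circ>\<^sub>z k\<close>:
  the rest of \<open>D\<close> can be put into \<open>k\<close>, and \<open>g\<close> may consist of edges joining outputs
  of \<open>L\<close> to wires that bypass \<open>L\<close>.\<close>

inductive zx_step :: "zx_diagram \<Rightarrow> zx_diagram \<Rightarrow> bool" where
  "zx_replace L R \<Longrightarrow> is_diagram g \<Longrightarrow> is_diagram k \<Longrightarrow>
   outs k = ins L + n \<Longrightarrow> ins g = outs L + n \<Longrightarrow>
   D \<simeq>\<^sub>z g \<circ>\<^sub>z (L \<otimes>\<^sub>z wire_id n) \<circ>\<^sub>z k \<Longrightarrow>
   D' \<simeq>\<^sub>z g \<circ>\<^sub>z (R \<otimes>\<^sub>z wire_id n) \<circ>\<^sub>z k \<Longrightarrow>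
   zx_step D D'"

text \<open>Isomorphic diagrams count as equal.\<close>

definition zx_equiv :: "zx_diagram \<Rightarrow> zx_diagram \<Rightarrow> bool" (infix "\<leftrightarrow>\<^sub>*" 50) where
  "zx_equiv = equivclp (\<lambda>D D'. D \<simeq>\<^sub>z D' \<or> zx_step D D')"


section \<open>One- and two-qubit Clifford diagrams\<close>

text \<open>Words are read from input to output.\<close>

fun line :: "zx_label list \<Rightarrow> zx_diagram" where
  "line [] = wire_id 1"
| "line [l] = vertex l 1 1"
| "line (l # ls) = line ls \<circ>\<^sub>z vertex l 1 1"

abbreviation z_p :: zx_label where "z_p \<equiv> Zl 1"
abbreviation z_pi :: zx_label where "z_pi \<equiv> Zl 2"
abbreviation z_m :: zx_label where "z_m \<equiv> Zl 3"
abbreviation x_p :: zx_label where "x_p \<equiv> Xl 1"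
abbreviation x_pi :: zx_label where "x_pi \<equiv> Xl 2"
abbreviation x_m :: zx_label where "x_m \<equiv> Xl 3"

definition CNOT :: zx_diagram where
  "CNOT = \<lparr>ins = 2, outs = 2, verts = [(Zl 0, 3), (Xl 0, 3)],
     wires = (let W = {(In 0, Leg 0 0), (Leg 0 1, Out 0), (Leg 0 2, Leg 1 0),
                       (In 1, Leg 1 1), (Leg 1 2, Out 1)} in W \<union> W\<inverse>),
     circles = 0\<rparr>"

definition Clifford1 :: "zx_diagram set" where
  "Clifford1 = line ` {[],
     [z_p], [z_pi], [z_m], [x_p], [x_pi], [x_m],
     [z_pi, x_pi], [z_pi, x_m], [z_pi, x_p], [x_pi, z_m], [x_pi, z_p],
     [z_m, x_m], [z_m, x_p], [z_p, x_m], [z_p, x_p],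
     [x_m, z_m], [x_m, z_p], [x_p, z_m], [x_p, z_p],
     [z_p, x_m, z_m], [z_p, x_m, z_p], [z_p, x_p, z_m], [z_p, x_p, z_p]}"

definition coset_A :: "zx_diagram set" where
  "coset_A = line ` {[], [x_p], [x_p, z_p]}"

definition coset_B :: "zx_diagram set" where
  "coset_B = line ` {[], [z_p], [z_p, x_p]}"

definition Clifford2 :: "zx_diagram set" where
  "Clifford2 =
     {C\<^sub>1 \<otimes>\<^sub>z C\<^sub>2 | C\<^sub>1 C\<^sub>2. C\<^sub>1 \<in> Clifford1 \<and> C\<^sub>2 \<in> Clifford1} \<union>
     {wire_swap \<circ>\<^sub>z (C\<^sub>1 \<otimes>\<^sub>z C\<^sub>2) | C\<^sub>1 C\<^sub>2. C\<^sub>1 \<in> Clifford1 \<and> C\<^sub>2 \<in> Clifford1} \<union>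
     {(A \<otimes>\<^sub>z B) \<circ>\<^sub>z CNOT \<circ>\<^sub>z (C\<^sub>1 \<otimes>\<^sub>z C\<^sub>2) | A B C\<^sub>1 C\<^sub>2.
        A \<in> coset_A \<and> B \<in> coset_B \<and> C\<^sub>1 \<in> Clifford1 \<and> C\<^sub>2 \<in> Clifford1} \<union>
     {(B \<otimes>\<^sub>z A) \<circ>\<^sub>z wire_swap \<circ>\<^sub>z CNOT \<circ>\<^sub>z (C\<^sub>1 \<otimes>\<^sub>z C\<^sub>2) | A B C\<^sub>1 C\<^sub>2.
        A \<in> coset_A \<and> B \<in> coset_B \<and> C\<^sub>1 \<in> Clifford1 \<and> C\<^sub>2 \<in> Clifford1}"

definition Clifford1_generators :: "zx_diagram set" where
  "Clifford1_generators = {line [z_p], line [x_p], line [z_pi], line [x_pi], line [Hl]}"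

definition Clifford2_generators :: "zx_diagram set" where
  "Clifford2_generators =
     {u \<otimes>\<^sub>z wire_id 1 | u. u \<in> Clifford1_generators} \<union>
     {wire_id 1 \<otimes>\<^sub>z u | u. u \<in> Clifford1_generators} \<union> {CNOT, wire_swap}"

end

theory Submission
  imports Defs "HOL-Library.Multiset" "HOL-Combinatorics.Permutations"
begin

text \<open>A diagram is described by naming its edges. A naming that is merely constant along edges is compatible
  with composition and tensor product, and it determines a diagram up to isomorphism and closed edges as soon
  as every name occurs at exactly two ports. Hence a rule can be applied inside a diagram by matching names: the
  context that \<open>zx_step\<close> asks for exists because names can be paired off by parity.

  Rewriting in this way gives relations between words in the gates: those of the one-qubit Clifford group,
  \<open>CNOT\<^sup>2 = 1\<close>, commutation of \<open>CNOT\<close> with phases, exchange of colours by \<open>H\<close>, the product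
  of three alternating \<open>CNOT\<close>s (bialgebra and hopf), and \<open>CNOT \<circ> V \<circ> CNOT\<close> on the control (bialgebra, hopf and Euler).
  In the monoid of two-qubit diagrams modulo equivalence, the classes of \<open>Clifford2\<close> are \<open>L\<close>, \<open>w L\<close>,
  \<open>K = A B c L\<close> and \<open>w K\<close>, where \<open>L\<close> is generated by the one-qubit gates, \<open>c\<close> is \<open>CNOT\<close> and \<open>w\<close> the
  swap. A one-qubit gate either changes the coset representative in \<open>A B\<close> or can be moved through \<open>c\<close> into \<open>L\<close>, and
  \<open>c A B c\<close> reduces to four cases because \<open>c\<close> commutes with \<open>S\<close> on the control and \<open>V\<close> on the target.\<close>

section \<open>Perfect matchings\<close>

text \<open>Direct proofs would founder on bookkeeping: ports are numbered, the edges of a composite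
  are paths through gluing points, and each rule application asks for a context and two
  isomorphisms. Nets forget the numbering, so that a rule application becomes a check on multisets.
  Two things have to be paid for. A net does not show closed edges, so these must be removable; the
  scalar rule does this because a closed edge has the value 2. And \<open>zx_step\<close> knows only
  contexts of one shape, so congruence for composition is derived by absorbing the outer diagram
  into \<open>g\<close> or \<open>k\<close>.

  Diagrams are rewritten only for gates on the first wire, for the control of \<open>CNOT\<close>
  and for the few laws that link the wires. All other relations follow by symmetry in the monoid:
  conjugation by the swap exchanges the wires, and the swap combined with Hadamard gates on both
  wires fixes \<open>CNOT\<close> while it exchanges control and target together with the
  colours.\<close>

definition matching :: "'a set \<Rightarrow> ('a \<times> 'a) set \<Rightarrow> bool" where
  "matching P M \<longleftrightarrow> M \<subseteq> P \<times> P \<and> sym M \<and> irrefl M \<and> (\<forall>p\<in>P. \<exists>!q. (p, q) \<in> M)"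

lemma matchingI:
  assumes "\<And>p q. (p, q) \<in> M \<Longrightarrow> q \<in> P" "sym M" "irrefl M" "\<And>p. p \<in> P \<Longrightarrow> \<exists>q. (p, q) \<in> M"
    "\<And>p q r. (p, q) \<in> M \<Longrightarrow> (p, r) \<in> M \<Longrightarrow> q = r"
  shows "matching P M"
proof -
  have "M \<subseteq> P \<times> P" using assms(1,2) by (auto dest: symD)
  then show ?thesis unfolding matching_def using assms(2-5) by blast
qed

lemma matchingD:
  assumes "matching P M"
  shows "(p, q) \<in> M \<Longrightarrow> p \<in> P" "(p, q) \<in> M \<Longrightarrow> q \<in> P" "(p, q) \<in> M \<Longrightarrow> (q, p) \<in> M"
    "(p, q) \<in> M \<Longrightarrow> p \<noteq> q" "(p, q) \<in> M \<Longrightarrow> (p, r) \<in> M \<Longrightarrow> q = r"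
    "p \<in> P \<Longrightarrow> \<exists>q. (p, q) \<in> M"
  using assms unfolding matching_def by (auto dest: symD simp: irrefl_def) blast

text \<open>Partners split a closed set into pairs. This parity count gives a path through gluing
  points its second end, and later shows that names occur evenly often in a realised net.\<close>

lemma matching_even_card:
  assumes "finite A" "matching P M" "A \<subseteq> P" "\<And>p q. p \<in> A \<Longrightarrow> (p, q) \<in> M \<Longrightarrow> q \<in> A"
  shows "even (card A)"
  using assms(1,3,4)
proof (induction A rule: finite_psubset_induct)
  case (psubset A)
  show ?case
  proof (cases "A = {}")
    case False
    then obtain p q where pq: "p \<in> A" "(p, q) \<in> M"
      using psubset.prems matchingD(6)[OF assms(2)] by blast
    note M = matchingD[OF assms(2)]
    have q: "q \<in> A" "p \<noteq> q" using pq psubset.prems M(4) by auto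
    have "even (card (A - {p, q}))"
    proof (rule psubset.IH)
      show "A - {p, q} \<subset> A" using pq by blast
      show "A - {p, q} \<subseteq> P" using psubset.prems by blast
      show "r' \<in> A - {p, q}" if "r \<in> A - {p, q}" "(r, r') \<in> M" for r r'
        using that psubset.prems(2)[of r r'] pq(2) M(3,5) by blast
    qed
    moreover have "card (A - {p, q}) = card A - 2"
      using pq q by (simp add: card_Diff_subset)
    moreover have "card A \<ge> 2"
      using pq q psubset.hyps card_mono[of A "{p, q}"] by simp
    ultimately show ?thesis by simp
  qed simp
qed

text \<open>A walk uses the two matchings alternately; \<open>(s, x)\<close> is the state at \<open>x\<close> when \<open>M s\<close> is next.\<close>

lemma alternating_walk:
  assumes sym: "\<And>s. sym (M s)" and fn: "\<And>s x y z. (x, y) \<in> M s \<Longrightarrow> (x, z) \<in> M s \<Longrightarrow> y = z"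
    and p: "\<And>y. (p, y) \<notin> M (\<not> t)" and py: "(p, y) \<in> (M True \<union> M False)\<^sup>*"
  shows "\<exists>s. ((t, p), (s, y)) \<in> {((s, x), (\<not> s, y)) | s x y. (x, y) \<in> M s}\<^sup>*" (is "\<exists>s. _ \<in> ?W\<^sup>*")
  using py
proof (induction rule: rtrancl_induct)
  case base
  show ?case by (rule exI[of _ t]) simp
next
  case (step y z)
  from step.IH obtain s where s: "((t, p), (s, y)) \<in> ?W\<^sup>*" ..
  obtain u where u: "(y, z) \<in> M u" using step.hyps(2) by auto
  show ?case
  proof (cases "u = s")
    case True
    then have "((s, y), (\<not> s, z)) \<in> ?W" using u by simp
    then show ?thesis by (intro exI[of _ "\<not> s"] rtrancl.rtrancl_into_rtrancl[OF s])
  next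
    case False
    show ?thesis using s
    proof (cases rule: rtranclE)
      case base
      then have "u = (\<not> t)" "y = p" using False by auto
      then show ?thesis using p u by simp
    next
      case (step r)
      then obtain x where x: "r = (\<not> s, x)" "(x, y) \<in> M (\<not> s)" by auto
      have "u = (\<not> s)" using False by simp
      then have "x = z" using fn[OF symD[OF sym x(2)]] u by simp
      then show ?thesis using step(1) x(1) by (intro exI[of _ "\<not> s"]) simp
    qed
  qed
qed

text \<open>Gluing points have a partner in each matching, points of \<open>P\<close> and
  \<open>Q\<close> in only one. Components of \<open>K \<union> G\<close> are therefore alternating
  cycles or paths, and the ends of the paths are exactly the remaining ports.\<close>

lemma matching_glue:
  assumes K: "matching (Inl ` I \<union> Inr ` P) K" and G: "matching (Inl ` I \<union> Inr ` Q) G"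
    and fin: "finite I" "finite P" "finite Q" and disj: "P \<inter> Q = {}"
  shows "matching (P \<union> Q) {(p, q). p \<noteq> q \<and> (Inr p, Inr q) \<in> (K \<union> G)\<^sup>*}" (is "matching _ ?M")
proof (rule matchingI)
  note KD = matchingD[OF K] and GD = matchingD[OF G]
  have KG: "sym (K \<union> G)" using KD(3) GD(3) by (auto intro: symI)
  have cl: "sym ((K \<union> G)\<^sup>*)" using KG by (rule sym_rtrancl)
  show "sym ?M" using cl by (auto intro!: symI dest: symD)
  show "irrefl ?M" by (auto simp: irrefl_def)
  show "q \<in> P \<union> Q" if "(p, q) \<in> ?M" for p q
  proof -
    have "(Inr p, Inr q) \<in> (K \<union> G)\<^sup>*" "Inr q \<noteq> Inr p" using that by auto
    then obtain x where "(x, Inr q) \<in> K \<union> G" by (auto elim: rtranclE)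
    then show ?thesis using KD(2)[of x "Inr q"] GD(2)[of x "Inr q"] by auto
  qed
  show "\<exists>q. (p, q) \<in> ?M" if p: "p \<in> P \<union> Q" for p
  proof (rule ccontr)
    assume no: "\<nexists>q. (p, q) \<in> ?M"
    define C where "C = {x. (Inr p, x) \<in> (K \<union> G)\<^sup>*}"
    have Cc: "y \<in> C" if "x \<in> C" "(x, y) \<in> K \<union> G" for x y
      using that unfolding C_def by (auto intro: rtrancl.rtrancl_into_rtrancl)
    have Csub: "C \<subseteq> insert (Inr p) (Inl ` I)"
    proof
      fix x assume x: "x \<in> C"
      then have "(Inr p, x) \<in> (K \<union> G)\<^sup>*" unfolding C_def by simp
      then have "x = Inr p \<or> x \<in> Inl ` I \<union> Inr ` P \<union> Inr ` Q"
      proof (cases rule: rtranclE)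
        case (step y)
        then show ?thesis using KD(2)[of y x] GD(2)[of y x] by auto
      qed simp
      moreover have "q = p" if "x = Inr q" for q using that x no unfolding C_def by auto
      ultimately show "x \<in> insert (Inr p) (Inl ` I)" by auto
    qed
    have pC: "Inr p \<in> C" unfolding C_def by simp
    \<comment> \<open>Without a second end the component would be \<open>p\<close> together with
      gluing points. It is closed under the matching that contains \<open>p\<close> and, after
      removal of \<open>p\<close>, under the other one; so two consecutive cardinalities would both
      be even.\<close>
    define J where "J = C - {Inr p}"
    have J: "J \<subseteq> Inl ` I" "C = insert (Inr p) J" "Inr p \<notin> J" "finite J"
      using Csub pC finite_subset[of J "Inl ` I"] fin unfolding J_def by auto
    show False
    proof (cases "p \<in> P")
      case True
      have "even (card C)"
      proof (rule matching_even_card[OF _ K])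
        show "y \<in> C" if "x \<in> C" "(x, y) \<in> K" for x y
          using Cc[of x y] that by simp
      qed (use J True in auto)
      moreover have "even (card J)"
      proof (rule matching_even_card[OF _ G])
        show "y \<in> J" if "x \<in> J" "(x, y) \<in> G" for x y
          using that J(2) Cc[of x y] GD(2)[OF that(2)] True disj by auto
      qed (use J in auto)
      ultimately show False using J by simp
    next
      case False
      then have pQ: "p \<in> Q" using p by simp
      have "even (card C)"
      proof (rule matching_even_card[OF _ G])
        show "y \<in> C" if "x \<in> C" "(x, y) \<in> G" for x y
          using Cc[of x y] that by simp
      qed (use J pQ in auto)
      moreover have "even (card J)"
      proof (rule matching_even_card[OF _ K])
        show "y \<in> J" if "x \<in> J" "(x, y) \<in> K" for x y
          using that J(2) Cc[of x y] KD(2)[OF that(2)] False by auto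
      qed (use J in auto)
      ultimately show False using J by simp
    qed
  qed
  show "q = r" if pq: "(p, q) \<in> ?M" and pr: "(p, r) \<in> ?M" for p q r
  proof -
    define M where "M s = (if s then K else G)" for s
    define W where "W = {((s, x), (\<not> s, y)) | s x y. (x, y) \<in> M s}"
    have MU: "M True \<union> M False = K \<union> G" by (simp add: M_def)
    have Ms: "sym (M s)" for s using KD(3) GD(3) by (auto simp: M_def intro: symI)
    have Mf: "y = z" if "(x, y) \<in> M s" "(x, z) \<in> M s" for s x y z
      using that KD(5) GD(5) by (auto simp: M_def split: if_splits)
    have MP: "(Inr a, y) \<in> M s \<Longrightarrow> a \<in> (if s then P else Q)" for s y a
      using KD(1)[of "Inr a" y] GD(1)[of "Inr a" y] by (auto simp: M_def)
    have both: False if "(x, Inr a) \<in> M s" "(Inr a, y) \<in> M (\<not> s)" for s x y a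
      using MP[of a x s] MP[OF that(2)] that(1) Ms disj by (cases s) (auto dest: symD)
    \<comment> \<open>\<open>t\<close> selects the matching that contains \<open>p\<close>, which
      leaves the walk a single way to start.\<close>
    obtain t where t: "\<And>y. (Inr p, y) \<notin> M (\<not> t)"
    proof (cases "p \<in> P")
      case True
      then show ?thesis using that[of True] MP[of p _ False] disj by auto
    next
      case False
      then show ?thesis using that[of False] MP[of p _ True] by auto
    qed
    have walk: "\<exists>s. ((t, Inr p), (s, y)) \<in> W\<^sup>*" if "(Inr p, y) \<in> (K \<union> G)\<^sup>*" for y
      unfolding W_def using alternating_walk[of M "Inr p" t y] Ms Mf t that MU by simp
    obtain s s' where s: "((t, Inr p), (s, Inr q)) \<in> W\<^sup>*" "((t, Inr p), (s', Inr r)) \<in> W\<^sup>*"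
      using walk[of "Inr q"] walk[of "Inr r"] pq pr by auto
    \<comment> \<open>A port other than \<open>p\<close> is reached through the matching it belongs
      to. Leaving it would take the other matching, in which it does not occur.\<close>
    have stop: "y = (u, Inr a)" if ua: "((t, Inr p), (u, Inr a)) \<in> W\<^sup>*" "((u, Inr a), y) \<in> W\<^sup>*" "a \<noteq> p" for u a y
    proof (rule ccontr)
      assume y: "y \<noteq> (u, Inr a)"
      obtain z where z: "(Inr a, z) \<in> M u"
        using ua(2) by (cases rule: converse_rtranclE) (use y in \<open>auto simp: W_def\<close>)
      obtain x where "(x, Inr a) \<in> M (\<not> u)"
        using ua(1) by (cases rule: rtranclE) (use ua(3) in \<open>auto simp: W_def\<close>)
      then show False using both[of x a "\<not> u" z] z by simp
    qed
    \<comment> \<open>A deterministic walk meets the two ends one after the other and stops at the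
      first, so they coincide.\<close>
    have "single_valued W" unfolding W_def by (auto intro!: single_valuedI dest: Mf)
    then have "((s, Inr q), (s', Inr r)) \<in> W\<^sup>* \<or> ((s', Inr r), (s, Inr q)) \<in> W\<^sup>*"
      using s by (rule single_valued_confluent)
    then show ?thesis
    proof
      assume "((s, Inr q), (s', Inr r)) \<in> W\<^sup>*"
      then show ?thesis using stop[OF s(1)] pq by auto
    next
      assume "((s', Inr r), (s, Inr q)) \<in> W\<^sup>*"
      then show ?thesis using stop[OF s(2)] pr by auto
    qed
  qed
qed

text \<open>Two ports of the same name are paired off and parity leaves none alone. In this way
  abstract nets become diagrams although their edges are never described.\<close>

lemma ex_matching:
  assumes "finite P" "\<And>x. even (card {p \<in> P. e p = x})"
  shows "\<exists>M. matching P M \<and> (\<forall>(p, q)\<in>M. e p = e q)"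
  using assms
proof (induction P rule: finite_psubset_induct)
  case (psubset P)
  show ?case
  proof (cases "P = {}")
    case True
    then show ?thesis by (intro exI[of _ "{}"]) (simp add: matching_def sym_def irrefl_def)
  next
    case False
    then obtain p where p: "p \<in> P" by blast
    let ?F = "{q \<in> P. e q = e p}"
    have "?F \<noteq> {p}" using psubset.prems[of "e p"] by (metis (no_types, lifting) card_1_singleton_iff odd_one One_nat_def)
    then obtain q where q: "q \<in> P" "e q = e p" "q \<noteq> p" using p by blast
    have "even (card {r \<in> P - {p, q}. e r = x})" for x
    proof (cases "x = e p")
      case True
      then have "{r \<in> P - {p, q}. e r = x} = ?F - {p, q}" by auto
      moreover have "card (?F - {p, q}) = card ?F - 2"
        using p q by (subst card_Diff_subset) auto
      moreover have "card ?F \<ge> 2" using p q psubset.hyps card_mono[of ?F "{p, q}"] by simp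
      ultimately show ?thesis using psubset.prems[of "e p"] by simp
    next
      case False
      then have "{r \<in> P - {p, q}. e r = x} = {r \<in> P. e r = x}" using q by auto
      then show ?thesis using psubset.prems by simp
    qed
    moreover have "P - {p, q} \<subset> P" using p by blast
    ultimately obtain M where M: "matching (P - {p, q}) M" "\<forall>(p, q)\<in>M. e p = e q"
      using psubset.IH by blast
    note MD = matchingD[OF M(1)]
    have "matching P (M \<union> {(p, q), (q, p)})"
    proof (rule matchingI)
      show "\<exists>y. (x, y) \<in> M \<union> {(p, q), (q, p)}" if "x \<in> P" for x
        using that MD(6)[of x] by blast
    qed (use p q MD in \<open>auto intro!: symI simp: irrefl_def, blast?\<close>)
    then show ?thesis using M(2) q by (intro exI[of _ "M \<union> {(p, q), (q, p)}"]) auto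
  qed
qed

section \<open>Named nets\<close>

lemma matching_image:
  assumes M: "matching P M" and f: "inj_on f P"
  shows "matching (f ` P) (map_prod f f ` M)"
proof (rule matchingI)
  note MD = matchingD[OF M]
  show "q \<in> f ` P" if "(p, q) \<in> map_prod f f ` M" for p q using that MD(2) by auto
  show "sym (map_prod f f ` M)" using MD(3) by (auto intro!: symI)
  show "irrefl (map_prod f f ` M)"
    using MD(1,2,4) inj_onD[OF f] by (auto simp: irrefl_def) blast
  show "\<exists>q. (p, q) \<in> map_prod f f ` M" if "p \<in> f ` P" for p
  proof -
    obtain x where x: "x \<in> P" "p = f x" using \<open>p \<in> f ` P\<close> by blast
    then obtain y where "(x, y) \<in> M" using MD(6) by blast
    then have "map_prod f f (x, y) \<in> map_prod f f ` M" by (rule imageI)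
    then show ?thesis unfolding x(2) map_prod_simp by (rule exI)
  qed
  show "q = r" if "(p, q) \<in> map_prod f f ` M" "(p, r) \<in> map_prod f f ` M" for p q r
    using that MD(1,5) inj_onD[OF f] by auto blast
qed

lemma matching_Un:
  assumes M: "matching P M" and N: "matching Q N" and disj: "P \<inter> Q = {}"
  shows "matching (P \<union> Q) (M \<union> N)"
proof (rule matchingI)
  note MD = matchingD[OF M] and ND = matchingD[OF N]
  show "q \<in> P \<union> Q" if "(p, q) \<in> M \<union> N" for p q using that MD(2) ND(2) by auto
  show "sym (M \<union> N)" using MD(3) ND(3) by (auto intro!: symI)
  show "irrefl (M \<union> N)" using MD(4) ND(4) by (auto simp: irrefl_def)
  show "\<exists>q. (p, q) \<in> M \<union> N" if "p \<in> P \<union> Q" for p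
    using that MD(6)[of p] ND(6)[of p] by auto
  show "q = r" if "(p, q) \<in> M \<union> N" "(p, r) \<in> M \<union> N" for p q r
    using that MD(1)[of p] MD(5)[of p q r] ND(1)[of p] ND(5)[of p q r] disj by blast
qed

lemma matching_empty: "matching {} {}"
  by (simp add: matching_def sym_def irrefl_def)

lemma matching_insert:
  assumes "matching P M" "p \<noteq> q" "p \<notin> P" "q \<notin> P"
  shows "matching ({p, q} \<union> P) ({(p, q), (q, p)} \<union> M)"
proof (rule matching_Un[OF _ assms(1)])
  show "matching {p, q} {(p, q), (q, p)}"
    using assms(2) by (auto simp: matching_def sym_def irrefl_def)
qed (use assms in auto)

abbreviation legs :: "(zx_label \<times> nat) list \<Rightarrow> zx_port set" where
  "legs vs \<equiv> {Leg v i | v i. v < length vs \<and> i < snd (vs ! v)}"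

lemma is_diagram_matching:
  "is_diagram D \<longleftrightarrow> matching (ports D) (wires D) \<and> (\<forall>d. (Hl, d) \<in> set (verts D) \<longrightarrow> d = 2)"
  unfolding is_diagram_def matching_def by auto

lemma legs_snoc: "legs (vs @ [v]) = legs vs \<union> Leg (length vs) ` {..<snd v}"
  by (auto simp: nth_append less_Suc_eq)

lemma finite_legs [simp]: "finite (legs vs)"
proof (induction vs rule: rev_induct)
  case (snoc v vs)
  then show ?case unfolding legs_snoc by simp
qed simp

lemma finite_ports [simp]: "finite (ports D)"
  unfolding ports_def by simp

lemma legs_append: "legs (vs @ ws) = legs vs \<union> {Leg (length vs + v) i | v i. v < length ws \<and> i < snd (ws ! v)}"
proof (intro equalityI subsetI)
  fix p assume "p \<in> legs (vs @ ws)"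
  then obtain v i where p: "p = Leg v i" "v < length vs + length ws" "i < snd ((vs @ ws) ! v)" by auto
  show "p \<in> legs vs \<union> {Leg (length vs + v) i | v i. v < length ws \<and> i < snd (ws ! v)}"
  proof (cases "v < length vs")
    case False
    then obtain w where "v = length vs + w" using le_Suc_ex by (metis not_less)
    then show ?thesis using p by auto
  qed (use p in \<open>auto simp: nth_append\<close>)
qed (auto simp: nth_append)

section \<open>Namings and the nets they induce\<close>

definition naming :: "zx_diagram \<Rightarrow> (zx_port \<Rightarrow> 'a) \<Rightarrow> bool" where
  "naming D e \<longleftrightarrow> (\<forall>(p, q)\<in>wires D. e p = e q)"

lemma namingD: "naming D e \<Longrightarrow> (p, q) \<in> wires D \<Longrightarrow> e p = e q"
  by (auto simp: naming_def)

lemma is_diagramD: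
  assumes "is_diagram D" "(p, q) \<in> wires D"
  shows "p \<in> ports D" "q \<in> ports D" "(q, p) \<in> wires D"
proof -
  have "matching (ports D) (wires D)" using assms(1) by (simp add: is_diagram_matching)
  note M = matchingD[OF this]
  show "p \<in> ports D" "q \<in> ports D" "(q, p) \<in> wires D"
    using M(1,2,3)[OF assms(2)] by simp_all
qed

text \<open>The boundary stays ordered because diagrams are framed. Vertices and legs become
  multisets because isomorphism forgets their numbering, and edges survive only as shared
  names.\<close>

type_synonym 'a net = "'a list \<times> 'a list \<times> (zx_label \<times> 'a multiset) multiset"

definition net_verts :: "(zx_label \<times> nat) list \<Rightarrow> (zx_port \<Rightarrow> 'a) \<Rightarrow> (zx_label \<times> 'a multiset) multiset" where
  "net_verts vs e =
     mset (map (\<lambda>v. (fst (vs ! v), mset (map (\<lambda>i. e (Leg v i)) [0..<snd (vs ! v)]))) [0..<length vs])"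

definition net_of :: "zx_diagram \<Rightarrow> (zx_port \<Rightarrow> 'a) \<Rightarrow> 'a net" where
  "net_of D e = (map (\<lambda>i. e (In i)) [0..<ins D], map (\<lambda>i. e (Out i)) [0..<outs D], net_verts (verts D) e)"

text \<open>The names of a net are constant along the edges, but different edges may share a name.\<close>

definition realises :: "zx_diagram \<Rightarrow> 'a net \<Rightarrow> bool" where
  "realises D N \<longleftrightarrow> is_diagram D \<and> (\<exists>e. naming D e \<and> N = net_of D e)"

definition map_net :: "('a \<Rightarrow> 'b) \<Rightarrow> 'a net \<Rightarrow> 'b net" where
  "map_net f = (\<lambda>(is, os, V). (map f is, map f os, image_mset (map_prod id (image_mset f)) V))"

text \<open>Constancy along edges survives every renaming, also one that identifies names; such an
  \<open>f\<close> merges two edges when the vertex between them disappears.\<close>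

lemma realises_map:
  assumes "realises D N"
  shows "realises D (map_net f N)"
proof -
  obtain e where e: "naming D e" "N = net_of D e" "is_diagram D"
    using assms unfolding realises_def by blast
  have "map_net f N = net_of D (f \<circ> e)"
    unfolding e(2) map_net_def net_of_def net_verts_def
    by (simp add: multiset.map_comp comp_def mset_map[symmetric] del: mset_map)
  moreover have "naming D (f \<circ> e)" using e(1) by (auto simp: naming_def)
  ultimately show ?thesis using e(3) unfolding realises_def by blast
qed

lemma net_verts_cong:
  assumes "\<And>v i. v < length vs \<Longrightarrow> i < snd (vs ! v) \<Longrightarrow> e (Leg v i) = e' (Leg v i)"
  shows "net_verts vs e = net_verts vs e'"
  unfolding net_verts_def
  by (intro arg_cong[of _ _ mset] map_cong refl prod_eqI) (use assms in \<open>auto intro!: arg_cong[of _ _ mset] simp del: mset_map\<close>)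

lemma net_verts_append:
  "net_verts (vs @ ws) e = net_verts vs e + net_verts ws (\<lambda>p. case p of Leg v i \<Rightarrow> e (Leg (length vs + v) i))"
proof -
  let ?f = "\<lambda>vs v. (fst (vs ! v), mset (map (\<lambda>i. e (Leg v i)) [0..<snd (vs ! v)]))"
  have "map (?f (vs @ ws)) [0..<length (vs @ ws)] =
    map (?f vs) [0..<length vs] @ map (\<lambda>v. ?f (vs @ ws) (length vs + v)) [0..<length ws]"
    by (rule nth_equalityI) (auto simp: nth_append)
  then show ?thesis unfolding net_verts_def by (simp add: nth_append)
qed

section \<open>Composition and tensor product\<close>

lemma image_Collect2: "f ` {h v i | v i. P v i} = {f (h v i) | v i. P v i}"
  by blast

lemma ports_comp:
  "ports (g \<circ>\<^sub>z k) = (In ` {..<ins k} \<union> legs (verts k)) \<union>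
     (Out ` {..<outs g} \<union> {Leg (length (verts k) + v) i | v i. v < length (verts g) \<and> i < snd (verts g ! v)})"
  unfolding ports_def zx_comp_def by (simp only: legs_append zx_diagram.simps) blast

lemma is_diagram_comp:
  assumes g: "is_diagram g" and k: "is_diagram k" and len: "outs k = ins g"
  shows "is_diagram (g \<circ>\<^sub>z k)"
proof -
  let ?s = "length (verts k)"
  let ?I = "{..<outs k}" and ?P = "In ` {..<ins k} \<union> legs (verts k)"
  let ?Q = "Out ` {..<outs g} \<union> {Leg (?s + v) i | v i. v < length (verts g) \<and> i < snd (verts g ! v)}"
  have Qim: "{Leg (?s + v) i | v i. v < length (verts g) \<and> i < snd (verts g ! v)} =
      (\<lambda>p. case p of Leg v i \<Rightarrow> Leg (?s + v) i | _ \<Rightarrow> p) ` legs (verts g)"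
    by (simp add: image_Collect2)
  have lp: "lower_port ` ports k = Inl ` ?I \<union> Inr ` ?P"
    by (simp add: ports_def image_Un image_image image_Collect2 Un_ac)
  have up: "upper_port ?s ` ports g = Inl ` ?I \<union> Inr ` ?Q"
    by (simp add: ports_def len image_Un image_image image_Collect2 Un_ac)
  have "inj_on lower_port (ports k)" "inj_on (upper_port ?s) (ports g)"
    unfolding ports_def by (auto intro!: inj_onI)
  then have K: "matching (Inl ` ?I \<union> Inr ` ?P) (map_prod lower_port lower_port ` wires k)"
    and G: "matching (Inl ` ?I \<union> Inr ` ?Q) (map_prod (upper_port ?s) (upper_port ?s) ` wires g)"
    using matching_image g k unfolding lp[symmetric] up[symmetric] is_diagram_matching by blast+
  have finQ: "finite ?Q" unfolding Qim by simp
  have "matching (?P \<union> ?Q) {(p, q). p \<noteq> q \<and> (Inr p, Inr q) \<in> (glue_wires g k)\<^sup>*}"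
    unfolding glue_wires_def by (rule matching_glue[OF K G]) (use finQ in auto)
  then show ?thesis
    using g k unfolding is_diagram_matching ports_comp by (auto simp: zx_comp_def)
qed

lemma naming_glue:
  assumes "\<And>p q. (p, q) \<in> wires k \<Longrightarrow> e (lower_port p) = e (lower_port q)"
    and "\<And>p q. (p, q) \<in> wires g \<Longrightarrow> e (upper_port (length (verts k)) p) = e (upper_port (length (verts k)) q)"
    and "(x, y) \<in> (glue_wires g k)\<^sup>*"
  shows "e x = e y"
  using assms(3)
  by (induction rule: rtrancl_induct) (use assms(1,2) in \<open>auto simp: glue_wires_def\<close>)

lemma realises_comp:
  assumes k: "realises k (is, ms, V)" and g: "realises g (ms, os, W)"
  shows "realises (g \<circ>\<^sub>z k) (is, os, V + W)"
proof -
  obtain e where e: "naming k e" "(is, ms, V) = net_of k e" "is_diagram k"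
    using k unfolding realises_def by blast
  obtain f where f: "naming g f" "(ms, os, W) = net_of g f" "is_diagram g"
    using g unfolding realises_def by blast
  let ?s = "length (verts k)"
  have ms: "ms = map (\<lambda>i. e (Out i)) [0..<outs k]" "ms = map (\<lambda>i. f (In i)) [0..<ins g]"
    using e(2) f(2) unfolding net_of_def by auto
  have len: "outs k = ins g" using ms by (metis diff_zero length_map length_upt)
  have mid: "f (In i) = e (Out i)" if "i < ins g" for i
  proof -
    have "ms ! i = f (In i)" using that by (simp add: ms(2))
    moreover have "ms ! i = e (Out i)" using that len by (simp add: ms(1))
    ultimately show ?thesis by simp
  qed
  \<comment> \<open>Vertices of \<open>k\<close> are numbered first, so the number of a vertex
    decides which naming its legs take. \<open>h'\<close> adds the gluing points, where the two
    namings agree by \<open>mid\<close>.\<close>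
  define h where "h p = (case p of In i \<Rightarrow> e (In i) | Out i \<Rightarrow> f (Out i)
    | Leg v i \<Rightarrow> if v < ?s then e (Leg v i) else f (Leg (v - ?s) i))" for p
  define h' where "h' = case_sum (\<lambda>i. e (Out i)) h"
  have lo: "h' (lower_port p) = e p" if "p \<in> ports k" for p
    using that by (auto simp: ports_def h'_def h_def)
  have up: "h' (upper_port ?s p) = f p" if "p \<in> ports g" for p
    using that mid by (auto simp: ports_def h'_def h_def)
  have "naming (g \<circ>\<^sub>z k) h"
  proof -
    have "h p = h q" if "(Inr p, Inr q) \<in> (glue_wires g k)\<^sup>*" for p q
    proof -
      have "h' (Inr p) = h' (Inr q)"
      proof (rule naming_glue[OF _ _ that])
        show "h' (lower_port p) = h' (lower_port q)" if "(p, q) \<in> wires k" for p q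
          using lo is_diagramD[OF e(3) that] namingD[OF e(1) that] by simp
        show "h' (upper_port ?s p) = h' (upper_port ?s q)" if "(p, q) \<in> wires g" for p q
          using up is_diagramD[OF f(3) that] namingD[OF f(1) that] by simp
      qed
      then show ?thesis by (simp add: h'_def)
    qed
    then show ?thesis by (auto simp: naming_def zx_comp_def)
  qed
  moreover have "net_of (g \<circ>\<^sub>z k) h = (is, os, V + W)"
  proof -
    have "net_verts (verts k @ verts g) h = net_verts (verts k) e + net_verts (verts g) f"
      unfolding net_verts_append
      by (intro arg_cong2[of _ _ _ _ "(+)"] net_verts_cong) (auto simp: h_def)
    then show ?thesis using e(2) f(2) by (auto simp: net_of_def zx_comp_def h_def)
  qed
  ultimately show ?thesis
    using is_diagram_comp[OF f(3) e(3) len] unfolding realises_def by metis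
qed

text \<open>The names on the cut are not part of the given net and have to be recovered from the
  paths that run through it.\<close>

lemma realises_compE:
  assumes D: "realises (g \<circ>\<^sub>z k) (is, os, U)" and gk: "is_diagram g" "is_diagram k" "outs k = ins g"
  obtains ms V W where "U = V + W" "realises k (is, ms, V)" "realises g (ms, os, W)"
proof -
  obtain e where e: "naming (g \<circ>\<^sub>z k) e" "(is, os, U) = net_of (g \<circ>\<^sub>z k) e"
    using D unfolding realises_def by blast
  let ?s = "length (verts k)" and ?R = "(glue_wires g k)\<^sup>*"
  have eq: "e p = e q" if "(Inr p, Inr q) \<in> ?R" for p q
    using e(1) that unfolding naming_def zx_comp_def by (cases "p = q") auto
  have "sym (glue_wires g k)"
    using is_diagramD(3)[OF gk(1)] is_diagramD(3)[OF gk(2)]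
    by (auto simp: glue_wires_def intro!: symI)
  then have sym: "(x, y) \<in> ?R \<Longrightarrow> (y, x) \<in> ?R" for x y by (metis sym_rtrancl symD)
  \<comment> \<open>A gluing point takes the name of a port on its path. On a closed component there
    is no such port, but \<open>SOME\<close> still yields the same value at all of its points, which
    is enough for a naming.\<close>
  define h where "h x = e (SOME p. (x, Inr p) \<in> ?R)" for x
  have h_Inr: "h (Inr p) = e p" for p
    unfolding h_def by (rule someI2[of _ p]) (auto intro: eq[symmetric])
  have h: "h x = h y" if "(x, y) \<in> glue_wires g k" for x y
  proof -
    have xy: "(x, y) \<in> ?R" using that by (rule r_into_rtrancl)
    have "(x, Inr p) \<in> ?R \<longleftrightarrow> (y, Inr p) \<in> ?R" for p
      using xy sym[OF xy] by (meson rtrancl_trans)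
    then show ?thesis unfolding h_def by simp
  qed
  have "naming k (h \<circ> lower_port)"
    unfolding naming_def by (auto intro!: h simp: glue_wires_def)
  moreover have "naming g (h \<circ> upper_port ?s)"
    unfolding naming_def by (auto intro!: h simp: glue_wires_def)
  moreover have "net_of k (h \<circ> lower_port) = (is, map (\<lambda>i. h (Inl i)) [0..<outs k], net_verts (verts k) e)"
    using e(2) by (auto simp: net_of_def zx_comp_def h_Inr intro!: net_verts_cong)
  moreover have "net_of g (h \<circ> upper_port ?s) = (map (\<lambda>i. h (Inl i)) [0..<outs k], os,
      net_verts (verts g) (\<lambda>p. case p of Leg v i \<Rightarrow> e (Leg (?s + v) i)))"
    using e(2) gk(3) by (auto simp: net_of_def zx_comp_def h_Inr intro!: net_verts_cong)
  moreover have "U = net_verts (verts k) e + net_verts (verts g) (\<lambda>p. case p of Leg v i \<Rightarrow> e (Leg (?s + v) i))"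
    using e(2) by (simp add: net_of_def zx_comp_def net_verts_append)
  ultimately show ?thesis using that gk unfolding realises_def by metis
qed

lemma zx_tensor_simps [simp]:
  "ins (D \<otimes>\<^sub>z E) = ins D + ins E" "outs (D \<otimes>\<^sub>z E) = outs D + outs E"
  "verts (D \<otimes>\<^sub>z E) = verts D @ verts E" "circles (D \<otimes>\<^sub>z E) = circles D + circles E"
  by (simp_all add: zx_tensor_def Let_def)

lemma zx_comp_simps [simp]:
  "ins (g \<circ>\<^sub>z k) = ins k" "outs (g \<circ>\<^sub>z k) = outs g" "verts (g \<circ>\<^sub>z k) = verts k @ verts g"
  by (simp_all add: zx_comp_def)

lemma is_diagram_tensor:
  assumes D: "is_diagram D" and E: "is_diagram E"
  shows "is_diagram (D \<otimes>\<^sub>z E)"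
proof -
  let ?sh = "shift_port (ins D) (outs D) (length (verts D))"
  have "inj ?sh"
  proof (rule injI)
    show "p = q" if "?sh p = ?sh q" for p q using that by (cases p; cases q) auto
  qed
  then have "matching (?sh ` ports E) (map_prod ?sh ?sh ` wires E)"
    using E by (auto simp: is_diagram_matching intro: matching_image inj_on_subset)
  moreover have "ports D \<inter> ?sh ` ports E = {}" by (auto simp: ports_def)
  ultimately have "matching (ports D \<union> ?sh ` ports E) (wires (D \<otimes>\<^sub>z E))"
    using D matching_Un by (auto simp: is_diagram_matching zx_tensor_def Let_def)
  moreover have "ports (D \<otimes>\<^sub>z E) = ports D \<union> ?sh ` ports E"
  proof -
    have shE: "?sh ` ports E = (\<lambda>i. In (ins D + i)) ` {..<ins E} \<union> (\<lambda>i. Out (outs D + i)) ` {..<outs E} \<union>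
      {Leg (length (verts D) + v) i | v i. v < length (verts E) \<and> i < snd (verts E ! v)}"
      by (simp add: ports_def image_Un image_image image_Collect2)
    have split: "h ` {..<m + n} = h ` {..<m} \<union> (\<lambda>i. h (m + i)) ` {..<n}" for h :: "nat \<Rightarrow> zx_port" and m n :: nat
    proof -
      have "{..<m + n} = {..<m} \<union> (+) m ` {..<n}"
        using image_add_atLeastLessThan[of m 0 n] by (auto simp: lessThan_atLeast0)
      then show ?thesis by (simp add: image_Un image_image)
    qed
    show ?thesis
      unfolding shE unfolding ports_def zx_tensor_simps legs_append split by (simp only: Un_ac)
  qed
  ultimately show ?thesis using D E by (auto simp: is_diagram_matching)
qed

lemma wires_tensor:
  "wires (D \<otimes>\<^sub>z E) = wires D \<union> map_prod (shift_port (ins D) (outs D) (length (verts D)))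
     (shift_port (ins D) (outs D) (length (verts D))) ` wires E"
  by (simp add: zx_tensor_def Let_def)

lemma map_upt_append: "map f [0..<m + n] = map f [0..<m] @ map (\<lambda>i. f (m + i)) [0..<n]"
  by (rule nth_equalityI) (auto simp: nth_append)

lemma realises_tensor:
  assumes D: "realises D (is, os, V)" and E: "realises E (is', os', V')"
  shows "realises (D \<otimes>\<^sub>z E) (is @ is', os @ os', V + V')"
proof -
  obtain e where e: "naming D e" "(is, os, V) = net_of D e" "is_diagram D"
    using D unfolding realises_def by blast
  obtain f where f: "naming E f" "(is', os', V') = net_of E f" "is_diagram E"
    using E unfolding realises_def by blast
  let ?s = "length (verts D)" and ?sh = "shift_port (ins D) (outs D) (length (verts D))"
  define h where "h p = (case p of In i \<Rightarrow> if i < ins D then e p else f (In (i - ins D))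
    | Out i \<Rightarrow> if i < outs D then e p else f (Out (i - outs D))
    | Leg v i \<Rightarrow> if v < ?s then e p else f (Leg (v - ?s) i))" for p
  have hD: "h p = e p" if "p \<in> ports D" for p using that by (auto simp: ports_def h_def)
  have hE: "h (?sh p) = f p" for p by (cases p) (auto simp: h_def)
  have "h p = h q" if "(p, q) \<in> wires D" for p q
    using hD is_diagramD[OF e(3) that] namingD[OF e(1) that] by simp
  moreover have "h (?sh p) = h (?sh q)" if "(p, q) \<in> wires E" for p q
    using hE namingD[OF f(1) that] by simp
  ultimately have "naming (D \<otimes>\<^sub>z E) h"
    unfolding naming_def wires_tensor by auto
  moreover have "net_of (D \<otimes>\<^sub>z E) h = (is @ is', os @ os', V + V')"
  proof -
    have "net_verts (verts D @ verts E) h = net_verts (verts D) e + net_verts (verts E) f"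
      unfolding net_verts_append
      by (intro arg_cong2[of _ _ _ _ "(+)"] net_verts_cong) (auto simp: h_def)
    then show ?thesis using e(2) f(2) by (auto simp: net_of_def map_upt_append h_def)
  qed
  ultimately show ?thesis
    using is_diagram_tensor[OF e(3) f(3)] unfolding realises_def by metis
qed

lemma realises_tensorE:
  assumes DE: "realises (D \<otimes>\<^sub>z E) (is, os, U)" and diag: "is_diagram D" "is_diagram E"
  obtains is\<^sub>1 os\<^sub>1 V is\<^sub>2 os\<^sub>2 W where "is = is\<^sub>1 @ is\<^sub>2" "os = os\<^sub>1 @ os\<^sub>2" "U = V + W"
    "realises D (is\<^sub>1, os\<^sub>1, V)" "realises E (is\<^sub>2, os\<^sub>2, W)"
proof -
  obtain e where e: "naming (D \<otimes>\<^sub>z E) e" "(is, os, U) = net_of (D \<otimes>\<^sub>z E) e"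
    using DE unfolding realises_def by blast
  let ?sh = "shift_port (ins D) (outs D) (length (verts D))"
  have "naming D e" "naming E (e \<circ> ?sh)"
    using e(1) unfolding naming_def wires_tensor by auto
  then have D: "realises D (net_of D e)" and E: "realises E (net_of E (e \<circ> ?sh))"
    using diag unfolding realises_def by blast+
  have "net_verts (verts E) (\<lambda>p. case p of Leg v i \<Rightarrow> e (Leg (length (verts D) + v) i)) =
    net_verts (verts E) (e \<circ> ?sh)"
    by (rule net_verts_cong) simp
  then show ?thesis
    using e(2) D E unfolding net_of_def
    by (intro that) (simp_all add: map_upt_append net_verts_append)
qed

section \<open>Basic diagrams\<close>

lemma diagram_simps [simp]:
  "ins (wire_id n) = n" "outs (wire_id n) = n" "verts (wire_id n) = []"
  "ins wire_swap = 2" "outs wire_swap = 2" "verts wire_swap = []"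
  "ins wire_cup = 0" "outs wire_cup = 2" "verts wire_cup = []"
  "ins (vertex l m n) = m" "outs (vertex l m n) = n" "verts (vertex l m n) = [(l, m + n)]"
  "ins CNOT = 2" "outs CNOT = 2" "verts CNOT = [(Zl 0, 3), (Xl 0, 3)]"
  by (simp_all add: wire_id_def wire_swap_def wire_cup_def vertex_def CNOT_def)

lemma is_diagram_wire_id [simp]: "is_diagram (wire_id n)"
  unfolding is_diagram_matching by (auto intro!: matchingI symI simp: wire_id_def ports_def irrefl_def)

lemma is_diagram_wire_swap [simp]: "is_diagram wire_swap"
  unfolding is_diagram_matching
  by (auto intro!: matchingI symI simp: wire_swap_def ports_def irrefl_def less_2_cases_iff)

lemma is_diagram_wire_cup [simp]: "is_diagram wire_cup"
  unfolding is_diagram_matching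
  by (auto intro!: matchingI symI simp: wire_cup_def ports_def irrefl_def less_2_cases_iff)

lemma is_diagram_vertex [simp]:
  assumes "l = Hl \<longrightarrow> m + n = 2"
  shows "is_diagram (vertex l m n)"
  unfolding is_diagram_matching
proof (intro conjI)
  let ?D = "vertex l m n"
  show "matching (ports ?D) (wires ?D)"
  proof (rule matchingI)
    show "\<exists>q. (p, q) \<in> wires ?D" if "p \<in> ports ?D" for p
    proof (cases p)
      case (Leg v i)
      then show ?thesis
        using that by (cases "i < m") (auto simp: ports_def vertex_def intro: exI[of _ "In i"] exI[of _ "Out (i - m)"])
    qed (use that in \<open>auto simp: ports_def vertex_def\<close>)
  qed (auto intro!: symI simp: ports_def irrefl_def vertex_def)
qed (use assms in auto)

lemma is_diagram_CNOT [simp]: "is_diagram CNOT"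
proof -
  have legs: "legs (verts CNOT) = {Leg 0 0, Leg 0 1, Leg 0 2, Leg 1 0, Leg 1 1, Leg 1 2}"
    by (auto simp: numeral_3_eq_3 numeral_2_eq_2 less_Suc_eq)
  have "ports CNOT = {In 0, Leg 0 0} \<union> ({Leg 0 1, Out 0} \<union> ({Leg 0 2, Leg 1 0} \<union>
      ({In 1, Leg 1 1} \<union> ({Leg 1 2, Out 1} \<union> {}))))"
    unfolding ports_def legs by (auto simp: less_2_cases_iff)
  moreover have "wires CNOT = {(In 0, Leg 0 0), (Leg 0 0, In 0)} \<union> ({(Leg 0 1, Out 0), (Out 0, Leg 0 1)} \<union>
      ({(Leg 0 2, Leg 1 0), (Leg 1 0, Leg 0 2)} \<union> ({(In 1, Leg 1 1), (Leg 1 1, In 1)} \<union>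
      ({(Leg 1 2, Out 1), (Out 1, Leg 1 2)} \<union> {}))))"
    by (auto simp: CNOT_def Let_def)
  ultimately have "matching (ports CNOT) (wires CNOT)"
    by (simp only:) (intro matching_insert matching_empty; simp)
  then show ?thesis by (auto simp: is_diagram_matching)
qed

lemma realises_wire_id:
  assumes "length xs = n"
  shows "realises (wire_id n) (xs, xs, {#})"
proof -
  let ?e = "\<lambda>p. case p of In i \<Rightarrow> xs ! i | Out i \<Rightarrow> xs ! i"
  have "naming (wire_id n) ?e" by (auto simp: naming_def wire_id_def)
  moreover have "net_of (wire_id n) ?e = (xs, xs, {#})"
    using assms by (auto simp: net_of_def net_verts_def intro: nth_equalityI)
  ultimately show ?thesis unfolding realises_def by (metis is_diagram_wire_id)
qed

lemma realises_wire_idE: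
  assumes "realises (wire_id n) (is, os, V)"
  shows "os = is" "V = {#}" "length is = n"
proof -
  obtain e where e: "naming (wire_id n) e" "(is, os, V) = net_of (wire_id n) e"
    using assms unfolding realises_def by blast
  have N: "is = map (\<lambda>i. e (In i)) [0..<n]" "os = map (\<lambda>i. e (Out i)) [0..<n]" "V = {#}"
    using e(2) by (simp_all add: net_of_def net_verts_def)
  then show "V = {#}" "length is = n" by simp_all
  have "e (Out i) = e (In i)" if "i < n" for i
    using that by (intro namingD[OF e(1)]) (auto simp: wire_id_def)
  then show "os = is" unfolding N by simp
qed

lemma realises_wire_swap: "realises wire_swap ([x, y], [y, x], {#})"
proof -
  let ?e = "\<lambda>p. case p of In i \<Rightarrow> [x, y] ! i | Out i \<Rightarrow> [y, x] ! i"
  have "naming wire_swap ?e" by (auto simp: naming_def wire_swap_def)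
  moreover have "net_of wire_swap ?e = ([x, y], [y, x], {#})"
    by (auto simp: net_of_def net_verts_def numeral_2_eq_2)
  ultimately show ?thesis unfolding realises_def by (metis is_diagram_wire_swap)
qed

lemma realises_vertex:
  assumes "length xs = m" "length ys = n" "l = Hl \<Longrightarrow> m + n = 2"
  shows "realises (vertex l m n) (xs, ys, {#(l, mset xs + mset ys)#})"
proof -
  let ?e = "\<lambda>p. case p of In i \<Rightarrow> xs ! i | Out i \<Rightarrow> ys ! i | Leg v i \<Rightarrow> (xs @ ys) ! i"
  have "naming (vertex l m n) ?e" using assms by (auto simp: naming_def vertex_def nth_append)
  moreover have "map (\<lambda>i. (xs @ ys) ! i) [0..<m + n] = xs @ ys"
    using assms by (auto intro: nth_equalityI)
  then have "mset (map (\<lambda>i. (xs @ ys) ! i) [0..<m + n]) = mset xs + mset ys"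
    by (metis mset_append)
  then have "net_of (vertex l m n) ?e = (xs, ys, {#(l, mset xs + mset ys)#})"
    using assms by (auto simp: net_of_def net_verts_def intro: nth_equalityI)
  ultimately show ?thesis
    unfolding realises_def using is_diagram_vertex[of l m n] assms(3) by metis
qed

text \<open>The name \<open>x\<close> of the inner edge is free, so several copies of the gate can
  be given different inner names.\<close>

lemma realises_CNOT:
  "realises CNOT ([a, b], [c, d], {#(Zl 0, {#a, c, x#}), (Xl 0, {#x, b, d#})#})"
proof -
  let ?e = "\<lambda>p. case p of In i \<Rightarrow> [a, b] ! i | Out i \<Rightarrow> [c, d] ! i
    | Leg v i \<Rightarrow> (if v = 0 then [a, c, x] else [x, b, d]) ! i"
  have "naming CNOT ?e" by (auto simp: naming_def CNOT_def Let_def numeral_2_eq_2)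
  moreover have "net_of CNOT ?e = ([a, b], [c, d], {#(Zl 0, {#a, c, x#}), (Xl 0, {#x, b, d#})#})"
    by (simp add: net_of_def net_verts_def numeral_2_eq_2 numeral_3_eq_3 del: mset_map)
  ultimately show ?thesis unfolding realises_def by (metis is_diagram_CNOT)
qed

section \<open>Proper nets determine diagrams up to isomorphism\<close>

definition net_names :: "'a net \<Rightarrow> 'a multiset" where
  "net_names = (\<lambda>(is, os, V). mset is + mset os + \<Sum>\<^sub># (image_mset snd V))"

text \<open>Two occurrences per name put names and edges in bijection; evenness alone, which every
  realised net has, would leave the pairing of ports open. The second condition mirrors the fixed
  degree of \<open>H\<close> vertices.\<close>

definition proper :: "'a net \<Rightarrow> bool" where
  "proper N \<longleftrightarrow> (\<forall>x\<in>#net_names N. count (net_names N) x = 2) \<and>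
     (\<forall>A. (Hl, A) \<in># snd (snd N) \<longrightarrow> size A = 2)"

lemma mset_map_upt: "mset (map f [0..<n]) = image_mset f (mset_set {..<n})"
  by (simp add: lessThan_atLeast0)

lemma mset_map_upt_bij:
  assumes "bij_betw q {..<m} {..<n}"
  shows "mset (map (\<lambda>i. f (q i)) [0..<m]) = mset (map f [0..<n])"
proof -
  have "image_mset f (image_mset q (mset_set {..<m})) = image_mset f (mset_set {..<n})"
    using assms by (simp add: image_mset_mset_set bij_betw_def)
  then show ?thesis unfolding mset_map_upt by (simp add: multiset.map_comp comp_def)
qed

lemma mset_map_upt_eqE:
  assumes "mset (map f [0..<m]) = mset (map g [0..<n])"
  shows "\<exists>q. bij_betw q {..<m} {..<n} \<and> (\<forall>i<m. f i = g (q i))"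
proof -
  obtain p where p: "p permutes {..<length (map g [0..<n])}" "permute_list p (map g [0..<n]) = map f [0..<m]"
    using mset_eq_permutation[OF assms] by blast
  have mn: "m = n" using arg_cong[OF assms, of size] by simp
  have "f i = g (p i)" if "i < m" for i
  proof -
    have "p i < n" using permutes_in_image[OF p(1), of i] that mn by simp
    then show ?thesis
      using arg_cong[OF p(2), of "\<lambda>xs. xs ! i"] that mn permute_list_nth[OF p(1), of i] by simp
  qed
  moreover have "bij_betw p {..<m} {..<n}" using permutes_imp_bij[OF p(1)] mn by simp
  ultimately show ?thesis by blast
qed

lemma names_net_verts: "\<Sum>\<^sub># (image_mset snd (net_verts vs e)) = image_mset e (mset_set (legs vs))"
proof (induction vs rule: rev_induct)
  case (snoc v vs)
  let ?L = "Leg (length vs) ` {..<snd v}"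
  have "legs vs \<inter> ?L = {}" by auto
  then have L: "mset_set (legs (vs @ [v])) = mset_set (legs vs) + mset_set ?L"
    unfolding legs_snoc by (intro mset_set_Union) simp_all
  have L': "mset_set ?L = image_mset (Leg (length vs)) (mset_set {..<snd v})"
    by (rule image_mset_mset_set[symmetric]) (simp add: inj_on_def)
  have nv: "image_mset snd (net_verts [v] f) = {#image_mset (\<lambda>i. f (Leg 0 i)) (mset_set {..<snd v})#}" for f
    by (simp add: net_verts_def lessThan_atLeast0)
  show ?case
    unfolding L L' net_verts_append image_mset_union nv
    by (simp add: snoc.IH multiset.map_comp comp_def)
qed (simp add: net_verts_def)

lemma names_net_of: "net_names (net_of D e) = image_mset e (mset_set (ports D))"
proof -
  have "mset_set (ports D) = mset_set (In ` {..<ins D} \<union> Out ` {..<outs D}) + mset_set (legs (verts D))"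
    unfolding ports_def by (rule mset_set_Union) auto
  also have "mset_set (In ` {..<ins D} \<union> Out ` {..<outs D}) = mset_set (In ` {..<ins D}) + mset_set (Out ` {..<outs D})"
    by (rule mset_set_Union) auto
  also have "mset_set (In ` {..<ins D}) = image_mset In (mset_set {..<ins D})"
    by (rule image_mset_mset_set[symmetric]) (simp add: inj_on_def)
  also have "mset_set (Out ` {..<outs D}) = image_mset Out (mset_set {..<outs D})"
    by (rule image_mset_mset_set[symmetric]) (simp add: inj_on_def)
  finally show ?thesis
    by (simp add: net_names_def net_of_def names_net_verts mset_map_upt multiset.map_comp comp_def
        del: mset_map)
qed

lemma count_names: "count (net_names (net_of D e)) x = card {p \<in> ports D. e p = x}"
proof -
  have "count (net_names (net_of D e)) x = (\<Sum>p\<in>e -` {x} \<inter> ports D. count (mset_set (ports D)) p)"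
    unfolding names_net_of count_image_mset by simp
  also have "\<dots> = (\<Sum>p\<in>e -` {x} \<inter> ports D. 1)" by (rule sum.cong) auto
  also have "\<dots> = card (e -` {x} \<inter> ports D)" by simp
  also have "e -` {x} \<inter> ports D = {p \<in> ports D. e p = x}" by auto
  finally show ?thesis .
qed

lemma realises_even:
  assumes "realises D N"
  shows "even (count (net_names N) x)"
proof -
  obtain e where e: "naming D e" "N = net_of D e" "matching (ports D) (wires D)" "is_diagram D"
    using assms unfolding realises_def is_diagram_matching by blast
  show ?thesis unfolding e(2) count_names
  proof (rule matching_even_card[OF _ e(3)])
    show "q \<in> {p \<in> ports D. e p = x}" if "p \<in> {p \<in> ports D. e p = x}" "(p, q) \<in> wires D" for p q
      using that(1) namingD[OF e(1) that(2)] is_diagramD[OF e(4) that(2)] by simp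
  qed auto
qed

lemma proper_even:
  assumes "proper N"
  shows "even (count (net_names N) x)"
proof (cases "x \<in># net_names N")
  case True
  then show ?thesis using assms by (auto simp: proper_def)
qed (simp add: not_in_iff)

text \<open>The partner of \<open>p\<close> has the name of \<open>p\<close>, and only two ports
  bear this name. Edges can thus be read off from the names.\<close>

lemma wires_proper:
  assumes D: "is_diagram D" "naming D e" and N: "proper (net_of D e)"
  shows "(p, q) \<in> wires D \<longleftrightarrow> p \<in> ports D \<and> q \<in> ports D \<and> p \<noteq> q \<and> e p = e q"
proof
  have M: "matching (ports D) (wires D)" using D(1) by (simp add: is_diagram_matching)
  {
    assume pq: "(p, q) \<in> wires D"
    then show "p \<in> ports D \<and> q \<in> ports D \<and> p \<noteq> q \<and> e p = e q"
      using is_diagramD[OF D(1) pq] namingD[OF D(2) pq] matchingD(4)[OF M pq] by simp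
  next
    assume pq: "p \<in> ports D \<and> q \<in> ports D \<and> p \<noteq> q \<and> e p = e q"
    then obtain r where r: "(p, r) \<in> wires D" using matchingD(6)[OF M] by blast
    let ?F = "{s \<in> ports D. e s = e p}"
    have "count (net_names (net_of D e)) (e p) = 2"
      using N pq unfolding proper_def names_net_of by auto
    then have "card ?F = 2" unfolding count_names .
    moreover have "{p, r} \<subseteq> ?F" "p \<noteq> r"
      using pq is_diagramD[OF D(1) r] namingD[OF D(2) r] matchingD(4)[OF M r] by auto
    ultimately have "{p, r} = ?F" by (intro card_subset_eq) auto
    then have "q = r" using pq by auto
    then show "(p, q) \<in> wires D" using r by simp
  }
qed

lemma is_diagram_circles [simp]: "is_diagram (D\<lparr>circles := c\<rparr>) \<longleftrightarrow> is_diagram D"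
  unfolding is_diagram_def ports_def by simp

lemma bij_betw_map_port:
  assumes \<pi>: "bij_betw \<pi> {..<length (verts D)} {..<length (verts D')}"
    and \<phi>: "\<And>v. v < length (verts D) \<Longrightarrow> bij_betw (\<phi> v) {..<snd (verts D ! v)} {..<snd (verts D' ! \<pi> v)}"
    and len: "ins D = ins D'" "outs D = outs D'"
  shows "bij_betw (map_port \<pi> \<phi>) (ports D) (ports D')"
proof (rule bij_betw_imageI)
  show "inj_on (map_port \<pi> \<phi>) (ports D)"
  proof (rule inj_onI)
    fix p q assume pq: "p \<in> ports D" "q \<in> ports D" "map_port \<pi> \<phi> p = map_port \<pi> \<phi> q"
    show "p = q"
    proof (cases p)
      case (Leg v i)
      then obtain w j where q: "q = Leg w j" using pq(3) by (cases q) auto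
      then have vi: "v < length (verts D)" "i < snd (verts D ! v)" "w < length (verts D)" "j < snd (verts D ! w)"
        and eq: "\<pi> v = \<pi> w" "\<phi> v i = \<phi> w j"
        using pq Leg by (auto simp: ports_def)
      have "v = w" using inj_onD[OF bij_betw_imp_inj_on[OF \<pi>] eq(1)] vi by simp
      moreover then have "i = j" using inj_onD[OF bij_betw_imp_inj_on[OF \<phi>[OF vi(1)]], of i j] eq vi by simp
      ultimately show ?thesis using Leg q by simp
    qed (use pq(3) in \<open>cases q; simp\<close>)+
  qed
  show "map_port \<pi> \<phi> ` ports D = ports D'"
  proof (intro equalityI subsetI)
    fix p assume "p \<in> map_port \<pi> \<phi> ` ports D"
    then obtain q where q: "p = map_port \<pi> \<phi> q" "q \<in> ports D" by blast
    show "p \<in> ports D'"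
    proof (cases q)
      case (Leg v i)
      then have vi: "v < length (verts D)" "i < snd (verts D ! v)" using q by (auto simp: ports_def)
      have "\<pi> v < length (verts D')" using bij_betwE[OF \<pi>] vi by simp
      moreover have "\<phi> v i < snd (verts D' ! \<pi> v)" using bij_betwE[OF \<phi>[OF vi(1)]] vi by simp
      ultimately show ?thesis using Leg q by (simp add: ports_def)
    qed (use q len in \<open>auto simp: ports_def\<close>)
  next
    fix p assume p: "p \<in> ports D'"
    have "\<exists>q\<in>ports D. p = map_port \<pi> \<phi> q"
    proof (cases p)
      case (In i)
      then show ?thesis using p len by (intro bexI[of _ p]) (auto simp: ports_def)
    next
      case (Out i)
      then show ?thesis using p len by (intro bexI[of _ p]) (auto simp: ports_def)
    next
      case (Leg w j)
      then have wj: "w < length (verts D')" "j < snd (verts D' ! w)" using p by (auto simp: ports_def)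
      have "w \<in> \<pi> ` {..<length (verts D)}" using \<pi> wj by (simp add: bij_betw_def)
      then obtain v where v: "v < length (verts D)" "w = \<pi> v" by auto
      have "j \<in> \<phi> v ` {..<snd (verts D ! v)}" using \<phi>[OF v(1)] wj v by (simp add: bij_betw_def)
      then obtain i where "i < snd (verts D ! v)" "j = \<phi> v i" by auto
      then show ?thesis using v Leg by (intro bexI[of _ "Leg v i"]) (auto simp: ports_def)
    qed
    then show "p \<in> map_port \<pi> \<phi> ` ports D" by blast
  qed
qed

text \<open>Equal multisets give a bijection of the vertices and then, for each vertex, one of its
  legs, both preserving names. As names determine the edges on either side, these bijections form an
  isomorphism; closed edges are invisible to the net and are compared separately.\<close>

lemma iso_if_same_net:
  assumes D: "is_diagram D" "naming D e" and D': "is_diagram D'" "naming D' e'"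
    and net: "net_of D e = net_of D' e'" and proper: "proper (net_of D e)"
    and circ: "circles D = circles D'"
  shows "D \<simeq>\<^sub>z D'"
proof -
  let ?F = "\<lambda>D e v. (fst (verts D ! v), mset (map (\<lambda>i. e (Leg v i)) [0..<snd (verts D ! v)]))"
  have ins_map: "map (\<lambda>i. e (In i)) [0..<ins D] = map (\<lambda>i. e' (In i)) [0..<ins D']"
    and outs_map: "map (\<lambda>i. e (Out i)) [0..<outs D] = map (\<lambda>i. e' (Out i)) [0..<outs D']"
    and verts_map: "mset (map (?F D e) [0..<length (verts D)]) = mset (map (?F D' e') [0..<length (verts D')])"
    using net by (simp_all add: net_of_def net_verts_def del: mset_map)
  have len: "ins D = ins D'" "outs D = outs D'"
    using arg_cong[OF ins_map, of length] arg_cong[OF outs_map, of length] by simp_all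
  have e_In: "e (In i) = e' (In i)" if "i < ins D" for i
    using arg_cong[OF ins_map, of "\<lambda>xs. xs ! i"] that len by simp
  have e_Out: "e (Out i) = e' (Out i)" if "i < outs D" for i
    using arg_cong[OF outs_map, of "\<lambda>xs. xs ! i"] that len by simp
  obtain \<pi> where \<pi>: "bij_betw \<pi> {..<length (verts D)} {..<length (verts D')}"
    "\<And>v. v < length (verts D) \<Longrightarrow> ?F D e v = ?F D' e' (\<pi> v)"
    using mset_map_upt_eqE[OF verts_map] by auto
  have "\<exists>q. bij_betw q {..<snd (verts D ! v)} {..<snd (verts D' ! \<pi> v)} \<and>
      (\<forall>i<snd (verts D ! v). e (Leg v i) = e' (Leg (\<pi> v) (q i)))" if "v < length (verts D)" for v
    by (rule mset_map_upt_eqE) (use \<pi>(2)[OF that] in \<open>simp del: mset_map\<close>)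
  then obtain \<phi> where \<phi>: "\<And>v. v < length (verts D) \<Longrightarrow> bij_betw (\<phi> v) {..<snd (verts D ! v)} {..<snd (verts D' ! \<pi> v)}"
    "\<And>v i. v < length (verts D) \<Longrightarrow> i < snd (verts D ! v) \<Longrightarrow> e (Leg v i) = e' (Leg (\<pi> v) (\<phi> v i))"
    by metis
  let ?M = "map_port \<pi> \<phi>"
  have bij: "bij_betw ?M (ports D) (ports D')"
    by (rule bij_betw_map_port[OF \<pi>(1) \<phi>(1) len])
  have eM: "e' (?M p) = e p" if "p \<in> ports D" for p
    using that e_In e_Out \<phi>(2) by (auto simp: ports_def)
  have proper': "proper (net_of D' e')" using proper net by simp
  have "wires D' = map_prod ?M ?M ` wires D"
  proof (intro equalityI subrelI)
    fix p' q' assume pq: "(p', q') \<in> wires D'"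
    note w = iffD1[OF wires_proper[OF D' proper'] pq]
    then have "p' \<in> ?M ` ports D" "q' \<in> ?M ` ports D" using bij by (simp_all add: bij_betw_def)
    then obtain p q where p: "p \<in> ports D" "p' = ?M p" and q: "q \<in> ports D" "q' = ?M q" by blast
    then have "(p, q) \<in> wires D" using wires_proper[OF D proper, of p q] w eM by auto
    then show "(p', q') \<in> map_prod ?M ?M ` wires D" using p q by (metis imageI map_prod_simp)
  next
    fix p' q' assume "(p', q') \<in> map_prod ?M ?M ` wires D"
    then obtain p q where pq: "(p, q) \<in> wires D" "p' = ?M p" "q' = ?M q" by auto
    note w = iffD1[OF wires_proper[OF D proper] pq(1)]
    have "?M p \<noteq> ?M q" using bij w by (metis bij_betw_imp_inj_on inj_onD)
    moreover have "?M p \<in> ports D'" "?M q \<in> ports D'" using bij_betwE[OF bij] w by simp_all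
    ultimately show "(p', q') \<in> wires D'"
      using wires_proper[OF D' proper', of p' q'] pq w eM by simp
  qed
  moreover have "fst (verts D ! v) = fst (verts D' ! \<pi> v)" if "v < length (verts D)" for v
    using \<pi>(2)[OF that] by simp
  ultimately show ?thesis
    unfolding zx_iso_def using D(1) D'(1) len circ \<pi>(1) \<phi>(1) by blast
qed

lemma zx_iso_refl: "is_diagram D \<Longrightarrow> D \<simeq>\<^sub>z D"
proof -
  assume D: "is_diagram D"
  have "map_port id (\<lambda>_. id) p = p" for p by (cases p) auto
  then have "map_port id (\<lambda>_. id) = id" by auto
  then have "wires D = map_prod (map_port id (\<lambda>_. id)) (map_port id (\<lambda>_. id)) ` wires D"
    by (simp add: map_prod.id)
  then show ?thesis
    unfolding zx_iso_def using D
    by (intro conjI exI[of _ id] exI[of _ "\<lambda>_. id"] allI impI) (simp_all only: id_apply refl bij_betw_id)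
qed

lemma zx_iso_realises:
  assumes "D \<simeq>\<^sub>z D'" "realises D' N"
  shows "realises D N"
proof -
  obtain \<pi> \<phi> where \<pi>: "bij_betw \<pi> {..<length (verts D)} {..<length (verts D')}"
    and \<phi>: "\<And>v. v < length (verts D) \<Longrightarrow> fst (verts D ! v) = fst (verts D' ! \<pi> v)"
      "\<And>v. v < length (verts D) \<Longrightarrow> bij_betw (\<phi> v) {..<snd (verts D ! v)} {..<snd (verts D' ! \<pi> v)}"
    and w: "wires D' = map_prod (map_port \<pi> \<phi>) (map_port \<pi> \<phi>) ` wires D"
    and D: "is_diagram D" "ins D = ins D'" "outs D = outs D'"
    using assms(1) unfolding zx_iso_def by blast
  obtain e where e: "naming D' e" "N = net_of D' e" using assms(2) unfolding realises_def by blast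
  let ?e = "\<lambda>p. e (map_port \<pi> \<phi> p)"
  let ?F = "\<lambda>v. (fst (verts D' ! v), mset (map (\<lambda>i. e (Leg v i)) [0..<snd (verts D' ! v)]))"
  have "naming D ?e" using e(1) w by (auto simp: naming_def)
  moreover have "net_verts (verts D) ?e = net_verts (verts D') e"
  proof -
    have eq: "map (\<lambda>v. (fst (verts D ! v), mset (map (\<lambda>i. ?e (Leg v i)) [0..<snd (verts D ! v)]))) [0..<length (verts D)]
        = map (\<lambda>v. ?F (\<pi> v)) [0..<length (verts D)]"
      using \<phi>(1) mset_map_upt_bij[OF \<phi>(2)] by (intro map_cong) (auto simp del: mset_map)
    show ?thesis unfolding net_verts_def eq by (rule mset_map_upt_bij[OF \<pi>])
  qed
  then have "net_of D ?e = N" unfolding e(2) net_of_def using D by simp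
  ultimately show ?thesis using D(1) unfolding realises_def by metis
qed

lemma net_of_H:
  assumes "is_diagram D" "(Hl, A) \<in># net_verts (verts D) e"
  shows "size A = 2"
proof -
  obtain v where v: "v < length (verts D)" "fst (verts D ! v) = Hl" "A = mset (map (\<lambda>i. e (Leg v i)) [0..<snd (verts D ! v)])"
    using assms(2) unfolding net_verts_def by auto
  have "(Hl, snd (verts D ! v)) \<in> set (verts D)" using v nth_mem[OF v(1)] by (metis prod.collapse)
  then have "snd (verts D ! v) = 2" using assms(1) unfolding is_diagram_def by blast
  then show ?thesis using v(3) by simp
qed

text \<open>Each port is named by its edge, taken as the set of its two ends. Names of type
  \<open>zx_port set\<close> therefore suffice to test any diagram.\<close>

lemma ex_proper_net:
  assumes D: "is_diagram D"
  shows "\<exists>N :: zx_port set net. realises D N \<and> proper N"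
proof -
  have M: "matching (ports D) (wires D)" using D by (simp add: is_diagram_matching)
  define e where "e p = insert p {q. (p, q) \<in> wires D}" for p
  have e: "e p = {p, q}" if "(p, q) \<in> wires D" for p q
    using that matchingD(5)[OF M that] unfolding e_def by blast
  have "naming D e"
    unfolding naming_def
  proof clarify
    fix p q assume pq: "(p, q) \<in> wires D"
    show "e p = e q" unfolding e[OF pq] e[OF is_diagramD(3)[OF D pq]] by blast
  qed
  moreover have "card {q \<in> ports D. e q = x} = 2" if x: "x \<in># net_names (net_of D e)" for x
  proof -
    obtain p where p: "p \<in> ports D" "x = e p" using x unfolding names_net_of by auto
    obtain q where q: "(p, q) \<in> wires D" using matchingD(6)[OF M p(1)] by blast
    have "r \<in> e r" for r by (simp add: e_def)
    then have "{q \<in> ports D. e q = x} \<subseteq> {p, q}" using e[OF q] p(2) by auto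
    moreover have "{p, q} \<subseteq> {q \<in> ports D. e q = x}"
      using is_diagramD[OF D q] e[OF q] e[OF is_diagramD(3)[OF D q]] p by auto
    ultimately have "{q \<in> ports D. e q = x} = {p, q}" by blast
    then show ?thesis using matchingD(4)[OF M q] by simp
  qed
  then have "proper (net_of D e)"
    unfolding proper_def count_names using net_of_H[OF D] by (auto simp: net_of_def)
  ultimately show ?thesis
    using D unfolding realises_def by blast
qed

text \<open>Multisets are listed in an arbitrary order and \<open>ex_matching\<close> picks the
  edges. The hypothesis is evenness instead of properness because the contexts of a rule application
  repeat names.\<close>

lemma ex_realiser:
  assumes even: "\<And>x. even (count (net_names N) x)" and H: "\<And>A. (Hl, A) \<in># snd (snd N) \<Longrightarrow> size A = 2"
  shows "\<exists>D. realises D N"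
proof -
  obtain "is" os V where N: "N = (is, os, V)" by (cases N)
  obtain vs where V: "V = mset vs" by (metis ex_mset)
  define ls where "ls A = (SOME xs. mset xs = A)" for A :: "'a multiset"
  have ls: "mset (ls A) = A" for A unfolding ls_def by (rule someI_ex) (rule ex_mset)
  have ls_len: "length (ls A) = size A" for A using ls by (metis size_mset)
  define D where "D W = \<lparr>ins = length is, outs = length os, verts = map (\<lambda>(l, A). (l, size A)) vs,
    wires = W, circles = 0\<rparr>" for W
  define e where "e p = (case p of In i \<Rightarrow> is ! i | Out i \<Rightarrow> os ! i | Leg v i \<Rightarrow> ls (snd (vs ! v)) ! i)" for p
  have "net_verts (verts (D {})) e = mset vs"
  proof -
    have "mset (map (\<lambda>i. ls A ! i) [0..<size A]) = A" for A
      using ls ls_len map_nth by metis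
    then have "map (\<lambda>v. (fst (verts (D {}) ! v), mset (map (\<lambda>i. e (Leg v i)) [0..<snd (verts (D {}) ! v)])))
        [0..<length (verts (D {}))] = vs"
      by (intro nth_equalityI) (auto simp: D_def e_def case_prod_beta simp del: mset_map)
    then show ?thesis unfolding net_verts_def by simp
  qed
  then have net: "net_of (D W) e = N" for W
    unfolding N V net_of_def by (simp add: D_def e_def map_nth)
  have "even (card {p \<in> ports (D {}). e p = x})" for x
    using even[of x] unfolding net[of "{}", symmetric] count_names by simp
  then obtain W where W: "matching (ports (D {})) W" "\<forall>(p, q)\<in>W. e p = e q"
    using ex_matching[of "ports (D {})" e] by auto
  have "ports (D W) = ports (D {})" by (simp add: ports_def D_def)
  then have "is_diagram (D W)"
    using W(1) H unfolding is_diagram_matching by (auto simp: D_def N V)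
  moreover have "naming (D W) e" using W(2) by (auto simp: naming_def D_def)
  ultimately show ?thesis using net unfolding realises_def by metis
qed

lemma realises_length:
  assumes "realises D (is, os, V)"
  shows "length is = ins D" "length os = outs D" "is_diagram D"
  using assms unfolding realises_def net_of_def by auto


section \<open>Closed edges are irrelevant\<close>

lemma zx_equiv_refl [simp]: "D \<leftrightarrow>\<^sub>* D"
  unfolding zx_equiv_def by (rule equivclp_refl)

lemma zx_equiv_sym: "D \<leftrightarrow>\<^sub>* E \<Longrightarrow> E \<leftrightarrow>\<^sub>* D"
  unfolding zx_equiv_def by (rule equivclp_sym)

lemma zx_equiv_trans [trans]: "D \<leftrightarrow>\<^sub>* E \<Longrightarrow> E \<leftrightarrow>\<^sub>* F \<Longrightarrow> D \<leftrightarrow>\<^sub>* F"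
  unfolding zx_equiv_def by (rule equivclp_trans)

lemma zx_equiv_iso: "D \<simeq>\<^sub>z E \<Longrightarrow> D \<leftrightarrow>\<^sub>* E"
  unfolding zx_equiv_def by (rule r_into_equivclp) simp

lemma zx_equiv_step: "zx_step D E \<Longrightarrow> D \<leftrightarrow>\<^sub>* E"
  unfolding zx_equiv_def by (rule r_into_equivclp) simp

lemma matching_subset_eq:
  assumes M: "matching P M" and N: "matching P N" and sub: "M \<subseteq> N"
  shows "M = N"
proof (intro equalityI sub subrelI)
  fix p q assume pq: "(p, q) \<in> N"
  then obtain r where r: "(p, r) \<in> M" using matchingD(1)[OF N pq] matchingD(6)[OF M] by blast
  then show "(p, q) \<in> M" using matchingD(5)[OF N pq, of r] sub by auto
qed

text \<open>Old edges remain edges of the composite, and a perfect matching has no proper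
  sub-matching on the same ports. For \<open>d = 1\<close> the outer diagram supplies the circle
  that the scalar rule removes; for \<open>d = 0\<close> this is the left unit law as a literal
  equality.\<close>

lemma comp_wire_id_circles:
  assumes E: "is_diagram E" "outs E = n"
  shows "wire_id n\<lparr>circles := d\<rparr> \<circ>\<^sub>z E = E\<lparr>circles := circles E + d\<rparr>"
proof -
  let ?I = "wire_id n\<lparr>circles := d\<rparr>" and ?R = "(glue_wires (wire_id n\<lparr>circles := d\<rparr>) E)\<^sup>*"
  have mid: "(Inl i, Inr (Out i)) \<in> ?R" "(Inr (Out i), Inl i) \<in> ?R" if "i < n" for i
    by (intro r_into_rtrancl; use that in \<open>force simp: glue_wires_def wire_id_def\<close>)+
  have out: "(Inr p, lower_port p) \<in> ?R \<and> (lower_port p, Inr p) \<in> ?R" if "p \<in> ports E" for p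
    using that mid E(2) by (cases p) (auto simp: ports_def)
  have "is_diagram (?I \<circ>\<^sub>z E)" using E by (intro is_diagram_comp) auto
  moreover have "ports (?I \<circ>\<^sub>z E) = ports E" using E(2) by (simp add: ports_def)
  moreover have "wires E \<subseteq> wires (?I \<circ>\<^sub>z E)"
  proof (rule subrelI)
    fix p q assume pq: "(p, q) \<in> wires E"
    have "(lower_port p, lower_port q) \<in> glue_wires ?I E"
      using pq unfolding glue_wires_def by (metis UnI1 imageI map_prod_simp)
    then have "(Inr p, Inr q) \<in> ?R"
      using out[OF is_diagramD(1)[OF E(1) pq]] out[OF is_diagramD(2)[OF E(1) pq]]
      by (meson r_into_rtrancl rtrancl_trans)
    moreover have "p \<noteq> q"
      using pq E(1) matchingD(4) unfolding is_diagram_matching by metis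
    ultimately show "(p, q) \<in> wires (?I \<circ>\<^sub>z E)" by (simp add: zx_comp_def)
  qed
  ultimately have "wires (?I \<circ>\<^sub>z E) = wires E"
    using E(1) matching_subset_eq unfolding is_diagram_matching by metis
  moreover have "circles (?I \<circ>\<^sub>z E) = circles E + d"
  proof -
    have "\<not> ?R `` {Inl i} \<subseteq> range Inl" if "i < n" for i
      using mid(1)[OF that] by (auto dest!: subsetD)
    then have "{C. \<exists>i<outs E. C = ?R `` {Inl i} \<and> C \<subseteq> range Inl} = {}" using E(2) by auto
    then show ?thesis by (simp add: zx_comp_def)
  qed
  ultimately show ?thesis using E(2) by (intro zx_diagram.equality) auto
qed

lemma tensor_wire_id_0: "wire_id 0\<lparr>circles := c\<rparr> \<otimes>\<^sub>z wire_id n = wire_id n\<lparr>circles := c\<rparr>"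
proof -
  have "shift_port 0 0 0 p = p" for p by (cases p) auto
  then have "shift_port 0 0 0 = id" by auto
  then show ?thesis by (simp add: zx_tensor_def Let_def wire_id_def map_prod.id)
qed

text \<open>A closed edge has the value 2 and hence is a non-zero scalar.\<close>

lemma zx_replace_circle: "zx_replace (wire_id 0\<lparr>circles := 1\<rparr>) (wire_id 0)"
proof (rule zx_replace.scalar)
  let ?S = "wire_id 0\<lparr>circles := 1\<rparr>"
  have "edge_bits ?S = {\<lambda>_. False}" by (auto simp: edge_bits_def ports_def wire_id_def)
  then show "scalar_value ?S \<noteq> 0" by (simp add: scalar_value_def)
qed simp_all

lemma zx_equiv_circles:
  assumes D: "is_diagram D"
  shows "D \<leftrightarrow>\<^sub>* D\<lparr>circles := c\<rparr>"
proof -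
  have step: "D\<lparr>circles := Suc c\<rparr> \<leftrightarrow>\<^sub>* D\<lparr>circles := c\<rparr>" for c
  proof (rule zx_equiv_step, rule zx_step.intros[OF zx_replace_circle])
    let ?n = "outs D"
    have id: "wire_id ?n \<circ>\<^sub>z E = E" "wire_id 0 \<otimes>\<^sub>z wire_id ?n = wire_id ?n" if "is_diagram E" "outs E = ?n" for E
      using comp_wire_id_circles[of E ?n 0] tensor_wire_id_0[of 0 ?n] that by (simp_all add: wire_id_def)
    show "is_diagram (wire_id ?n)" "is_diagram (D\<lparr>circles := c\<rparr>)" using D by simp_all
    show "D\<lparr>circles := Suc c\<rparr> \<simeq>\<^sub>z wire_id ?n \<circ>\<^sub>z (wire_id 0\<lparr>circles := 1\<rparr> \<otimes>\<^sub>z wire_id ?n) \<circ>\<^sub>z D\<lparr>circles := c\<rparr>"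
      using comp_wire_id_circles[of "D\<lparr>circles := c\<rparr>" ?n 1] id[of "D\<lparr>circles := Suc c\<rparr>"] D
      by (simp add: tensor_wire_id_0 zx_iso_refl)
    show "D\<lparr>circles := c\<rparr> \<simeq>\<^sub>z wire_id ?n \<circ>\<^sub>z (wire_id 0 \<otimes>\<^sub>z wire_id ?n) \<circ>\<^sub>z D\<lparr>circles := c\<rparr>"
      using id[of "D\<lparr>circles := c\<rparr>"] D by (simp add: zx_iso_refl)
  qed auto
  have zero: "D\<lparr>circles := c\<rparr> \<leftrightarrow>\<^sub>* D\<lparr>circles := 0\<rparr>" for c
    by (induction c) (auto intro: zx_equiv_trans step)
  have "D\<lparr>circles := circles D\<rparr> \<leftrightarrow>\<^sub>* D\<lparr>circles := c\<rparr>"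
    using zero zx_equiv_sym zx_equiv_trans by blast
  then show ?thesis by simp
qed

lemma realises_equiv:
  assumes "realises D N" "realises D' N" "proper N"
  shows "D \<leftrightarrow>\<^sub>* D'"
proof -
  obtain e where e: "naming D e" "N = net_of D e" "is_diagram D" using assms(1) unfolding realises_def by blast
  obtain f where f: "naming D' f" "N = net_of D' f" "is_diagram D'" using assms(2) unfolding realises_def by blast
  let ?E = "D'\<lparr>circles := circles D\<rparr>"
  have "D \<simeq>\<^sub>z ?E"
  proof (rule iso_if_same_net[OF e(3,1)])
    show "naming ?E f" "is_diagram ?E" using f by (simp_all add: naming_def)
    show "net_of D e = net_of ?E f" using e(2) f(2) by (simp add: net_of_def)
  qed (use assms(3) e(2) in auto)
  then show ?thesis
    using zx_equiv_circles[OF f(3)] zx_equiv_iso zx_equiv_sym zx_equiv_trans by meson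
qed

text \<open>Applied to a proper net of \<open>D\<close>, the hypothesis makes both diagrams realise
  it. Structural laws such as associativity are thereby reduced to taking a net apart and
  reassembling it.\<close>

lemma equiv_if_same_nets:
  assumes "is_diagram D" "\<And>N :: zx_port set net. realises D N \<Longrightarrow> realises E N"
  shows "D \<leftrightarrow>\<^sub>* E"
  using ex_proper_net[OF assms(1)] assms(2) realises_equiv by metis

section \<open>Congruence\<close>

text \<open>A net splits at both cuts and can be put together in the other order. The circles
  created by nested gluings are never compared, since closed edges are irrelevant.\<close>

lemma zx_comp_assoc:
  assumes d: "is_diagram f" "is_diagram g" "is_diagram h" and len: "outs h = ins g" "outs g = ins f"
  shows "(f \<circ>\<^sub>z g) \<circ>\<^sub>z h \<leftrightarrow>\<^sub>* f \<circ>\<^sub>z (g \<circ>\<^sub>z h)"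
proof (rule equiv_if_same_nets)
  have fg: "is_diagram (f \<circ>\<^sub>z g)" using d len by (intro is_diagram_comp)
  show "is_diagram ((f \<circ>\<^sub>z g) \<circ>\<^sub>z h)" using fg d len by (intro is_diagram_comp) simp_all
  fix N :: "zx_port set net"
  assume N: "realises ((f \<circ>\<^sub>z g) \<circ>\<^sub>z h) N"
  obtain "is" os U where eq: "N = (is, os, U)" by (cases N)
  obtain ms V W where 1: "U = V + W" "realises h (is, ms, V)" "realises (f \<circ>\<^sub>z g) (ms, os, W)"
    using realises_compE[OF N[unfolded eq] fg d(3)] len(1) unfolding zx_comp_simps by metis
  obtain ns V' W' where 2: "W = V' + W'" "realises g (ms, ns, V')" "realises f (ns, os, W')"
    using realises_compE[OF 1(3) d(1,2) len(2)] by blast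
  show "realises (f \<circ>\<^sub>z (g \<circ>\<^sub>z h)) N"
    using realises_comp[OF realises_comp[OF 1(2) 2(2)] 2(3)] unfolding eq 1(1) 2(1) by (simp add: add.assoc)
qed

lemma is_diagram_tensor_power: "is_diagram D \<Longrightarrow> is_diagram (tensor_power D n)"
  by (induction n) (auto intro: is_diagram_tensor)

lemma tensor_power_size [simp]: "ins (tensor_power D n) = n * ins D" "outs (tensor_power D n) = n * outs D"
  by (induction n) auto

lemma zx_rule_diagram:
  assumes "zx_rule L R"
  shows "is_diagram L \<and> is_diagram R \<and> ins L = ins R \<and> outs L = outs R"
  using assms
  by cases (auto intro!: is_diagram_comp is_diagram_tensor is_diagram_tensor_power)

lemma colour_swap_simps [simp]:
  "ins (colour_swap D) = ins D" "outs (colour_swap D) = outs D" "wires (colour_swap D) = wires D"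
  "verts (colour_swap D) = map (map_prod swap_label id) (verts D)"
  by (simp_all add: colour_swap_def)

lemma swap_label_eq_H [simp]: "swap_label l = Hl \<longleftrightarrow> l = Hl"
  by (cases l) auto

lemma ports_colour_swap [simp]: "ports (colour_swap D) = ports D"
proof -
  have "snd (map (map_prod swap_label id) (verts D) ! v) = snd (verts D ! v)" if "v < length (verts D)" for v
    using that by simp
  then have "legs (verts (colour_swap D)) = legs (verts D)" by (auto simp del: nth_map)
  then show ?thesis unfolding ports_def by simp
qed

lemma is_diagram_colour_swap: "is_diagram D \<Longrightarrow> is_diagram (colour_swap D)"
  unfolding is_diagram_matching by (auto simp: image_iff map_prod_def split: prod.splits) (metis swap_label_eq_H)

lemma zx_replace_diagram:
  assumes "zx_replace L R"
  shows "is_diagram L" "is_diagram R" "ins L = ins R" "outs L = outs R"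
  using assms zx_rule_diagram by (cases; auto intro: is_diagram_colour_swap)+

lemma zx_step_context:
  assumes rep: "zx_replace L R" and d: "is_diagram g" "is_diagram k" "outs k = ins L + n" "ins g = outs L + n"
  shows "zx_step (g \<circ>\<^sub>z (L \<otimes>\<^sub>z wire_id n) \<circ>\<^sub>z k) (g \<circ>\<^sub>z (R \<otimes>\<^sub>z wire_id n) \<circ>\<^sub>z k)"
proof -
  note LR = zx_replace_diagram[OF rep]
  have "is_diagram (g \<circ>\<^sub>z (X \<otimes>\<^sub>z wire_id n) \<circ>\<^sub>z k)" if X: "is_diagram X" "ins X = ins L" "outs X = outs L" for X
  proof -
    have "is_diagram (X \<otimes>\<^sub>z wire_id n)" using X by (simp add: is_diagram_tensor)
    then have "is_diagram ((X \<otimes>\<^sub>z wire_id n) \<circ>\<^sub>z k)" using d X by (simp add: is_diagram_comp)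
    then show ?thesis using d X by (simp add: is_diagram_comp)
  qed
  then show ?thesis using LR by (intro zx_step.intros[OF rep d] zx_iso_refl) simp_all
qed

lemma zx_equiv_comp_iso:
  assumes "D \<simeq>\<^sub>z E" "is_diagram g" "ins g = outs D"
  shows "g \<circ>\<^sub>z D \<leftrightarrow>\<^sub>* g \<circ>\<^sub>z E"
proof -
  have d: "is_diagram D" "is_diagram E" "outs D = outs E" using assms(1) unfolding zx_iso_def by auto
  have "g \<circ>\<^sub>z E \<leftrightarrow>\<^sub>* g \<circ>\<^sub>z D"
  proof (rule equiv_if_same_nets)
    show "is_diagram (g \<circ>\<^sub>z E)" using assms d by (intro is_diagram_comp) simp_all
    fix N :: "zx_port set net" assume N: "realises (g \<circ>\<^sub>z E) N"
    obtain "is" os U where eq: "N = (is, os, U)" by (cases N)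
    obtain ms V W where "U = V + W" "realises E (is, ms, V)" "realises g (ms, os, W)"
      using realises_compE[OF N[unfolded eq] assms(2) d(2)] assms(3) d(3) by metis
    then show "realises (g \<circ>\<^sub>z D) N" unfolding eq using realises_comp zx_iso_realises[OF assms(1)] by metis
  qed
  then show ?thesis by (rule zx_equiv_sym)
qed

lemma zx_equiv_iso_comp:
  assumes "D \<simeq>\<^sub>z E" "is_diagram k" "outs k = ins D"
  shows "D \<circ>\<^sub>z k \<leftrightarrow>\<^sub>* E \<circ>\<^sub>z k"
proof -
  have d: "is_diagram D" "is_diagram E" "ins D = ins E" using assms(1) unfolding zx_iso_def by auto
  have "E \<circ>\<^sub>z k \<leftrightarrow>\<^sub>* D \<circ>\<^sub>z k"
  proof (rule equiv_if_same_nets)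
    show "is_diagram (E \<circ>\<^sub>z k)" using assms d by (intro is_diagram_comp) simp_all
    fix N :: "zx_port set net" assume N: "realises (E \<circ>\<^sub>z k) N"
    obtain "is" os U where eq: "N = (is, os, U)" by (cases N)
    obtain ms V W where "U = V + W" "realises k (is, ms, V)" "realises E (ms, os, W)"
      using realises_compE[OF N[unfolded eq] d(2) assms(2)] assms(3) d(3) by metis
    then show "realises (D \<circ>\<^sub>z k) N" unfolding eq using realises_comp zx_iso_realises[OF assms(1)] by metis
  qed
  then show ?thesis by (rule zx_equiv_sym)
qed

lemma zx_step_size:
  assumes "zx_step D E"
  shows "is_diagram D" "is_diagram E" "ins D = ins E" "outs D = outs E"
  using assms by (cases; auto simp: zx_iso_def)+

text \<open>The diagram \<open>h\<close> is absorbed into the context: \<open>g\<close> is enlarged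
  to \<open>h \<circ>\<^sub>z g\<close>, and the same replacement takes place in the new
  context.\<close>

lemma zx_step_comp:
  assumes "zx_step D E" "is_diagram h" "ins h = outs D"
  shows "h \<circ>\<^sub>z D \<leftrightarrow>\<^sub>* h \<circ>\<^sub>z E"
  using assms(1)
proof cases
  case (1 L R g k n)
  note LR = zx_replace_diagram[OF 1(1)]
  have out: "outs g = ins h" using 1(6) assms(3) by (simp add: zx_iso_def)
  have hg: "is_diagram (h \<circ>\<^sub>z g)" using assms(2) 1(2) out by (intro is_diagram_comp)
  have mid: "is_diagram ((X \<otimes>\<^sub>z wire_id n) \<circ>\<^sub>z k)"
    "(h \<circ>\<^sub>z g) \<circ>\<^sub>z (X \<otimes>\<^sub>z wire_id n) \<circ>\<^sub>z k \<leftrightarrow>\<^sub>* h \<circ>\<^sub>z g \<circ>\<^sub>z (X \<otimes>\<^sub>z wire_id n) \<circ>\<^sub>z k"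
    if X: "is_diagram X" "ins X = ins L" "outs X = outs L" for X
  proof -
    show d: "is_diagram ((X \<otimes>\<^sub>z wire_id n) \<circ>\<^sub>z k)"
      using X 1 by (intro is_diagram_comp is_diagram_tensor) simp_all
    show "(h \<circ>\<^sub>z g) \<circ>\<^sub>z (X \<otimes>\<^sub>z wire_id n) \<circ>\<^sub>z k \<leftrightarrow>\<^sub>* h \<circ>\<^sub>z g \<circ>\<^sub>z (X \<otimes>\<^sub>z wire_id n) \<circ>\<^sub>z k"
      by (rule zx_comp_assoc[OF assms(2) 1(2) d]) (use X 1 out in simp_all)
  qed
  have "h \<circ>\<^sub>z D \<leftrightarrow>\<^sub>* h \<circ>\<^sub>z g \<circ>\<^sub>z (L \<otimes>\<^sub>z wire_id n) \<circ>\<^sub>z k"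
    by (rule zx_equiv_comp_iso[OF 1(6) assms(2,3)])
  also have "\<dots> \<leftrightarrow>\<^sub>* (h \<circ>\<^sub>z g) \<circ>\<^sub>z (L \<otimes>\<^sub>z wire_id n) \<circ>\<^sub>z k"
    using mid(2)[of L] LR by (simp add: zx_equiv_sym)
  also have "\<dots> \<leftrightarrow>\<^sub>* (h \<circ>\<^sub>z g) \<circ>\<^sub>z (R \<otimes>\<^sub>z wire_id n) \<circ>\<^sub>z k"
    by (rule zx_equiv_step, rule zx_step_context[OF 1(1) hg 1(3,4)]) (use 1(5) in simp)
  also have "\<dots> \<leftrightarrow>\<^sub>* h \<circ>\<^sub>z g \<circ>\<^sub>z (R \<otimes>\<^sub>z wire_id n) \<circ>\<^sub>z k"
    using mid(2)[of R] LR by simp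
  also have "\<dots> \<leftrightarrow>\<^sub>* h \<circ>\<^sub>z E"
    by (rule zx_equiv_sym, rule zx_equiv_comp_iso[OF 1(7) assms(2)])
      (use assms(3) zx_step_size[OF assms(1)] in simp)
  finally show ?thesis .
qed

lemma zx_equiv_comp_left:
  assumes "D \<leftrightarrow>\<^sub>* E" "is_diagram g" "ins g = outs D"
  shows "g \<circ>\<^sub>z D \<leftrightarrow>\<^sub>* g \<circ>\<^sub>z E"
proof -
  have one: "outs X = outs Y \<and> (ins g = outs X \<longrightarrow> g \<circ>\<^sub>z X \<leftrightarrow>\<^sub>* g \<circ>\<^sub>z Y)" if "X \<simeq>\<^sub>z Y \<or> zx_step X Y" for X Y
    using that
  proof
    assume "X \<simeq>\<^sub>z Y"
    then show ?thesis using zx_equiv_comp_iso assms(2) by (auto simp: zx_iso_def)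
  next
    assume "zx_step X Y"
    then show ?thesis using zx_step_comp zx_step_size assms(2) by simp
  qed
  have "equivclp (\<lambda>D E. D \<simeq>\<^sub>z E \<or> zx_step D E) D E" using assms(1) unfolding zx_equiv_def .
  \<comment> \<open>The induction also carries the number of outputs, so that \<open>g\<close> fits
    every diagram of the chain.\<close>
  then have "outs D = outs E \<and> g \<circ>\<^sub>z D \<leftrightarrow>\<^sub>* g \<circ>\<^sub>z E"
  proof (induction rule: equivclp_induct)
    case (step Y Z)
    have "outs Y = outs Z \<and> g \<circ>\<^sub>z Y \<leftrightarrow>\<^sub>* g \<circ>\<^sub>z Z"
      using step.hyps(2) one[of Y Z] one[of Z Y] step.IH assms(3) by (auto intro: zx_equiv_sym)
    then show ?case using step.IH by (auto intro: zx_equiv_trans)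
  qed simp
  then show ?thesis ..
qed

text \<open>Dual to \<open>zx_step_comp\<close>: here \<open>k\<close> is enlarged to
  \<open>k \<circ>\<^sub>z h\<close>.\<close>

lemma zx_step_precomp:
  assumes "zx_step D E" "is_diagram h" "outs h = ins D"
  shows "D \<circ>\<^sub>z h \<leftrightarrow>\<^sub>* E \<circ>\<^sub>z h"
  using assms(1)
proof cases
  case (1 L R g k n)
  note LR = zx_replace_diagram[OF 1(1)]
  have inn: "ins k = outs h" using 1(6) assms(3) by (simp add: zx_iso_def)
  have kh: "is_diagram (k \<circ>\<^sub>z h)" using assms(2) 1(3) inn by (intro is_diagram_comp) simp_all
  have mid: "is_diagram ((X \<otimes>\<^sub>z wire_id n) \<circ>\<^sub>z k \<circ>\<^sub>z h)"
    "(g \<circ>\<^sub>z (X \<otimes>\<^sub>z wire_id n) \<circ>\<^sub>z k) \<circ>\<^sub>z h \<leftrightarrow>\<^sub>* g \<circ>\<^sub>z (X \<otimes>\<^sub>z wire_id n) \<circ>\<^sub>z k \<circ>\<^sub>z h"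
    if X: "is_diagram X" "ins X = ins L" "outs X = outs L" for X
  proof -
    let ?X = "X \<otimes>\<^sub>z wire_id n"
    have XI: "is_diagram ?X" using X by (intro is_diagram_tensor) simp_all
    show "is_diagram (?X \<circ>\<^sub>z k \<circ>\<^sub>z h)" by (rule is_diagram_comp[OF XI kh]) (use X 1 in simp_all)
    show "(g \<circ>\<^sub>z ?X \<circ>\<^sub>z k) \<circ>\<^sub>z h \<leftrightarrow>\<^sub>* g \<circ>\<^sub>z ?X \<circ>\<^sub>z k \<circ>\<^sub>z h"
    proof -
      have Xk: "is_diagram (?X \<circ>\<^sub>z k)" using XI X 1 by (intro is_diagram_comp) simp_all
      have "(g \<circ>\<^sub>z ?X \<circ>\<^sub>z k) \<circ>\<^sub>z h \<leftrightarrow>\<^sub>* g \<circ>\<^sub>z ((?X \<circ>\<^sub>z k) \<circ>\<^sub>z h)"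
        by (rule zx_comp_assoc[OF 1(2) Xk assms(2)]) (use inn X 1 in simp_all)
      also have "\<dots> \<leftrightarrow>\<^sub>* g \<circ>\<^sub>z ?X \<circ>\<^sub>z k \<circ>\<^sub>z h"
        by (rule zx_equiv_comp_left[OF zx_comp_assoc[OF XI 1(3) assms(2)] 1(2)]) (use inn X 1 in simp_all)
      finally show ?thesis .
    qed
  qed
  have "D \<circ>\<^sub>z h \<leftrightarrow>\<^sub>* (g \<circ>\<^sub>z (L \<otimes>\<^sub>z wire_id n) \<circ>\<^sub>z k) \<circ>\<^sub>z h"
    by (rule zx_equiv_iso_comp[OF 1(6) assms(2,3)])
  also have "\<dots> \<leftrightarrow>\<^sub>* g \<circ>\<^sub>z (L \<otimes>\<^sub>z wire_id n) \<circ>\<^sub>z k \<circ>\<^sub>z h"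
    using mid(2)[of L] LR by simp
  also have "\<dots> \<leftrightarrow>\<^sub>* g \<circ>\<^sub>z (R \<otimes>\<^sub>z wire_id n) \<circ>\<^sub>z k \<circ>\<^sub>z h"
    by (rule zx_equiv_step, rule zx_step_context[OF 1(1,2) kh _ 1(5)]) (use 1(4) in simp)
  also have "\<dots> \<leftrightarrow>\<^sub>* (g \<circ>\<^sub>z (R \<otimes>\<^sub>z wire_id n) \<circ>\<^sub>z k) \<circ>\<^sub>z h"
    using mid(2)[of R] LR by (simp add: zx_equiv_sym)
  also have "\<dots> \<leftrightarrow>\<^sub>* E \<circ>\<^sub>z h"
    by (rule zx_equiv_sym, rule zx_equiv_iso_comp[OF 1(7) assms(2)])
      (use assms(3) zx_step_size[OF assms(1)] in simp)
  finally show ?thesis .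
qed

lemma zx_equiv_comp_right:
  assumes "D \<leftrightarrow>\<^sub>* E" "is_diagram k" "outs k = ins D"
  shows "D \<circ>\<^sub>z k \<leftrightarrow>\<^sub>* E \<circ>\<^sub>z k"
proof -
  have one: "ins X = ins Y \<and> (outs k = ins X \<longrightarrow> X \<circ>\<^sub>z k \<leftrightarrow>\<^sub>* Y \<circ>\<^sub>z k)" if "X \<simeq>\<^sub>z Y \<or> zx_step X Y" for X Y
    using that
  proof
    assume "X \<simeq>\<^sub>z Y"
    then show ?thesis using zx_equiv_iso_comp assms(2) by (auto simp: zx_iso_def)
  next
    assume "zx_step X Y"
    then show ?thesis using zx_step_precomp zx_step_size assms(2) by simp
  qed
  have "equivclp (\<lambda>D E. D \<simeq>\<^sub>z E \<or> zx_step D E) D E" using assms(1) unfolding zx_equiv_def .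
  then have "ins D = ins E \<and> D \<circ>\<^sub>z k \<leftrightarrow>\<^sub>* E \<circ>\<^sub>z k"
  proof (induction rule: equivclp_induct)
    case (step Y Z)
    have "ins Y = ins Z \<and> Y \<circ>\<^sub>z k \<leftrightarrow>\<^sub>* Z \<circ>\<^sub>z k"
      using step.hyps(2) one[of Y Z] one[of Z Y] step.IH assms(3) by (auto intro: zx_equiv_sym)
    then show ?case using step.IH by (auto intro: zx_equiv_trans)
  qed simp
  then show ?thesis ..
qed

section \<open>Rewriting of nets\<close>

text \<open>One pair of realisers speaks for all of them, because a proper net determines its
  diagram up to equivalence. Chains of rewrites can thus be written without mentioning
  diagrams.\<close>

definition net_equiv :: "'a net \<Rightarrow> 'a net \<Rightarrow> bool" where
  "net_equiv N N' \<longleftrightarrow> proper N \<and> proper N' \<and>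
     (\<exists>D D'. realises D N \<and> realises D' N' \<and> D \<leftrightarrow>\<^sub>* D')"

lemma net_equiv_refl: "proper N \<Longrightarrow> net_equiv N N"
  unfolding net_equiv_def
  using ex_realiser[of N] proper_even by (metis proper_def zx_equiv_refl)

lemma net_equiv_sym: "net_equiv N N' \<Longrightarrow> net_equiv N' N"
  unfolding net_equiv_def by (meson zx_equiv_sym)

lemma net_equivD:
  assumes "net_equiv N N'" "realises D N" "realises D' N'"
  shows "D \<leftrightarrow>\<^sub>* D'"
  using assms realises_equiv zx_equiv_trans unfolding net_equiv_def by meson

lemma net_equiv_trans [trans]: "net_equiv N N' \<Longrightarrow> net_equiv N' N'' \<Longrightarrow> net_equiv N N''"
  unfolding net_equiv_def by (meson realises_equiv zx_equiv_trans)

text \<open>The names on the right may be identified by \<open>f\<close>: a rule whose right-hand side contains a plain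
  wire merges two edges of its context.\<close>

lemma net_step:
  assumes rep: "zx_replace L R" and L: "realises L (a, b, VL)" and R: "realises R (map f a, map f b, VR)"
    and N: "proper (is, os, VL + W)" and N': "proper (map f is, map f os, VR + image_mset (map_prod id (image_mset f)) W)"
  shows "net_equiv (is, os, VL + W) (map f is, map f os, VR + image_mset (map_prod id (image_mset f)) W)"
proof -
  let ?n = "length (b @ os)"
  \<comment> \<open>Outputs of \<open>L\<close> must be connected back to the remaining vertices. So
    \<open>k\<close> offers the names \<open>b\<close> a second time, on wires that bypass
    \<open>L\<close>, and \<open>g\<close> joins these to the outputs of \<open>L\<close>. The
    parity of \<open>k\<close> follows by adding that of the whole net and that of \<open>L\<close>,
    in which \<open>VL\<close> is counted twice.\<close>
  have "even (count (net_names (is, a @ b @ os, W)) x)" for x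
    using realises_even[OF L, of x] proper_even[OF N, of x] by (simp add: net_names_def) presburger
  moreover have "size A = 2" if "(Hl, A) \<in># snd (snd (is, a @ b @ os, W))" for A
    using that N by (auto simp: proper_def)
  ultimately obtain k where k: "realises k (is, a @ b @ os, W)" using ex_realiser by metis
  have "\<exists>g. realises g (b @ b @ os, os, {#})"
    by (rule ex_realiser) (auto simp: net_names_def)
  then obtain g where g: "realises g (b @ b @ os, os, {#})" ..
  have comp: "realises (g \<circ>\<^sub>z (L \<otimes>\<^sub>z wire_id ?n) \<circ>\<^sub>z k) (is, os, VL + W)"
    using realises_comp[OF realises_comp[OF k realises_tensor[OF L realises_wire_id[OF refl, of "b @ os"]]] g]
    by (simp add: add.commute)
  \<comment> \<open>The same diagrams \<open>k\<close> and \<open>g\<close> serve for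
    \<open>R\<close>: the renaming acts on their nets only.\<close>
  have kf: "realises k (map f is, map f a @ map f b @ map f os, image_mset (map_prod id (image_mset f)) W)"
    using realises_map[OF k, of f] by (simp add: map_net_def)
  have gf: "realises g (map f b @ map f b @ map f os, map f os, {#})"
    using realises_map[OF g, of f] by (simp add: map_net_def)
  have comp': "realises (g \<circ>\<^sub>z (R \<otimes>\<^sub>z wire_id ?n) \<circ>\<^sub>z k)
      (map f is, map f os, VR + image_mset (map_prod id (image_mset f)) W)"
    using realises_comp[OF realises_comp[OF kf realises_tensor[OF R realises_wire_id[of "map f b @ map f os" ?n]]] gf]
    by (simp add: add.commute)
  have "zx_step (g \<circ>\<^sub>z (L \<otimes>\<^sub>z wire_id ?n) \<circ>\<^sub>z k) (g \<circ>\<^sub>z (R \<otimes>\<^sub>z wire_id ?n) \<circ>\<^sub>z k)"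
    by (rule zx_step_context[OF rep realises_length(3)[OF g] realises_length(3)[OF k]])
      (use realises_length(1,2)[OF g] realises_length(2)[OF k] realises_length(1,2)[OF L] in simp_all)
  then have "g \<circ>\<^sub>z (L \<otimes>\<^sub>z wire_id ?n) \<circ>\<^sub>z k \<leftrightarrow>\<^sub>* g \<circ>\<^sub>z (R \<otimes>\<^sub>z wire_id ?n) \<circ>\<^sub>z k"
    by (rule zx_equiv_step)
  then show ?thesis
    unfolding net_equiv_def by (intro conjI N N' exI) (rule comp comp' | assumption)+
qed

section \<open>The rules on nets\<close>

lemma realises_colour_swap:
  assumes "realises D (is, os, V)"
  shows "realises (colour_swap D) (is, os, image_mset (map_prod swap_label id) V)"
proof -
  obtain e where e: "naming D e" "(is, os, V) = net_of D e" "is_diagram D"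
    using assms unfolding realises_def by blast
  have "net_verts (map (map_prod swap_label id) vs) e = image_mset (map_prod swap_label id) (net_verts vs e)" for vs
    unfolding net_verts_def mset_map[symmetric] map_map
    by (rule arg_cong[of _ _ mset], rule nth_equalityI) simp_all
  then have "net_of (colour_swap D) e = (is, os, image_mset (map_prod swap_label id) V)"
    using e(2) by (simp add: net_of_def)
  moreover have "naming (colour_swap D) e" using e(1) by (simp add: naming_def)
  ultimately show ?thesis
    using is_diagram_colour_swap[OF e(3)] unfolding realises_def by metis
qed

definition recolour :: "bool \<Rightarrow> (zx_label \<times> 'a multiset) multiset \<Rightarrow> (zx_label \<times> 'a multiset) multiset" where
  "recolour t = image_mset (map_prod (if t then swap_label else id) id)"

text \<open>\<open>False\<close> stands for \<open>Z\<close> and \<open>True\<close> for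
  \<open>X\<close>, so that a single statement covers a rule and its colour-swapped version.\<close>

definition lab :: "bool \<Rightarrow> 4 \<Rightarrow> zx_label" where
  "lab t = (if t then Xl else Zl)"

lemma recolour_simps [simp]:
  "recolour t {#} = {#}"
  "recolour t (add_mset (Zl \<alpha>, A) V) = add_mset (lab t \<alpha>, A) (recolour t V)"
  "recolour t (add_mset (Xl \<alpha>, A) V) = add_mset (lab (\<not> t) \<alpha>, A) (recolour t V)"
  "recolour t (add_mset (Hl, A) V) = add_mset (Hl, A) (recolour t V)"
  "recolour t (V + W) = recolour t V + recolour t W"
  by (simp_all add: recolour_def lab_def)

lemma net_rule_rename:
  assumes rule: "zx_rule L R" and L: "realises L (a, b, VL)" and R: "realises R (map f a, map f b, VR)"
    and N: "proper N" "N = (is, os, recolour t VL + W)"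
    and N': "proper N'" "N' = (map f is, map f os, recolour t VR + image_mset (map_prod id (image_mset f)) W)"
  shows "net_equiv N N'"
proof (cases t)
  case True
  have "realises (colour_swap L) (a, b, recolour t VL)" "realises (colour_swap R) (map f a, map f b, recolour t VR)"
    using realises_colour_swap[OF L] realises_colour_swap[OF R] True by (simp_all add: recolour_def)
  then show ?thesis unfolding N(2) N'(2)
    by (rule net_step[OF zx_replace.swapped[OF rule]]) (use N N' in simp_all)
next
  case False
  then have "recolour t V = V" for V :: "(zx_label \<times> 'a multiset) multiset"
    by (simp add: recolour_def map_prod.id)
  then show ?thesis unfolding N(2) N'(2)
    using net_step[OF zx_replace.rule[OF rule] L R] N N' by simp
qed

lemma net_rule:
  assumes rule: "zx_rule L R" "realises L (a, b, VL)" "realises R (a, b, VR)"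
    and V: "proper (is, os, V)" "recolour t VL \<subseteq># V"
    and V': "proper (is, os, V')" "V' = recolour t VR + (V - recolour t VL)"
  shows "net_equiv (is, os, V) (is, os, V')"
proof (rule net_rule_rename[OF rule(1,2) _ V(1) _ V'(1)])
  show "realises R (map id a, map id b, VR)" using rule(3) by simp
  show "(is, os, V) = (is, os, recolour t VL + (V - recolour t VL))"
    by (simp only: subset_mset.add_diff_inverse[OF V(2)])
  show "(is, os, V') = (map id is, map id os, recolour t VR + image_mset (map_prod id (image_mset id)) (V - recolour t VL))"
    by (simp add: V'(2) map_prod.id)
qed

text \<open>Legs form a multiset, so \<open>A\<close> and \<open>B\<close> are any division of them
  between the two vertices. Read backwards, the rule separates whichever legs are chosen.\<close>

lemma net_spider:
  assumes "proper (is, os, V)" "{#(lab t \<alpha>, add_mset e A), (lab t \<beta>, add_mset e B)#} \<subseteq># V"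
    and "proper (is, os, V')" "V' = {#(lab t (\<alpha> + \<beta>), A + B)#} + (V - {#(lab t \<alpha>, add_mset e A), (lab t \<beta>, add_mset e B)#})"
  shows "net_equiv (is, os, V) (is, os, V')"
proof -
  obtain as bs where AB: "mset as = A" "mset bs = B" by (metis ex_mset)
  have "realises (Z_vertex \<beta> 1 (length bs) \<circ>\<^sub>z Z_vertex \<alpha> (length as) 1)
      (as, bs, {#(Zl \<alpha>, add_mset e A), (Zl \<beta>, add_mset e B)#})"
    using realises_comp[OF realises_vertex[of as "length as" "[e]" 1 "Zl \<alpha>"] realises_vertex[of "[e]" 1 bs "length bs" "Zl \<beta>"]] AB
    by (simp add: add_mset_commute)
  moreover have "realises (Z_vertex (\<alpha> + \<beta>) (length as) (length bs)) (as, bs, {#(Zl (\<alpha> + \<beta>), A + B)#})"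
    using realises_vertex[of as "length as" bs "length bs" "Zl (\<alpha> + \<beta>)"] AB by simp
  ultimately show ?thesis
    by (rule net_rule[OF zx_rule.spider, where t = t]) (use assms in simp_all)
qed

text \<open>Removal of the vertex joins the edges \<open>x\<close> and \<open>y\<close>. The name
  \<open>y\<close> gives way to \<open>x\<close> in the whole net, the boundary included.\<close>

lemma net_identity:
  assumes "proper (is, os, V)" "(lab t 0, {#x, y#}) \<in># V"
    and "proper (is', os', V')" "(is', os', V') = map_net (id(y := x)) (is, os, V - {#(lab t 0, {#x, y#})#})"
  shows "net_equiv (is, os, V) (is', os', V')"
proof -
  let ?f = "id(y := x)"
  have "realises (Z_vertex 0 1 1) ([x], [y], {#(Zl 0, {#x, y#})#})"
    using realises_vertex[of "[x]" 1 "[y]" 1 "Zl 0"] by (simp add: add_mset_commute)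
  moreover have "realises (wire_id 1) (map ?f [x], map ?f [y], {#})"
    using realises_wire_id[of "[x]" 1] by auto
  ultimately show ?thesis
    by (rule net_rule_rename[OF zx_rule.identity, where t = t and W = "V - {#(lab t 0, {#x, y#})#}"]) (use assms in \<open>simp_all add: map_net_def\<close>)
qed

lemma net_copying:
  assumes "proper (is, os, V)" "{#(lab (\<not> t) 0, {#e#}), (lab t 0, {#e, x, y#})#} \<subseteq># V"
    and "proper (is, os, V')" "V' = {#(lab (\<not> t) 0, {#x#}), (lab (\<not> t) 0, {#y#})#} + (V - {#(lab (\<not> t) 0, {#e#}), (lab t 0, {#e, x, y#})#})"
  shows "net_equiv (is, os, V) (is, os, V')"
proof -
  have "realises (Z_vertex 0 1 2 \<circ>\<^sub>z X_vertex 0 0 1) ([], [x, y], {#(Xl 0, {#e#}), (Zl 0, {#e, x, y#})#})"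
    using realises_comp[OF realises_vertex[of "[]" 0 "[e]" 1 "Xl 0"] realises_vertex[of "[e]" 1 "[x, y]" 2 "Zl 0"]]
    by (simp add: add_mset_commute)
  moreover have "realises (X_vertex 0 0 1 \<otimes>\<^sub>z X_vertex 0 0 1) ([], [x, y], {#(Xl 0, {#x#}), (Xl 0, {#y#})#})"
    using realises_tensor[OF realises_vertex[of "[]" 0 "[x]" 1 "Xl 0"] realises_vertex[of "[]" 0 "[y]" 1 "Xl 0"]]
    by (simp add: add_mset_commute)
  ultimately show ?thesis
    by (rule net_rule[OF zx_rule.copying, where t = t]) (use assms in simp_all)
qed

lemma realises_tensor_power:
  assumes "length xs = length ys"
  shows "realises (tensor_power (vertex l 1 1) (length ys)) (xs, ys, mset (map2 (\<lambda>x y. (l, {#x, y#})) xs ys))"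
  using assms
proof (induction xs ys rule: list_induct2)
  case Nil
  show ?case using realises_wire_id[of "[]" 0] by simp
next
  case (Cons x xs y ys)
  have "realises (vertex l 1 1) ([x], [y], {#(l, {#x, y#})#})"
    using realises_vertex[of "[x]" 1 "[y]" 1 l] by (simp add: add_mset_commute)
  from realises_tensor[OF this Cons.IH] show ?case by simp
qed

lemma net_pi_commute:
  assumes "length zs = length ys"
    and "proper (is, os, V)" "{#(lab (\<not> t) 2, {#x, e#}), (lab t \<alpha>, add_mset e (mset ys))#} \<subseteq># V"
    and "proper (is, os, V')" "V' = add_mset (lab t (- \<alpha>), add_mset x (mset zs))
      (mset (map2 (\<lambda>z y. (lab (\<not> t) 2, {#z, y#})) zs ys)) + (V - {#(lab (\<not> t) 2, {#x, e#}), (lab t \<alpha>, add_mset e (mset ys))#})"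
  shows "net_equiv (is, os, V) (is, os, V')"
proof -
  let ?n = "length ys"
  have L: "realises (Z_vertex \<alpha> 1 ?n \<circ>\<^sub>z X_vertex 2 1 1) ([x], ys, {#(Xl 2, {#x, e#}), (Zl \<alpha>, add_mset e (mset ys))#})"
    using realises_comp[OF realises_vertex[of "[x]" 1 "[e]" 1 "Xl 2"] realises_vertex[of "[e]" 1 ys ?n "Zl \<alpha>"]]
    by (simp add: add_mset_commute)
  have R: "realises (tensor_power (X_vertex 2 1 1) ?n \<circ>\<^sub>z Z_vertex (- \<alpha>) 1 ?n)
      ([x], ys, add_mset (Zl (- \<alpha>), add_mset x (mset zs)) (mset (map2 (\<lambda>z y. (Xl 2, {#z, y#})) zs ys)))"
    using realises_comp[OF realises_vertex[of "[x]" 1 zs ?n "Zl (- \<alpha>)"] realises_tensor_power[OF assms(1), of "Xl 2"]] assms(1)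
    by simp
  have "recolour t (mset (map2 (\<lambda>z y. (Xl 2, {#z, y#})) zs ys)) = mset (map2 (\<lambda>z y. (lab (\<not> t) 2, {#z, y#})) zs ys)"
    unfolding recolour_def mset_map[symmetric] map_map
    by (intro arg_cong[of _ _ mset] map_cong refl) (auto simp: lab_def)
  then show ?thesis
    by (intro net_rule[OF zx_rule.pi_commute L R, where t = t]) (use assms in simp_all)
qed

lemma net_hopf:
  assumes "proper (is, os, V)" "{#(lab t 0, {#x, a, b#}), (lab (\<not> t) 0, {#a, b, y#})#} \<subseteq># V"
    and "proper (is, os, V')" "V' = {#(lab t 0, {#x#}), (lab (\<not> t) 0, {#y#})#} + (V - {#(lab t 0, {#x, a, b#}), (lab (\<not> t) 0, {#a, b, y#})#})"
  shows "net_equiv (is, os, V) (is, os, V')"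
proof -
  have "realises (X_vertex 0 2 1 \<circ>\<^sub>z Z_vertex 0 1 2) ([x], [y], {#(Zl 0, {#x, a, b#}), (Xl 0, {#a, b, y#})#})"
    using realises_comp[OF realises_vertex[of "[x]" 1 "[a, b]" 2 "Zl 0"] realises_vertex[of "[a, b]" 2 "[y]" 1 "Xl 0"]]
    by (simp add: add_mset_commute)
  moreover have "realises (X_vertex 0 0 1 \<circ>\<^sub>z Z_vertex 0 1 0) ([x], [y], {#(Zl 0, {#x#}), (Xl 0, {#y#})#})"
    using realises_comp[OF realises_vertex[of "[x]" 1 "[]" 0 "Zl 0"] realises_vertex[of "[]" 0 "[y]" 1 "Xl 0"]]
    by (simp add: add_mset_commute)
  ultimately show ?thesis
    by (rule net_rule[OF zx_rule.hopf, where t = t]) (use assms in simp_all)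
qed

lemma net_bialgebra:
  assumes "proper (is, os, V)" "{#(lab (\<not> t) 0, {#x, x', e#}), (lab t 0, {#e, y, y'#})#} \<subseteq># V"
    and "proper (is, os, V')" "V' = {#(lab t 0, {#x, a, b#}), (lab t 0, {#x', c, d#}),
      (lab (\<not> t) 0, {#a, c, y#}), (lab (\<not> t) 0, {#b, d, y'#})#} + (V - {#(lab (\<not> t) 0, {#x, x', e#}), (lab t 0, {#e, y, y'#})#})"
  shows "net_equiv (is, os, V) (is, os, V')"
proof -
  have "realises (Z_vertex 0 1 2 \<circ>\<^sub>z X_vertex 0 2 1) ([x, x'], [y, y'], {#(Xl 0, {#x, x', e#}), (Zl 0, {#e, y, y'#})#})"
    using realises_comp[OF realises_vertex[of "[x, x']" 2 "[e]" 1 "Xl 0"] realises_vertex[of "[e]" 1 "[y, y']" 2 "Zl 0"]]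
    by (simp add: add_mset_commute)
  moreover have "realises ((X_vertex 0 2 1 \<otimes>\<^sub>z X_vertex 0 2 1) \<circ>\<^sub>z (wire_id 1 \<otimes>\<^sub>z wire_swap \<otimes>\<^sub>z wire_id 1) \<circ>\<^sub>z
     (Z_vertex 0 1 2 \<otimes>\<^sub>z Z_vertex 0 1 2)) ([x, x'], [y, y'], {#(Zl 0, {#x, a, b#}), (Zl 0, {#x', c, d#}),
      (Xl 0, {#a, c, y#}), (Xl 0, {#b, d, y'#})#})"
  proof -
    have Z: "realises (Z_vertex 0 1 2 \<otimes>\<^sub>z Z_vertex 0 1 2) ([x, x'], [a, b, c, d], {#(Zl 0, {#x, a, b#}), (Zl 0, {#x', c, d#})#})"
      using realises_tensor[OF realises_vertex[of "[x]" 1 "[a, b]" 2 "Zl 0"] realises_vertex[of "[x']" 1 "[c, d]" 2 "Zl 0"]]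
      by (simp add: add_mset_commute)
    have S: "realises (wire_id 1 \<otimes>\<^sub>z wire_swap \<otimes>\<^sub>z wire_id 1) ([a, b, c, d], [a, c, b, d], {#})"
      using realises_tensor[OF realises_wire_id[of "[a]" 1] realises_tensor[OF realises_wire_swap[of b c] realises_wire_id[of "[d]" 1]]]
      by simp
    have X: "realises (X_vertex 0 2 1 \<otimes>\<^sub>z X_vertex 0 2 1) ([a, c, b, d], [y, y'], {#(Xl 0, {#a, c, y#}), (Xl 0, {#b, d, y'#})#})"
      using realises_tensor[OF realises_vertex[of "[a, c]" 2 "[y]" 1 "Xl 0"] realises_vertex[of "[b, d]" 2 "[y']" 1 "Xl 0"]]
      by (simp add: add_mset_commute)
    show ?thesis using realises_comp[OF realises_comp[OF Z S] X] by (simp add: add_mset_commute)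
  qed
  ultimately show ?thesis
    by (rule net_rule[OF zx_rule.bialgebra, where t = t]) (use assms in simp_all)
qed

text \<open>The rule is taken with \<open>m = 0\<close>, all legs being outputs: a net does not
  distinguish the sides of a vertex.\<close>

lemma net_H_commute:
  assumes "length zs = length ys"
    and "proper (is, os, V)" "add_mset (lab t \<alpha>, mset zs) (mset (map2 (\<lambda>z y. (Hl, {#z, y#})) zs ys)) \<subseteq># V"
    and "proper (is, os, V')" "V' = {#(lab (\<not> t) \<alpha>, mset ys)#} + (V - add_mset (lab t \<alpha>, mset zs) (mset (map2 (\<lambda>z y. (Hl, {#z, y#})) zs ys)))"
  shows "net_equiv (is, os, V) (is, os, V')"
proof -
  let ?n = "length ys"
  have "realises (Z_vertex \<alpha> 0 ?n \<circ>\<^sub>z tensor_power H_vertex 0) ([], zs, {#(Zl \<alpha>, mset zs)#})"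
    using realises_comp[OF realises_wire_id[of "[]" 0] realises_vertex[of "[]" 0 zs ?n "Zl \<alpha>"]] assms(1) by simp
  from realises_comp[OF this realises_tensor_power[OF assms(1), of Hl]]
  have L: "realises (tensor_power H_vertex ?n \<circ>\<^sub>z Z_vertex \<alpha> 0 ?n \<circ>\<^sub>z tensor_power H_vertex 0)
      ([], ys, add_mset (Zl \<alpha>, mset zs) (mset (map2 (\<lambda>z y. (Hl, {#z, y#})) zs ys)))" by simp
  have R: "realises (X_vertex \<alpha> 0 ?n) ([], ys, {#(Xl \<alpha>, mset ys)#})"
    using realises_vertex[of "[]" 0 ys ?n "Xl \<alpha>"] by simp
  have "recolour t (mset (map2 (\<lambda>z y. (Hl, {#z, y#})) zs ys)) = mset (map2 (\<lambda>z y. (Hl, {#z, y#})) zs ys)"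
    unfolding recolour_def mset_map[symmetric] map_map
    by (intro arg_cong[of _ _ mset] map_cong refl) auto
  then show ?thesis
    by (intro net_rule[OF zx_rule.H_commute L R, where t = t]) (use assms in simp_all)
qed

lemma net_H_euler:
  assumes "proper (is, os, V)" "{#(Hl, {#x, y#})#} \<subseteq># V"
    and "proper (is, os, V')" "V' = {#(lab t 1, {#x, a#}), (lab (\<not> t) 1, {#a, b#}), (lab t 1, {#b, y#})#} + (V - {#(Hl, {#x, y#})#})"
  shows "net_equiv (is, os, V) (is, os, V')"
proof -
  have "realises H_vertex ([x], [y], {#(Hl, {#x, y#})#})"
    using realises_vertex[of "[x]" 1 "[y]" 1 Hl] by (simp add: add_mset_commute)
  moreover have "realises (Z_vertex 1 1 1 \<circ>\<^sub>z X_vertex 1 1 1 \<circ>\<^sub>z Z_vertex 1 1 1)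
      ([x], [y], {#(Zl 1, {#x, a#}), (Xl 1, {#a, b#}), (Zl 1, {#b, y#})#})"
    using realises_comp[OF realises_comp[OF realises_vertex[of "[x]" 1 "[a]" 1 "Zl 1"] realises_vertex[of "[a]" 1 "[b]" 1 "Xl 1"]]
        realises_vertex[of "[b]" 1 "[y]" 1 "Zl 1"]]
    by (simp add: add_mset_commute)
  ultimately show ?thesis
    by (rule net_rule[OF zx_rule.H_euler, where t = t]) (use assms in simp_all)
qed

text \<open>The value is \<open>sqrt 2\<close>: the bit 1 contributes nothing because the weight of
  \<open>X(0)\<close> vanishes there. Read backwards, the lemma supplies the spare leaves for a
  reversed copying in \<open>CNOT_V_CNOT\<close>.\<close>

lemma net_scalar:
  assumes "proper (is, os, V)" "{#(Zl 1, {#e#}), (Xl 0, {#e#})#} \<subseteq># V"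
    and "proper (is, os, V')" "V' = V - {#(Zl 1, {#e#}), (Xl 0, {#e#})#}"
  shows "net_equiv (is, os, V) (is, os, V')"
proof -
  define S where "S = \<lparr>ins = 0, outs = 0, verts = [(Zl 1, 1), (Xl 0, 1)],
    wires = {(Leg 0 0, Leg 1 0), (Leg 1 0, Leg 0 0)}, circles = 0\<rparr>"
  have ports: "ports S = {Leg 0 0, Leg 1 0}"
    by (auto simp: ports_def S_def less_Suc_eq)
  have S: "is_diagram S"
    using matching_insert[OF matching_empty, of "Leg 0 0" "Leg 1 0"]
    unfolding is_diagram_matching ports by (simp add: S_def)
  have "naming S (\<lambda>_. e)" by (simp add: naming_def)
  moreover have "net_of S (\<lambda>_. e) = ([], [], {#(Zl 1, {#e#}), (Xl 0, {#e#})#})"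
    by (simp add: net_of_def net_verts_def S_def del: mset_map)
  ultimately have L: "realises S ([], [], {#(Zl 1, {#e#}), (Xl 0, {#e#})#})"
    using S unfolding realises_def by metis
  let ?b = "\<lambda>p. p \<in> {Leg 0 0, Leg 1 0}"
  have bits: "b \<in> edge_bits S \<longleftrightarrow> (\<forall>p. \<not> ?b p \<longrightarrow> \<not> b p) \<and> b (Leg 0 0) = b (Leg 1 0)" for b
    unfolding edge_bits_def ports by (auto simp: S_def)
  have "b = ?b \<or> b = (\<lambda>_. False)" if "b \<in> edge_bits S" for b
  proof (cases "b (Leg 0 0)")
    case True
    then have "b p = ?b p" for p using that unfolding bits by (cases "?b p") auto
    then show ?thesis by blast
  next
    case False
    then have "\<not> b p" for p using that unfolding bits by (cases "?b p") auto
    then have "b = (\<lambda>_. False)" by blast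
    then show ?thesis ..
  qed
  moreover have "?b \<in> edge_bits S" "(\<lambda>_. False) \<in> edge_bits S" unfolding bits by simp_all
  ultimately have "edge_bits S = {\<lambda>_. False, ?b}" by blast
  moreover have "(\<lambda>_. False) \<noteq> ?b" by (auto simp: fun_eq_iff)
  ultimately have "scalar_value S = complex_of_real 2 / complex_of_real (sqrt 2)"
    by (simp add: scalar_value_def S_def lessThan_Suc phase_def bit0.Rep_0)
  then have rep: "zx_replace S (wire_id 0)"
    using S by (intro zx_replace.scalar) (simp_all add: S_def)
  have R: "realises (wire_id 0) (map id [], map id [], {#})" using realises_wire_id[of "[]" 0] by simp
  show ?thesis
    using net_step[OF rep L R, of "is" os "V - {#(Zl 1, {#e#}), (Xl 0, {#e#})#}"] assms(1,3)
      subset_mset.add_diff_inverse[OF assms(2)]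
    unfolding assms(4) by (simp add: map_prod.id)
qed

section \<open>Relations between two-qubit circuits\<close>

lemma net_arith: "(4::4) = 0" "(5::4) = 1" "(6::4) = 2" "- 1 = (3::4)" "- 2 = (2::4)" "- 3 = (1::4)"
  by simp_all

lemmas net_simps = proper_def net_names_def map_net_def lab_def net_arith add_mset_commute

lemmas net_split = net_equiv_sym[OF net_spider]

lemmas net_spider_Z = net_spider[where t = False] and net_spider_X = net_spider[where t = True]
  and net_split_Z = net_split[where t = False] and net_split_X = net_split[where t = True]
  and net_identity_Z = net_identity[where t = False] and net_identity_X = net_identity[where t = True]
  and net_copying_Z = net_copying[where t = False]
  and net_pi_commute_Z = net_pi_commute[where t = False]
  and net_hopf_Z = net_hopf[where t = False] and net_bialgebra_Z = net_bialgebra[where t = False]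
  and net_H_commute_Z = net_H_commute[where t = False] and net_H_commute_X = net_H_commute[where t = True]
  and net_H_euler_Z = net_H_euler[where t = False] and net_H_euler_X = net_H_euler[where t = True]

definition gate\<^sub>1 :: "zx_label \<Rightarrow> zx_diagram" where
  "gate\<^sub>1 l = vertex l 1 1 \<otimes>\<^sub>z wire_id 1"

definition gate\<^sub>2 :: "zx_label \<Rightarrow> zx_diagram" where
  "gate\<^sub>2 l = wire_id 1 \<otimes>\<^sub>z vertex l 1 1"

lemma realises_gate1: "realises (gate\<^sub>1 l) ([a, x], [b, x], {#(l, {#a, b#})#})"
  using realises_tensor[OF realises_vertex[of "[a]" 1 "[b]" 1 l] realises_wire_id[of "[x]" 1]]
  by (simp add: gate\<^sub>1_def add_mset_commute)

lemma realises_gate2: "realises (gate\<^sub>2 l) ([a, x], [a, y], {#(l, {#x, y#})#})"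
  using realises_tensor[OF realises_wire_id[of "[a]" 1] realises_vertex[of "[x]" 1 "[y]" 1 l]]
  by (simp add: gate\<^sub>2_def add_mset_commute)

section \<open>Relations of CNOT and the swap\<close>

context notes net_simps [simp]
begin

text \<open>Phase and control have the same colour: the phase fuses with the control and is split
  off on its other side.\<close>

lemma CNOT_Z_control: "CNOT \<circ>\<^sub>z gate\<^sub>1 (Zl 1) \<leftrightarrow>\<^sub>* gate\<^sub>1 (Zl 1) \<circ>\<^sub>z CNOT"
proof -
  let ?N = "\<lambda>V. ([0::nat, 10], [2, 11], V)"
  have L: "realises (CNOT \<circ>\<^sub>z gate\<^sub>1 (Zl 1)) (?N {#(Zl 1, {#0, 1#}), (Zl 0, {#1, 2, 3#}), (Xl 0, {#3, 10, 11#})#})" (is "realises _ ?L")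
    using realises_comp[OF realises_gate1[of "Zl 1" "0::nat" 10 1]
      realises_CNOT[of "1::nat" 10 2 11 3]] by simp
  have R: "realises (gate\<^sub>1 (Zl 1) \<circ>\<^sub>z CNOT) (?N {#(Zl 0, {#0, 4, 3#}), (Xl 0, {#3, 10, 11#}), (Zl 1, {#4, 2#})#})" (is "realises _ ?R")
    using realises_comp[OF realises_CNOT[of "0::nat" 10 4 11 3]
      realises_gate1[of "Zl 1" "4::nat" 11 2]] by simp
  have "net_equiv ?L (?N {#(Xl 0, {#3, 10, 11#}), (Zl 1, {#0, 2, 3#})#})"
    by (rule net_spider_Z[where \<alpha> = 1 and \<beta> = 0 and e = 1 and A = "{#0#}" and B = "{#2, 3#}"]) simp_all
  also have "net_equiv \<dots> ?R"
    by (rule net_split_Z[where \<alpha> = 0 and \<beta> = 1 and e = 4 and A = "{#0, 3#}" and B = "{#2#}"]) simp_all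
  finally show ?thesis using L R by (rule net_equivD)
qed

text \<open>The control, of opposite colour, copies the \<pi> phase. The copy on the connecting edge
  fuses with the target and leaves through its output.\<close>

lemma CNOT_X_control: "CNOT \<circ>\<^sub>z gate\<^sub>1 (Xl 2) \<leftrightarrow>\<^sub>* gate\<^sub>2 (Xl 2) \<circ>\<^sub>z gate\<^sub>1 (Xl 2) \<circ>\<^sub>z CNOT"
proof -
  let ?N = "\<lambda>V. ([0::nat, 10], [2, 11], V)"
  have L: "realises (CNOT \<circ>\<^sub>z gate\<^sub>1 (Xl 2)) (?N {#(Xl 2, {#0, 1#}), (Zl 0, {#1, 2, 3#}), (Xl 0, {#3, 10, 11#})#})" (is "realises _ ?L")
    using realises_comp[OF realises_gate1[of "Xl 2" "0::nat" 10 1]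
      realises_CNOT[of "1::nat" 10 2 11 3]] by simp
  have R: "realises (gate\<^sub>2 (Xl 2) \<circ>\<^sub>z gate\<^sub>1 (Xl 2) \<circ>\<^sub>z CNOT) (?N {#(Zl 0, {#0, 4, 5#}), (Xl 0, {#5, 10, 6#}), (Xl 2, {#4, 2#}), (Xl 2, {#6, 11#})#})" (is "realises _ ?R")
    using realises_comp[OF realises_comp[OF realises_CNOT[of "0::nat" 10 4 6 5]
      realises_gate1[of "Xl 2" "4::nat" 6 2]]
      realises_gate2[of "Xl 2" "2::nat" 6 11]] by simp
  have "net_equiv ?L (?N {#(Xl 0, {#3, 10, 11#}), (Zl 0, {#0, 4, 5#}), (Xl 2, {#4, 2#}), (Xl 2, {#5, 3#})#})"
    by (rule net_pi_commute_Z[where \<alpha> = 0 and x = 0 and e = 1 and zs = "[4, 5]" and ys = "[2, 3]"]) simp_all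
  also have "net_equiv \<dots> (?N {#(Zl 0, {#0, 4, 5#}), (Xl 2, {#4, 2#}), (Xl 2, {#5, 10, 11#})#})"
    by (rule net_spider_X[where \<alpha> = 2 and \<beta> = 0 and e = 3 and A = "{#5#}" and B = "{#10, 11#}"]) simp_all
  also have "net_equiv \<dots> ?R"
    by (rule net_split_X[where \<alpha> = 0 and \<beta> = 2 and e = 6 and A = "{#5, 10#}" and B = "{#11#}"]) simp_all
  finally show ?thesis using L R by (rule net_equivD)
qed

text \<open>Fused controls and fused targets are joined by two parallel edges, which hopf cuts. The
  splittings isolate these edges on vertices of degree 3, the form in which hopf is stated.\<close>

lemma CNOT_CNOT: "CNOT \<circ>\<^sub>z CNOT \<leftrightarrow>\<^sub>* wire_id 2"
proof -
  let ?N = "\<lambda>V. ([0::nat, 10], [3, 12], V)"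
  have L: "realises (CNOT \<circ>\<^sub>z CNOT) (?N {#(Zl 0, {#0, 1, 2#}), (Xl 0, {#2, 10, 11#}), (Zl 0, {#1, 3, 4#}), (Xl 0, {#4, 11, 12#})#})" (is "realises _ ?L")
    using realises_comp[OF realises_CNOT[of "0::nat" 10 1 11 2]
      realises_CNOT[of "1::nat" 11 3 12 4]] by simp
  have R: "realises (wire_id 2) ([0::nat, 10], [0, 10], {#})" (is "realises _ ?R")
    using realises_wire_id[of "[0::nat, 10]" 2] by simp
  have "net_equiv ?L (?N {#(Xl 0, {#2, 10, 11#}), (Xl 0, {#4, 11, 12#}), (Zl 0, {#0, 2, 3, 4#})#})"
    by (rule net_spider_Z[where \<alpha> = 0 and \<beta> = 0 and e = 1 and A = "{#0, 2#}" and B = "{#3, 4#}"]) simp_all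
  also have "net_equiv \<dots> (?N {#(Zl 0, {#0, 2, 3, 4#}), (Xl 0, {#2, 10, 4, 12#})#})"
    by (rule net_spider_X[where \<alpha> = 0 and \<beta> = 0 and e = 11 and A = "{#2, 10#}" and B = "{#4, 12#}"]) simp_all
  also have "net_equiv \<dots> (?N {#(Xl 0, {#2, 10, 4, 12#}), (Zl 0, {#5, 0, 3#}), (Zl 0, {#5, 2, 4#})#})"
    by (rule net_split_Z[where \<alpha> = 0 and \<beta> = 0 and e = 5 and A = "{#0, 3#}" and B = "{#2, 4#}"]) simp_all
  also have "net_equiv \<dots> (?N {#(Zl 0, {#5, 0, 3#}), (Zl 0, {#5, 2, 4#}), (Xl 0, {#6, 10, 12#}), (Xl 0, {#6, 2, 4#})#})"
    by (rule net_split_X[where \<alpha> = 0 and \<beta> = 0 and e = 6 and A = "{#10, 12#}" and B = "{#2, 4#}"]) simp_all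
  also have "net_equiv \<dots> (?N {#(Zl 0, {#5, 0, 3#}), (Xl 0, {#6, 10, 12#}), (Zl 0, {#5#}), (Xl 0, {#6#})#})"
    by (rule net_hopf_Z[where x = 5 and a = 2 and b = 4 and y = 6]) simp_all
  also have "net_equiv \<dots> (?N {#(Xl 0, {#6, 10, 12#}), (Xl 0, {#6#}), (Zl 0, {#0, 3#})#})"
    by (rule net_spider_Z[where \<alpha> = 0 and \<beta> = 0 and e = 5 and A = "{#0, 3#}" and B = "{#}"]) simp_all
  also have "net_equiv \<dots> (?N {#(Zl 0, {#0, 3#}), (Xl 0, {#10, 12#})#})"
    by (rule net_spider_X[where \<alpha> = 0 and \<beta> = 0 and e = 6 and A = "{#10, 12#}" and B = "{#}"]) simp_all
  also have "net_equiv \<dots> ([0::nat, 10], [0, 12], {#(Xl 0, {#10, 12#})#})"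
    by (rule net_identity_Z[where x = 0 and y = 3]) simp_all
  also have "net_equiv \<dots> ?R"
    by (rule net_identity_X[where x = 10 and y = 12]) simp_all
  finally show ?thesis using L R by (rule net_equivD)
qed

text \<open>A change of colour needs an \<open>H\<close> on every leg, but the connecting edge
  carries none. An identity vertex inserted there, recoloured and removed again, leaves two of them,
  one for each end.\<close>

lemma CNOT_H: "gate\<^sub>2 Hl \<circ>\<^sub>z gate\<^sub>1 Hl \<circ>\<^sub>z CNOT \<circ>\<^sub>z gate\<^sub>2 Hl \<circ>\<^sub>z gate\<^sub>1 Hl \<leftrightarrow>\<^sub>* wire_swap \<circ>\<^sub>z CNOT \<circ>\<^sub>z wire_swap"
proof -
  let ?N = "\<lambda>V. ([0::nat, 10], [4, 13], V)"
  have L: "realises (gate\<^sub>2 Hl \<circ>\<^sub>z gate\<^sub>1 Hl \<circ>\<^sub>z CNOT \<circ>\<^sub>z gate\<^sub>2 Hl \<circ>\<^sub>z gate\<^sub>1 Hl) (?N {#(Hl, {#0, 1#}), (Hl, {#10, 11#}), (Zl 0, {#1, 2, 3#}), (Xl 0, {#3, 11, 12#}), (Hl, {#2, 4#}), (Hl, {#12, 13#})#})" (is "realises _ ?L")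
    using realises_comp[OF realises_comp[OF realises_comp[OF realises_comp[OF realises_gate1[of "Hl" "0::nat" 10 1]
      realises_gate2[of "Hl" "1::nat" 10 11]]
      realises_CNOT[of "1::nat" 11 2 12 3]]
      realises_gate1[of "Hl" "2::nat" 12 4]]
      realises_gate2[of "Hl" "4::nat" 12 13]] by simp
  have R: "realises (wire_swap \<circ>\<^sub>z CNOT \<circ>\<^sub>z wire_swap) (?N {#(Zl 0, {#10, 13, 5#}), (Xl 0, {#5, 0, 4#})#})" (is "realises _ ?R")
    using realises_comp[OF realises_comp[OF realises_wire_swap[of "0::nat" 10]
      realises_CNOT[of "10::nat" 0 13 4 5]]
      realises_wire_swap[of "13::nat" 4]] by simp
  have "net_equiv ?L (?N {#(Hl, {#0, 1#}), (Hl, {#10, 11#}), (Zl 0, {#1, 2, 3#}), (Hl, {#2, 4#}), (Hl, {#12, 13#}), (Xl 0, {#7, 11, 12#}), (Xl 0, {#3, 7#})#})"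
    by (rule net_equiv_sym, rule net_identity_X[where x = 3 and y = 7]) simp_all
  also have "net_equiv \<dots> (?N {#(Hl, {#0, 1#}), (Hl, {#10, 11#}), (Zl 0, {#1, 2, 3#}), (Hl, {#2, 4#}), (Hl, {#12, 13#}), (Xl 0, {#7, 11, 12#}), (Zl 0, {#5, 6#}), (Hl, {#5, 3#}), (Hl, {#6, 7#})#})"
    by (rule net_equiv_sym, rule net_H_commute_Z[where \<alpha> = 0 and zs = "[5, 6]" and ys = "[3, 7]"]) simp_all
  also have "net_equiv \<dots> (?N {#(Hl, {#0, 1#}), (Hl, {#10, 11#}), (Zl 0, {#1, 2, 3#}), (Hl, {#2, 4#}), (Hl, {#12, 13#}), (Xl 0, {#7, 11, 12#}), (Hl, {#5, 3#}), (Hl, {#5, 7#})#})"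
    by (rule net_identity_Z[where x = 5 and y = 6]) simp_all
  also have "net_equiv \<dots> (?N {#(Hl, {#10, 11#}), (Hl, {#12, 13#}), (Xl 0, {#7, 11, 12#}), (Hl, {#5, 7#}), (Xl 0, {#0, 4, 5#})#})"
    by (rule net_H_commute_Z[where \<alpha> = 0 and zs = "[1, 2, 3]" and ys = "[0, 4, 5]"]) simp_all
  also have "net_equiv \<dots> ?R"
    by (rule net_H_commute_X[where \<alpha> = 0 and zs = "[7, 11, 12]" and ys = "[5, 10, 13]"]) simp_all
  finally show ?thesis using L R by (rule net_equivD)
qed

text \<open>Both sides are rewritten to the symmetric net \<open>?M\<close>: an \<open>X(0)\<close>
  vertex on each wire, joined by an edge that carries \<open>Z(3)\<close>, the angle
  -\<pi>/2.\<close>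

lemma CNOT_V_CNOT: "CNOT \<circ>\<^sub>z gate\<^sub>1 (Xl 1) \<circ>\<^sub>z CNOT \<leftrightarrow>\<^sub>* gate\<^sub>2 (Xl 1) \<circ>\<^sub>z gate\<^sub>1 (Xl 1) \<circ>\<^sub>z gate\<^sub>1 Hl \<circ>\<^sub>z CNOT \<circ>\<^sub>z gate\<^sub>1 Hl"
proof -
  let ?N = "\<lambda>V. ([0::nat, 10], [4, 12], V)"
  have L: "realises (CNOT \<circ>\<^sub>z gate\<^sub>1 (Xl 1) \<circ>\<^sub>z CNOT) (?N {#(Zl 0, {#0, 1, 2#}), (Xl 0, {#2, 10, 11#}), (Xl 1, {#1, 3#}), (Zl 0, {#3, 4, 5#}), (Xl 0, {#5, 11, 12#})#})" (is "realises _ ?L")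
    using realises_comp[OF realises_comp[OF realises_CNOT[of "0::nat" 10 1 11 2]
      realises_gate1[of "Xl 1" "1::nat" 11 3]]
      realises_CNOT[of "3::nat" 11 4 12 5]] by simp
  have R: "realises (gate\<^sub>2 (Xl 1) \<circ>\<^sub>z gate\<^sub>1 (Xl 1) \<circ>\<^sub>z gate\<^sub>1 Hl \<circ>\<^sub>z CNOT \<circ>\<^sub>z gate\<^sub>1 Hl) (?N {#(Hl, {#0, 1#}), (Zl 0, {#1, 2, 3#}), (Xl 0, {#3, 10, 11#}), (Hl, {#2, 5#}), (Xl 1, {#5, 4#}), (Xl 1, {#11, 12#})#})" (is "realises _ ?R")
    using realises_comp[OF realises_comp[OF realises_comp[OF realises_comp[OF realises_gate1[of "Hl" "0::nat" 10 1]
      realises_CNOT[of "1::nat" 10 2 11 3]]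
      realises_gate1[of "Hl" "2::nat" 11 5]]
      realises_gate1[of "Xl 1" "5::nat" 11 4]]
      realises_gate2[of "Xl 1" "4::nat" 11 12]] by simp
  \<comment> \<open>Recolouring the conjugated control leaves an \<open>H\<close> on the connecting
    edge. The outer factors of its Euler form fuse with the two \<open>V\<close> gates to \<pi>
    phases; commuting one of them past the inner \<open>Z(1)\<close> inverts that phase and cancels
    the other \<pi>.\<close>
  have "net_equiv ?R (?N {#(Hl, {#0, 1#}), (Zl 0, {#1, 2, 3#}), (Hl, {#2, 5#}), (Xl 1, {#5, 4#}), (Xl 1, {#3, 10, 12#})#})"
    by (rule net_spider_X[where \<alpha> = 0 and \<beta> = 1 and e = 11 and A = "{#3, 10#}" and B = "{#12#}"]) simp_all
  also have "net_equiv \<dots> (?N {#(Hl, {#0, 1#}), (Zl 0, {#1, 2, 3#}), (Hl, {#2, 5#}), (Xl 1, {#5, 4#}), (Xl 1, {#7, 10, 12#}), (Xl 0, {#3, 7#})#})"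
    by (rule net_equiv_sym, rule net_identity_X[where x = 3 and y = 7]) simp_all
  also have "net_equiv \<dots> (?N {#(Hl, {#0, 1#}), (Zl 0, {#1, 2, 3#}), (Hl, {#2, 5#}), (Xl 1, {#5, 4#}), (Xl 1, {#7, 10, 12#}), (Zl 0, {#8, 9#}), (Hl, {#8, 3#}), (Hl, {#9, 7#})#})"
    by (rule net_equiv_sym, rule net_H_commute_Z[where \<alpha> = 0 and zs = "[8, 9]" and ys = "[3, 7]"]) simp_all
  also have "net_equiv \<dots> (?N {#(Hl, {#0, 1#}), (Zl 0, {#1, 2, 3#}), (Hl, {#2, 5#}), (Xl 1, {#5, 4#}), (Xl 1, {#7, 10, 12#}), (Hl, {#8, 3#}), (Hl, {#8, 7#})#})"
    by (rule net_identity_Z[where x = 8 and y = 9]) simp_all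
  also have "net_equiv \<dots> (?N {#(Xl 1, {#5, 4#}), (Xl 1, {#7, 10, 12#}), (Hl, {#8, 7#}), (Xl 0, {#0, 5, 8#})#})"
    by (rule net_H_commute_Z[where \<alpha> = 0 and zs = "[1, 2, 3]" and ys = "[0, 5, 8]"]) simp_all
  also have "net_equiv \<dots> (?N {#(Xl 1, {#7, 10, 12#}), (Hl, {#8, 7#}), (Xl 1, {#0, 8, 4#})#})"
    by (rule net_spider_X[where \<alpha> = 0 and \<beta> = 1 and e = 5 and A = "{#0, 8#}" and B = "{#4#}"]) simp_all
  also have "net_equiv \<dots> (?N {#(Xl 1, {#7, 10, 12#}), (Xl 1, {#0, 8, 4#}), (Xl 1, {#8, 13#}), (Zl 1, {#13, 14#}), (Xl 1, {#14, 7#})#})"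
    by (rule net_H_euler_X[where x = 8 and y = 7 and a = 13 and b = 14]) simp_all
  also have "net_equiv \<dots> (?N {#(Xl 1, {#7, 10, 12#}), (Zl 1, {#13, 14#}), (Xl 1, {#14, 7#}), (Xl 2, {#0, 4, 13#})#})"
    by (rule net_spider_X[where \<alpha> = 1 and \<beta> = 1 and e = 8 and A = "{#0, 4#}" and B = "{#13#}"]) simp_all
  also have "net_equiv \<dots> (?N {#(Zl 1, {#13, 14#}), (Xl 2, {#0, 4, 13#}), (Xl 2, {#14, 10, 12#})#})"
    by (rule net_spider_X[where \<alpha> = 1 and \<beta> = 1 and e = 7 and A = "{#14#}" and B = "{#10, 12#}"]) simp_all
  also have "net_equiv \<dots> (?N {#(Zl 1, {#13, 14#}), (Xl 2, {#14, 10, 12#}), (Xl 0, {#22, 0, 4#}), (Xl 2, {#22, 13#})#})"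
    by (rule net_split_X[where \<alpha> = 0 and \<beta> = 2 and e = 22 and A = "{#0, 4#}" and B = "{#13#}"]) simp_all
  also have "net_equiv \<dots> (?N {#(Xl 2, {#14, 10, 12#}), (Xl 0, {#22, 0, 4#}), (Zl 3, {#22, 23#}), (Xl 2, {#23, 14#})#})"
    by (rule net_pi_commute_Z[where \<alpha> = 1 and x = 22 and e = 13 and zs = "[23]" and ys = "[14]"]) simp_all
  also have "net_equiv \<dots> (?N {#(Xl 0, {#22, 0, 4#}), (Zl 3, {#22, 23#}), (Xl 0, {#23, 10, 12#})#})"
    by (rule net_spider_X[where \<alpha> = 2 and \<beta> = 2 and e = 14 and A = "{#23#}" and B = "{#10, 12#}"]) simp_all
  finally have R_net: "net_equiv ?R (?N {#(Xl 0, {#22, 0, 4#}), (Zl 3, {#22, 23#}), (Xl 0, {#23, 10, 12#})#})" (is "net_equiv _ ?M") .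
  have "net_equiv ?L (?N {#(Zl 0, {#0, 1, 2#}), (Xl 1, {#1, 3#}), (Zl 0, {#3, 4, 5#}), (Xl 0, {#2, 10, 5, 12#})#})"
    by (rule net_spider_X[where \<alpha> = 0 and \<beta> = 0 and e = 11 and A = "{#2, 10#}" and B = "{#5, 12#}"]) simp_all
  \<comment> \<open>Up to a scalar a leaf \<open>X(1)\<close> equals a leaf \<open>Z(3)\<close>.
    Once the phase of \<open>V\<close> is moved to a leaf and recoloured, the vertices to which
    bialgebra and hopf apply are free of phases.\<close>
  also have "net_equiv \<dots> (?N {#(Zl 0, {#0, 1, 2#}), (Zl 0, {#3, 4, 5#}), (Xl 0, {#2, 10, 5, 12#}), (Xl 0, {#6, 1, 3#}), (Xl 1, {#6#})#})"
    by (rule net_split_X[where \<alpha> = 0 and \<beta> = 1 and e = 6 and A = "{#1, 3#}" and B = "{#}"]) simp_all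
  also have "net_equiv \<dots> (?N {#(Zl 0, {#0, 1, 2#}), (Zl 0, {#3, 4, 5#}), (Xl 0, {#2, 10, 5, 12#}), (Xl 0, {#6, 1, 3#}), (Xl 1, {#7#}), (Zl 0, {#6, 7#})#})"
    by (rule net_equiv_sym, rule net_identity_Z[where x = 6 and y = 7]) simp_all
  \<comment> \<open>The split-off \<open>Z(1)\<close> is the first factor of an Euler form of
    \<open>H\<close>; the phase of the leaf will be the middle one.\<close>
  also have "net_equiv \<dots> (?N {#(Zl 0, {#0, 1, 2#}), (Zl 0, {#3, 4, 5#}), (Xl 0, {#2, 10, 5, 12#}), (Xl 0, {#6, 1, 3#}), (Xl 1, {#7#}), (Zl 3, {#8, 6#}), (Zl 1, {#8, 7#})#})"
    by (rule net_split_Z[where \<alpha> = 3 and \<beta> = 1 and e = 8 and A = "{#6#}" and B = "{#7#}"]) simp_all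
  also have "net_equiv \<dots> (?N {#(Zl 0, {#0, 1, 2#}), (Zl 0, {#3, 4, 5#}), (Xl 0, {#2, 10, 5, 12#}), (Xl 0, {#6, 1, 3#}), (Zl 3, {#8, 6#}), (Zl 1, {#8, 7#}), (Xl 1, {#16, 7#}), (Xl 0, {#16#})#})"
    by (rule net_split_X[where \<alpha> = 1 and \<beta> = 0 and e = 16 and A = "{#7#}" and B = "{#}"]) simp_all
  \<comment> \<open>The last Euler factor \<open>Z(1)\<close> enters as part of a scalar. Its
    partner \<open>X(0)\<close> and the leaf at 16 merge by reversed copying, which attaches the new
    phase to the chain; the completed \<open>H\<close> then recolours the remaining leaf to
    \<open>Z(0)\<close>.\<close>
  also have "net_equiv \<dots> (?N {#(Zl 0, {#0, 1, 2#}), (Zl 0, {#3, 4, 5#}), (Xl 0, {#2, 10, 5, 12#}), (Xl 0, {#6, 1, 3#}), (Zl 3, {#8, 6#}), (Zl 1, {#8, 7#}), (Xl 1, {#16, 7#}), (Xl 0, {#16#}), (Zl 1, {#17#}), (Xl 0, {#17#})#})"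
    by (rule net_equiv_sym, rule net_scalar[where e = 17]) simp_all
  also have "net_equiv \<dots> (?N {#(Zl 0, {#0, 1, 2#}), (Zl 0, {#3, 4, 5#}), (Xl 0, {#2, 10, 5, 12#}), (Xl 0, {#6, 1, 3#}), (Zl 3, {#8, 6#}), (Zl 1, {#8, 7#}), (Xl 1, {#16, 7#}), (Zl 1, {#17#}), (Xl 0, {#9#}), (Zl 0, {#9, 16, 17#})#})"
    by (rule net_equiv_sym, rule net_copying_Z[where e = 9 and x = 16 and y = 17]) simp_all
  also have "net_equiv \<dots> (?N {#(Zl 0, {#0, 1, 2#}), (Zl 0, {#3, 4, 5#}), (Xl 0, {#2, 10, 5, 12#}), (Xl 0, {#6, 1, 3#}), (Zl 3, {#8, 6#}), (Zl 1, {#8, 7#}), (Xl 1, {#16, 7#}), (Xl 0, {#9#}), (Zl 1, {#9, 16#})#})"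
    by (rule net_spider_Z[where \<alpha> = 1 and \<beta> = 0 and e = 17 and A = "{#}" and B = "{#9, 16#}"]) simp_all
  also have "net_equiv \<dots> (?N {#(Zl 0, {#0, 1, 2#}), (Zl 0, {#3, 4, 5#}), (Xl 0, {#2, 10, 5, 12#}), (Xl 0, {#6, 1, 3#}), (Zl 3, {#8, 6#}), (Xl 0, {#9#}), (Hl, {#8, 9#})#})"
    by (rule net_equiv_sym, rule net_H_euler_Z[where x = 8 and y = 9 and a = 7 and b = 16]) simp_all
  also have "net_equiv \<dots> (?N {#(Zl 0, {#0, 1, 2#}), (Zl 0, {#3, 4, 5#}), (Xl 0, {#2, 10, 5, 12#}), (Xl 0, {#6, 1, 3#}), (Zl 3, {#8, 6#}), (Zl 0, {#8#})#})"
    by (rule net_H_commute_X[where \<alpha> = 0 and zs = "[9]" and ys = "[8]"]) simp_all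
  also have "net_equiv \<dots> (?N {#(Zl 0, {#0, 1, 2#}), (Zl 0, {#3, 4, 5#}), (Xl 0, {#2, 10, 5, 12#}), (Xl 0, {#6, 1, 3#}), (Zl 3, {#6#})#})"
    by (rule net_spider_Z[where \<alpha> = 3 and \<beta> = 0 and e = 8 and A = "{#6#}" and B = "{#}"]) simp_all
  \<comment> \<open>After bialgebra and fusion, two parallel edges between control and target are
    left for hopf.\<close>
  also have "net_equiv \<dots> (?N {#(Zl 0, {#0, 1, 2#}), (Xl 0, {#2, 10, 5, 12#}), (Zl 3, {#6#}), (Zl 0, {#1, 20, 21#}), (Zl 0, {#6, 22, 23#}), (Xl 0, {#20, 22, 4#}), (Xl 0, {#21, 23, 5#})#})"
    by (rule net_bialgebra_Z[where x = 1 and x' = 6 and e = 3 and y = 4 and y' = 5 and a = 20 and b = 21 and c = 22 and d = 23]) simp_all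
  also have "net_equiv \<dots> (?N {#(Xl 0, {#2, 10, 5, 12#}), (Zl 3, {#6#}), (Zl 0, {#6, 22, 23#}), (Xl 0, {#20, 22, 4#}), (Xl 0, {#21, 23, 5#}), (Zl 0, {#0, 2, 20, 21#})#})"
    by (rule net_spider_Z[where \<alpha> = 0 and \<beta> = 0 and e = 1 and A = "{#0, 2#}" and B = "{#20, 21#}"]) simp_all
  also have "net_equiv \<dots> (?N {#(Xl 0, {#2, 10, 5, 12#}), (Xl 0, {#20, 22, 4#}), (Xl 0, {#21, 23, 5#}), (Zl 0, {#0, 2, 20, 21#}), (Zl 3, {#22, 23#})#})"
    by (rule net_spider_Z[where \<alpha> = 0 and \<beta> = 3 and e = 6 and A = "{#22, 23#}" and B = "{#}"]) simp_all
  also have "net_equiv \<dots> (?N {#(Xl 0, {#20, 22, 4#}), (Zl 0, {#0, 2, 20, 21#}), (Zl 3, {#22, 23#}), (Xl 0, {#21, 23, 2, 10, 12#})#})"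
    by (rule net_spider_X[where \<alpha> = 0 and \<beta> = 0 and e = 5 and A = "{#21, 23#}" and B = "{#2, 10, 12#}"]) simp_all
  also have "net_equiv \<dots> (?N {#(Xl 0, {#20, 22, 4#}), (Zl 3, {#22, 23#}), (Xl 0, {#21, 23, 2, 10, 12#}), (Zl 0, {#24, 0, 20#}), (Zl 0, {#24, 2, 21#})#})"
    by (rule net_split_Z[where \<alpha> = 0 and \<beta> = 0 and e = 24 and A = "{#0, 20#}" and B = "{#2, 21#}"]) simp_all
  also have "net_equiv \<dots> (?N {#(Xl 0, {#20, 22, 4#}), (Zl 3, {#22, 23#}), (Zl 0, {#24, 0, 20#}), (Zl 0, {#24, 2, 21#}), (Xl 0, {#25, 23, 10, 12#}), (Xl 0, {#25, 2, 21#})#})"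
    by (rule net_split_X[where \<alpha> = 0 and \<beta> = 0 and e = 25 and A = "{#23, 10, 12#}" and B = "{#2, 21#}"]) simp_all
  also have "net_equiv \<dots> (?N {#(Xl 0, {#20, 22, 4#}), (Zl 3, {#22, 23#}), (Zl 0, {#24, 0, 20#}), (Xl 0, {#25, 23, 10, 12#}), (Zl 0, {#24#}), (Xl 0, {#25#})#})"
    by (rule net_hopf_Z[where x = 24 and a = 2 and b = 21 and y = 25]) simp_all
  also have "net_equiv \<dots> (?N {#(Xl 0, {#20, 22, 4#}), (Zl 3, {#22, 23#}), (Xl 0, {#25, 23, 10, 12#}), (Xl 0, {#25#}), (Zl 0, {#0, 20#})#})"
    by (rule net_spider_Z[where \<alpha> = 0 and \<beta> = 0 and e = 24 and A = "{#0, 20#}" and B = "{#}"]) simp_all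
  also have "net_equiv \<dots> (?N {#(Xl 0, {#20, 22, 4#}), (Zl 3, {#22, 23#}), (Zl 0, {#0, 20#}), (Xl 0, {#23, 10, 12#})#})"
    by (rule net_spider_X[where \<alpha> = 0 and \<beta> = 0 and e = 25 and A = "{#23, 10, 12#}" and B = "{#}"]) simp_all
  also have "net_equiv \<dots> ?M"
    by (rule net_identity_Z[where x = 0 and y = 20]) simp_all
  also note net_equiv_sym[OF R_net]
  finally show ?thesis using L R by (rule net_equivD)
qed

text \<open>Bialgebra is applied to the target of the second gate and the control of the third. With
  spiders in between, hopf then removes two pairs of parallel edges, and crossing plain wires
  remain.\<close>

lemma CNOT_swap_CNOT: "CNOT \<circ>\<^sub>z wire_swap \<circ>\<^sub>z CNOT \<circ>\<^sub>z wire_swap \<circ>\<^sub>z CNOT \<leftrightarrow>\<^sub>* wire_swap"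
proof -
  let ?N = "\<lambda>V. ([0::nat, 10], [5, 13], V)"
  have L: "realises (CNOT \<circ>\<^sub>z wire_swap \<circ>\<^sub>z CNOT \<circ>\<^sub>z wire_swap \<circ>\<^sub>z CNOT) (?N {#(Zl 0, {#0, 1, 2#}), (Xl 0, {#2, 10, 11#}), (Zl 0, {#11, 12, 4#}), (Xl 0, {#4, 1, 3#}), (Zl 0, {#3, 5, 6#}), (Xl 0, {#6, 12, 13#})#})" (is "realises _ ?L")
    using realises_comp[OF realises_comp[OF realises_comp[OF realises_comp[OF realises_CNOT[of "0::nat" 10 1 11 2]
      realises_wire_swap[of "1::nat" 11]]
      realises_CNOT[of "11::nat" 1 12 3 4]]
      realises_wire_swap[of "12::nat" 3]]
      realises_CNOT[of "3::nat" 12 5 13 6]] by simp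
  have R: "realises (wire_swap) ([0::nat, 10], [10, 0], {#})" (is "realises _ ?R")
    using realises_wire_swap[of "0::nat" 10] by simp
  have "net_equiv ?L (?N {#(Zl 0, {#0, 1, 2#}), (Xl 0, {#2, 10, 11#}), (Zl 0, {#11, 12, 4#}), (Xl 0, {#6, 12, 13#}), (Zl 0, {#1, 20, 21#}), (Zl 0, {#4, 22, 23#}), (Xl 0, {#20, 22, 5#}), (Xl 0, {#21, 23, 6#})#})"
    by (rule net_bialgebra_Z[where x = 1 and x' = 4 and e = 3 and y = 5 and y' = 6 and a = 20 and b = 21 and c = 22 and d = 23]) simp_all
  also have "net_equiv \<dots> (?N {#(Xl 0, {#2, 10, 11#}), (Zl 0, {#11, 12, 4#}), (Xl 0, {#6, 12, 13#}), (Zl 0, {#4, 22, 23#}), (Xl 0, {#20, 22, 5#}), (Xl 0, {#21, 23, 6#}), (Zl 0, {#0, 2, 20, 21#})#})"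
    by (rule net_spider_Z[where \<alpha> = 0 and \<beta> = 0 and e = 1 and A = "{#0, 2#}" and B = "{#20, 21#}"]) simp_all
  also have "net_equiv \<dots> (?N {#(Xl 0, {#2, 10, 11#}), (Xl 0, {#6, 12, 13#}), (Xl 0, {#20, 22, 5#}), (Xl 0, {#21, 23, 6#}), (Zl 0, {#0, 2, 20, 21#}), (Zl 0, {#11, 12, 22, 23#})#})"
    by (rule net_spider_Z[where \<alpha> = 0 and \<beta> = 0 and e = 4 and A = "{#11, 12#}" and B = "{#22, 23#}"]) simp_all
  also have "net_equiv \<dots> (?N {#(Xl 0, {#2, 10, 11#}), (Xl 0, {#20, 22, 5#}), (Zl 0, {#0, 2, 20, 21#}), (Zl 0, {#11, 12, 22, 23#}), (Xl 0, {#21, 23, 12, 13#})#})"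
    by (rule net_spider_X[where \<alpha> = 0 and \<beta> = 0 and e = 6 and A = "{#21, 23#}" and B = "{#12, 13#}"]) simp_all
  also have "net_equiv \<dots> (?N {#(Xl 0, {#2, 10, 11#}), (Xl 0, {#20, 22, 5#}), (Zl 0, {#0, 2, 20, 21#}), (Xl 0, {#21, 23, 12, 13#}), (Zl 0, {#24, 11, 22#}), (Zl 0, {#24, 12, 23#})#})"
    by (rule net_split_Z[where \<alpha> = 0 and \<beta> = 0 and e = 24 and A = "{#11, 22#}" and B = "{#12, 23#}"]) simp_all
  also have "net_equiv \<dots> (?N {#(Xl 0, {#2, 10, 11#}), (Xl 0, {#20, 22, 5#}), (Zl 0, {#0, 2, 20, 21#}), (Zl 0, {#24, 11, 22#}), (Zl 0, {#24, 12, 23#}), (Xl 0, {#25, 21, 13#}), (Xl 0, {#25, 12, 23#})#})"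
    by (rule net_split_X[where \<alpha> = 0 and \<beta> = 0 and e = 25 and A = "{#21, 13#}" and B = "{#12, 23#}"]) simp_all
  also have "net_equiv \<dots> (?N {#(Xl 0, {#2, 10, 11#}), (Xl 0, {#20, 22, 5#}), (Zl 0, {#0, 2, 20, 21#}), (Zl 0, {#24, 11, 22#}), (Xl 0, {#25, 21, 13#}), (Zl 0, {#24#}), (Xl 0, {#25#})#})"
    by (rule net_hopf_Z[where x = 24 and a = 12 and b = 23 and y = 25]) simp_all
  also have "net_equiv \<dots> (?N {#(Xl 0, {#2, 10, 11#}), (Xl 0, {#20, 22, 5#}), (Zl 0, {#0, 2, 20, 21#}), (Xl 0, {#25, 21, 13#}), (Xl 0, {#25#}), (Zl 0, {#11, 22#})#})"
    by (rule net_spider_Z[where \<alpha> = 0 and \<beta> = 0 and e = 24 and A = "{#11, 22#}" and B = "{#}"]) simp_all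
  also have "net_equiv \<dots> (?N {#(Xl 0, {#2, 10, 11#}), (Xl 0, {#20, 22, 5#}), (Zl 0, {#0, 2, 20, 21#}), (Zl 0, {#11, 22#}), (Xl 0, {#21, 13#})#})"
    by (rule net_spider_X[where \<alpha> = 0 and \<beta> = 0 and e = 25 and A = "{#21, 13#}" and B = "{#}"]) simp_all
  also have "net_equiv \<dots> (?N {#(Xl 0, {#2, 10, 11#}), (Xl 0, {#20, 11, 5#}), (Zl 0, {#0, 2, 20, 21#}), (Xl 0, {#21, 13#})#})"
    by (rule net_identity_Z[where x = 11 and y = 22]) simp_all
  also have "net_equiv \<dots> (?N {#(Xl 0, {#2, 10, 11#}), (Xl 0, {#20, 11, 5#}), (Zl 0, {#0, 2, 20, 13#})#})"
    by (rule net_identity_X[where x = 13 and y = 21]) simp_all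
  also have "net_equiv \<dots> (?N {#(Zl 0, {#0, 2, 20, 13#}), (Xl 0, {#2, 10, 20, 5#})#})"
    by (rule net_spider_X[where \<alpha> = 0 and \<beta> = 0 and e = 11 and A = "{#2, 10#}" and B = "{#20, 5#}"]) simp_all
  also have "net_equiv \<dots> (?N {#(Xl 0, {#2, 10, 20, 5#}), (Zl 0, {#26, 0, 13#}), (Zl 0, {#26, 2, 20#})#})"
    by (rule net_split_Z[where \<alpha> = 0 and \<beta> = 0 and e = 26 and A = "{#0, 13#}" and B = "{#2, 20#}"]) simp_all
  also have "net_equiv \<dots> (?N {#(Zl 0, {#26, 0, 13#}), (Zl 0, {#26, 2, 20#}), (Xl 0, {#27, 10, 5#}), (Xl 0, {#27, 2, 20#})#})"
    by (rule net_split_X[where \<alpha> = 0 and \<beta> = 0 and e = 27 and A = "{#10, 5#}" and B = "{#2, 20#}"]) simp_all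
  also have "net_equiv \<dots> (?N {#(Zl 0, {#26, 0, 13#}), (Xl 0, {#27, 10, 5#}), (Zl 0, {#26#}), (Xl 0, {#27#})#})"
    by (rule net_hopf_Z[where x = 26 and a = 2 and b = 20 and y = 27]) simp_all
  also have "net_equiv \<dots> (?N {#(Xl 0, {#27, 10, 5#}), (Xl 0, {#27#}), (Zl 0, {#0, 13#})#})"
    by (rule net_spider_Z[where \<alpha> = 0 and \<beta> = 0 and e = 26 and A = "{#0, 13#}" and B = "{#}"]) simp_all
  also have "net_equiv \<dots> (?N {#(Zl 0, {#0, 13#}), (Xl 0, {#10, 5#})#})"
    by (rule net_spider_X[where \<alpha> = 0 and \<beta> = 0 and e = 27 and A = "{#10, 5#}" and B = "{#}"]) simp_all
  also have "net_equiv \<dots> ([0::nat, 10], [5, 0], {#(Xl 0, {#10, 5#})#})"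
    by (rule net_identity_Z[where x = 0 and y = 13]) simp_all
  also have "net_equiv \<dots> ?R"
    by (rule net_identity_X[where x = 10 and y = 5]) simp_all
  finally show ?thesis using L R by (rule net_equivD)
qed

lemma swap_swap: "wire_swap \<circ>\<^sub>z wire_swap \<leftrightarrow>\<^sub>* wire_id 2"
proof -
  let ?N = "\<lambda>V. ([0::nat, 10], [0, 10], V)"
  have L: "realises (wire_swap \<circ>\<^sub>z wire_swap) (?N {#})" (is "realises _ ?L")
    using realises_comp[OF realises_wire_swap[of "0::nat" 10]
      realises_wire_swap[of "10::nat" 0]] by simp
  have R: "realises (wire_id 2) (?N {#})" (is "realises _ ?R")
    using realises_wire_id[of "[0::nat, 10]" 2] by simp
  have "net_equiv ?L ?R" by (simp add: net_equiv_refl)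
  then show ?thesis using L R by (rule net_equivD)
qed


section \<open>One-qubit gates on the first wire and exchange laws\<close>

lemma gate1_fuse: "gate\<^sub>1 (lab t \<beta>) \<circ>\<^sub>z gate\<^sub>1 (lab t \<alpha>) \<leftrightarrow>\<^sub>* gate\<^sub>1 (lab t (\<alpha> + \<beta>))"
proof (rule net_equivD)
  show "realises (gate\<^sub>1 (lab t \<beta>) \<circ>\<^sub>z gate\<^sub>1 (lab t \<alpha>))
      ([0::nat, 10], [2, 10], {#(lab t \<alpha>, {#0, 1#}), (lab t \<beta>, {#1, 2#})#})" (is "realises _ ?L")
    using realises_comp[OF realises_gate1[of "lab t \<alpha>" "0::nat" 10 1] realises_gate1[of "lab t \<beta>" 1 10 2]] by simp
  show "realises (gate\<^sub>1 (lab t (\<alpha> + \<beta>))) ([0::nat, 10], [2, 10], {#(lab t (\<alpha> + \<beta>), {#0, 2#})#})" (is "realises _ ?R")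
    using realises_gate1[of "lab t (\<alpha> + \<beta>)" "0::nat" 10 2] .
  show "net_equiv ?L ?R"
    by (rule net_spider[where t = t and \<alpha> = \<alpha> and \<beta> = \<beta> and e = 1 and A = "{#0#}" and B = "{#2#}"]) (cases t; simp)+
qed

lemma gate1_zero: "gate\<^sub>1 (lab t 0) \<leftrightarrow>\<^sub>* wire_id 2"
proof (rule net_equivD)
  show "realises (gate\<^sub>1 (lab t 0)) ([0::nat, 10], [1, 10], {#(lab t 0, {#0, 1#})#})" (is "realises _ ?L")
    by (rule realises_gate1)
  show "realises (wire_id 2) ([0::nat, 10], [0, 10], {#})" (is "realises _ ?R")
    by (rule realises_wire_id) simp
  show "net_equiv ?L ?R"
    by (rule net_identity[where t = t and x = 0 and y = 1]) (cases t; simp)+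
qed

lemma gate1_pi: "gate\<^sub>1 (lab t \<alpha>) \<circ>\<^sub>z gate\<^sub>1 (lab (\<not> t) 2) \<leftrightarrow>\<^sub>* gate\<^sub>1 (lab (\<not> t) 2) \<circ>\<^sub>z gate\<^sub>1 (lab t (- \<alpha>))"
proof (rule net_equivD)
  show "realises (gate\<^sub>1 (lab t \<alpha>) \<circ>\<^sub>z gate\<^sub>1 (lab (\<not> t) 2))
      ([0::nat, 10], [2, 10], {#(lab (\<not> t) 2, {#0, 1#}), (lab t \<alpha>, {#1, 2#})#})" (is "realises _ ?L")
    using realises_comp[OF realises_gate1[of "lab (\<not> t) 2" "0::nat" 10 1] realises_gate1[of "lab t \<alpha>" 1 10 2]] by simp
  show "realises (gate\<^sub>1 (lab (\<not> t) 2) \<circ>\<^sub>z gate\<^sub>1 (lab t (- \<alpha>)))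
      ([0::nat, 10], [2, 10], {#(lab t (- \<alpha>), {#0, 3#}), (lab (\<not> t) 2, {#3, 2#})#})" (is "realises _ ?R")
    using realises_comp[OF realises_gate1[of "lab t (- \<alpha>)" "0::nat" 10 3] realises_gate1[of "lab (\<not> t) 2" 3 10 2]] by simp
  show "net_equiv ?L ?R"
    by (rule net_pi_commute[where t = t and \<alpha> = \<alpha> and x = 0 and e = 1 and zs = "[3]" and ys = "[2]"]) (cases t; simp)+
qed

text \<open>Both colours matter: equating the two Euler forms of \<open>H\<close> yields the braid
  relation.\<close>

lemma gate1_euler: "gate\<^sub>1 Hl \<leftrightarrow>\<^sub>* gate\<^sub>1 (lab t 1) \<circ>\<^sub>z gate\<^sub>1 (lab (\<not> t) 1) \<circ>\<^sub>z gate\<^sub>1 (lab t 1)"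
proof (rule net_equivD)
  show "realises (gate\<^sub>1 Hl) ([0::nat, 10], [3, 10], {#(Hl, {#0, 3#})#})" (is "realises _ ?L")
    by (rule realises_gate1)
  show "realises (gate\<^sub>1 (lab t 1) \<circ>\<^sub>z gate\<^sub>1 (lab (\<not> t) 1) \<circ>\<^sub>z gate\<^sub>1 (lab t 1))
      ([0::nat, 10], [3, 10], {#(lab t 1, {#0, 1#}), (lab (\<not> t) 1, {#1, 2#}), (lab t 1, {#2, 3#})#})" (is "realises _ ?R")
    using realises_comp[OF realises_comp[OF realises_gate1[of "lab t 1" "0::nat" 10 1] realises_gate1[of "lab (\<not> t) 1" 1 10 2]]
      realises_gate1[of "lab t 1" 2 10 3]] by simp
  show "net_equiv ?L ?R"
    by (rule net_H_euler[where t = t and x = 0 and y = 3 and a = 1 and b = 2]) (cases t; simp)+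
qed
lemma gate1_gate2: "gate\<^sub>2 m \<circ>\<^sub>z gate\<^sub>1 l \<leftrightarrow>\<^sub>* gate\<^sub>1 l \<circ>\<^sub>z gate\<^sub>2 m"
proof (rule realises_equiv)
  show "realises (gate\<^sub>2 m \<circ>\<^sub>z gate\<^sub>1 l) ([0::nat, 10], [1, 11], {#(l, {#0, 1#}), (m, {#10, 11#})#})"
    using realises_comp[OF realises_gate1[of l "0::nat" 10 1] realises_gate2[of m 1 10 11]]
    by (simp add: add_mset_commute)
  show "realises (gate\<^sub>1 l \<circ>\<^sub>z gate\<^sub>2 m) ([0::nat, 10], [1, 11], {#(l, {#0, 1#}), (m, {#10, 11#})#})"
    using realises_comp[OF realises_gate2[of m "0::nat" 10 11] realises_gate1[of l 0 11 1]]
    by (simp add: add_mset_commute)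
qed (auto simp: net_simps)

lemma swap_gate1: "wire_swap \<circ>\<^sub>z gate\<^sub>1 l \<leftrightarrow>\<^sub>* gate\<^sub>2 l \<circ>\<^sub>z wire_swap"
proof (rule realises_equiv)
  show "realises (wire_swap \<circ>\<^sub>z gate\<^sub>1 l) ([0::nat, 10], [10, 1], {#(l, {#0, 1#})#})"
    using realises_comp[OF realises_gate1[of l "0::nat" 10 1] realises_wire_swap[of 1 10]] by simp
  show "realises (gate\<^sub>2 l \<circ>\<^sub>z wire_swap) ([0::nat, 10], [10, 1], {#(l, {#0, 1#})#})"
    using realises_comp[OF realises_wire_swap[of "0::nat" 10] realises_gate2[of l 10 0 1]] by simp
qed (auto simp: net_simps)

end

section \<open>The Clifford relations in a monoid\<close>

text \<open>In the application the fourth power of each generator is 1, so this submonoid is the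
  generated group.\<close>

inductive_set generated :: "'a::monoid_mult set \<Rightarrow> 'a set" for G where
  one: "1 \<in> generated G"
| mult: "g \<in> G \<Longrightarrow> x \<in> generated G \<Longrightarrow> g * x \<in> generated G"

lemma generated_mult: "x \<in> generated G \<Longrightarrow> y \<in> generated G \<Longrightarrow> x * y \<in> generated G"
  by (induction rule: generated.induct) (auto simp: mult.assoc intro: generated.mult)

lemma generated_base: "g \<in> G \<Longrightarrow> g \<in> generated G"
  using generated.mult[OF _ generated.one] by fastforce

section \<open>Normal forms of the one-qubit Clifford group\<close>

definition clifford_words :: "zx_label list set" where
  "clifford_words = {[],
     [z_p], [z_pi], [z_m], [x_p], [x_pi], [x_m],
     [z_pi, x_pi], [z_pi, x_m], [z_pi, x_p], [x_pi, z_m], [x_pi, z_p],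
     [z_m, x_m], [z_m, x_p], [z_p, x_m], [z_p, x_p],
     [x_m, z_m], [x_m, z_p], [x_p, z_m], [x_p, z_p],
     [z_p, x_m, z_m], [z_p, x_m, z_p], [z_p, x_p, z_m], [z_p, x_p, z_p]}"

text \<open>\<open>s\<close> and \<open>v\<close> are the gates S and V. \<open>s4\<close> and
  \<open>v4\<close> express addition of angles, \<open>braid\<close> equates the two Euler forms of
  the Hadamard gate, and \<open>v2s\<close>, \<open>s2v\<close> say that a \<pi> phase inverts
  phases of the other colour.\<close>

locale one_qubit =
  fixes s v :: "'a::monoid_mult"
  assumes s4: "s * (s * (s * s)) = 1" and v4: "v * (v * (v * v)) = 1"
    and braid: "v * (s * v) = s * (v * s)"
    and v2s: "v * (v * s) = s * (s * (s * (v * v)))"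
    and s2v: "s * (s * v) = v * (v * (v * (s * s)))"
begin

text \<open>The Knuth-Bendix completion of the defining relations: a convergent rewriting system with
  24 normal forms.\<close>

lemma base_rewrites:
  "s * (s * (s * (s * x))) = x" "v * (v * (v * (v * x))) = x" "v * (s * (v * x)) = s * (v * (s * x))"
  "s * (s * (s * (v * (v * x)))) = v * (v * (s * x))" "v * (v * (v * (s * (s * x)))) = s * (s * (v * x))"
  using arg_cong[OF s4, of "\<lambda>y. y * x"] arg_cong[OF v4, of "\<lambda>y. y * x"] arg_cong[OF braid, of "\<lambda>y. y * x"]
    arg_cong[OF v2s, of "\<lambda>y. y * x"] arg_cong[OF s2v, of "\<lambda>y. y * x"]
  by (simp_all add: mult.assoc)

lemma svvs: "s * (v * (v * (s * x))) = v * (v * x)"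
  by (simp only: base_rewrites(1) base_rewrites(4)[symmetric])

lemma vssv: "v * (s * (s * (v * x))) = s * (s * x)"
  by (simp only: base_rewrites(2) base_rewrites(5)[symmetric])

lemma vvss: "v * (v * (s * (s * x))) = s * (s * (v * (v * x)))"
  by (simp only: base_rewrites(1) base_rewrites(4)[symmetric])

lemma ssvss: "s * (s * (v * (s * (s * x)))) = v * (v * (v * x))"
  by (simp only: base_rewrites(1) base_rewrites(5)[symmetric])

lemma ssvvv: "s * (s * (v * (v * (v * x)))) = v * (s * (s * x))"
  by (simp only: vvss[symmetric] base_rewrites(2) base_rewrites(5)[symmetric])

text \<open>The braid relation overlaps with \<open>vssv\<close>. The resulting equation has a spare
  \<open>s\<close> in front, which multiplication by the inverse, the cube of \<open>s\<close>,
  removes.\<close>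

lemma vsssv: "v * (s * (s * (s * (v * x)))) = s * (v * (v * (v * (s * x))))"
proof -
  have "s * (v * (s * (s * (s * (v * x))))) = v * (s * (v * (s * (s * (v * x)))))"
    by (simp only: base_rewrites(3))
  also have "\<dots> = v * (s * (s * (s * x)))" by (simp only: vssv)
  finally have "s * (s * (s * (s * (v * (s * (s * (s * (v * x)))))))) = s * (s * (s * (v * (s * (s * (s * x))))))"
    by simp
  then have "v * (s * (s * (s * (v * x)))) = s * (s * (s * (v * (s * (s * (s * x))))))"
    by (simp only: base_rewrites(1))
  then show ?thesis by (simp only: ssvss)
qed

text \<open>Products are nested to the right, so a rule has to be given twice: with a tail
  \<open>x\<close> for the middle of a word, and without one for its end.\<close>

lemmas completion = mult.assoc base_rewrites svvs vssv vvss ssvss ssvvv vsssv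
  base_rewrites[where x = 1, unfolded mult_1_right] svvs[where x = 1, unfolded mult_1_right]
  vssv[where x = 1, unfolded mult_1_right] vvss[where x = 1, unfolded mult_1_right]
  ssvss[where x = 1, unfolded mult_1_right] ssvvv[where x = 1, unfolded mult_1_right]
  vsssv[where x = 1, unfolded mult_1_right]

text \<open>The final 1 is a default; the words to be evaluated contain only the six non-zero
  phases.\<close>

definition label_value :: "zx_label \<Rightarrow> 'a" where
  "label_value l = (if l = Zl 1 then s else if l = Zl 2 then s * s else if l = Zl 3 then s * (s * s)
     else if l = Xl 1 then v else if l = Xl 2 then v * v else if l = Xl 3 then v * (v * v) else 1)"

text \<open>Words are read from input to output whereas products apply the right factor first, hence
  the reversal.\<close>

primrec word_value :: "zx_label list \<Rightarrow> 'a" where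
  "word_value [] = 1"
| "word_value (l # ls) = word_value ls * label_value l"

text \<open>The right-hand side lists the irreducible words of the rewriting system, the form in
  which simplified products can be recognised.\<close>

lemma word_values:
  "word_value ` clifford_words = {1, s, v, s * s, s * v, v * s, v * v, s * (s * s), s * (s * v), s * (v * s),
     s * (v * v), v * (s * s), v * (v * s), v * (v * v), s * (s * (s * v)), s * (s * (v * s)),
     s * (s * (v * v)), s * (v * (s * s)), s * (v * (v * v)), v * (s * (s * s)), v * (v * (v * s)),
     s * (s * (s * (v * s))), s * (v * (s * (s * s))), s * (v * (v * (v * s)))}" (is "?L = ?R")
proof -
  have "?L = {1, s, s * s, s * (s * s), v, v * v, v * (v * v),
     v * (v * (s * s)), v * (v * (v * (s * s))), v * (s * s), s * (s * (s * (v * v))), s * (v * v),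
     v * (v * (v * (s * (s * s)))), v * (s * (s * s)), v * (v * (v * s)), v * s,
     s * (s * (s * (v * (v * v)))), s * (v * (v * v)), s * (s * (s * v)), s * v,
     s * (s * (s * (v * (v * (v * s))))), s * (v * (v * (v * s))), s * (s * (s * (v * s))), s * (v * s)}"
    unfolding clifford_words_def by (simp add: label_value_def mult.assoc)
  also have "\<dots> = ?R" by (simp add: completion insert_commute)
  finally show ?thesis .
qed

text \<open>Left multiplication of an irreducible word by \<open>s\<close> or \<open>v\<close>
  reduces to one of the 24 again, so closure is a finite computation.\<close>

lemma generated_words: "generated {s, v} = word_value ` clifford_words"
proof
  show "generated {s, v} \<subseteq> word_value ` clifford_words"
  proof
    fix x assume "x \<in> generated {s, v}"
    then show "x \<in> word_value ` clifford_words"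
    proof induction
      case one
      show ?case unfolding word_values by simp
    next
      case (mult g x)
      then show ?case unfolding word_values
        by (auto simp: completion)
    qed
  qed
  have "s \<in> generated {s, v}" "v \<in> generated {s, v}" by (auto intro: generated_base)
  then show "word_value ` clifford_words \<subseteq> generated {s, v}"
    unfolding word_values by (auto intro!: generated_mult intro: generated.one)
qed

end

text \<open>Indices denote wires, \<open>c\<close> is CNOT with its control on the first wire and
  \<open>w\<close> is the swap. In \<open>wcw\<close> and \<open>cv\<^sub>1c\<close> the Hadamard
  gates are spelled out by Euler forms. One-qubit relations on the second wire will come from
  \<open>w\<close>, those of the target from \<open>J\<close>.\<close>

locale clifford_relations = one_qubit s\<^sub>1 v\<^sub>1 for s\<^sub>1 v\<^sub>1 :: "'a::monoid_mult" +
  fixes s\<^sub>2 v\<^sub>2 c w :: 'a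
  assumes commute: "s\<^sub>2 * s\<^sub>1 = s\<^sub>1 * s\<^sub>2" "s\<^sub>2 * v\<^sub>1 = v\<^sub>1 * s\<^sub>2" "v\<^sub>2 * s\<^sub>1 = s\<^sub>1 * v\<^sub>2" "v\<^sub>2 * v\<^sub>1 = v\<^sub>1 * v\<^sub>2"
    and swap: "w * w = 1" "w * s\<^sub>1 = s\<^sub>2 * w" "w * v\<^sub>1 = v\<^sub>2 * w"
    and cc: "c * c = 1"
    and cs\<^sub>1: "c * s\<^sub>1 = s\<^sub>1 * c"
    and cv\<^sub>1v\<^sub>1: "c * (v\<^sub>1 * v\<^sub>1) = v\<^sub>1 * (v\<^sub>1 * (v\<^sub>2 * (v\<^sub>2 * c)))"
    and wcw: "w * (c * w) = (s\<^sub>1 * (v\<^sub>1 * s\<^sub>1)) * ((s\<^sub>2 * (v\<^sub>2 * s\<^sub>2)) * (c * ((s\<^sub>1 * (v\<^sub>1 * s\<^sub>1)) * (s\<^sub>2 * (v\<^sub>2 * s\<^sub>2)))))"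
    and cv\<^sub>1c: "c * (v\<^sub>1 * c) = v\<^sub>1 * (v\<^sub>2 * ((s\<^sub>1 * (v\<^sub>1 * s\<^sub>1)) * (c * (s\<^sub>1 * (v\<^sub>1 * s\<^sub>1)))))"
    and cwcwc: "c * (w * (c * (w * c))) = w"
begin

section \<open>Transport of relations between the wires\<close>

lemma left: "x * y = z \<Longrightarrow> x * (y * u) = z * u" for x y z u :: 'a
  by (simp add: mult.assoc[symmetric])

lemma w_simps: "w * (w * x) = x" "w * (s\<^sub>1 * x) = s\<^sub>2 * (w * x)" "w * (v\<^sub>1 * x) = v\<^sub>2 * (w * x)"
  "w * (s\<^sub>2 * x) = s\<^sub>1 * (w * x)" "w * (v\<^sub>2 * x) = v\<^sub>1 * (w * x)" "w * s\<^sub>2 = s\<^sub>1 * w" "w * v\<^sub>2 = v\<^sub>1 * w"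
proof -
  show ww: "w * (w * x) = x" for x using left[OF swap(1)] by simp
  show "w * (s\<^sub>1 * x) = s\<^sub>2 * (w * x)" "w * (v\<^sub>1 * x) = v\<^sub>2 * (w * x)" for x
    using left[OF swap(2)] left[OF swap(3)] by (simp_all add: mult.assoc)
  show ws\<^sub>2: "w * s\<^sub>2 = s\<^sub>1 * w" using arg_cong[OF swap(2), of "\<lambda>y. w * (y * w)"] swap(1) ww by (simp add: mult.assoc)
  show wv\<^sub>2: "w * v\<^sub>2 = v\<^sub>1 * w" using arg_cong[OF swap(3), of "\<lambda>y. w * (y * w)"] swap(1) ww by (simp add: mult.assoc)
  show "w * (s\<^sub>2 * x) = s\<^sub>1 * (w * x)" "w * (v\<^sub>2 * x) = v\<^sub>1 * (w * x)" for x
    using left[OF ws\<^sub>2] left[OF wv\<^sub>2] by (simp_all add: mult.assoc)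
qed

sublocale second: one_qubit s\<^sub>2 v\<^sub>2
proof
  \<comment> \<open>As \<open>w\<close> is invertible, a relation may be checked after
    multiplication by \<open>w\<close> on the right; moving \<open>w\<close> to the left turns it
    into the relation for the first wire.\<close>
  have conj: "a * w = b * w \<Longrightarrow> a = b" for a b
    by (metis mult.assoc mult_1_right swap(1))
  show "s\<^sub>2 * (s\<^sub>2 * (s\<^sub>2 * s\<^sub>2)) = 1"
    by (rule conj) (simp add: mult.assoc swap(2)[symmetric], simp add: w_simps(2)[symmetric] s4)
  show "v\<^sub>2 * (v\<^sub>2 * (v\<^sub>2 * v\<^sub>2)) = 1"
    by (rule conj) (simp add: mult.assoc swap(3)[symmetric], simp add: w_simps(3)[symmetric] v4)
  show "v\<^sub>2 * (s\<^sub>2 * v\<^sub>2) = s\<^sub>2 * (v\<^sub>2 * s\<^sub>2)"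
    by (rule conj) (simp add: mult.assoc swap(2,3)[symmetric], simp add: w_simps(2,3)[symmetric] braid)
  show "v\<^sub>2 * (v\<^sub>2 * s\<^sub>2) = s\<^sub>2 * (s\<^sub>2 * (s\<^sub>2 * (v\<^sub>2 * v\<^sub>2)))"
    by (rule conj) (simp add: mult.assoc swap(2,3)[symmetric], simp add: w_simps(2,3)[symmetric] v2s)
  show "s\<^sub>2 * (s\<^sub>2 * v\<^sub>2) = v\<^sub>2 * (v\<^sub>2 * (v\<^sub>2 * (s\<^sub>2 * s\<^sub>2)))"
    by (rule conj) (simp add: mult.assoc swap(2,3)[symmetric], simp add: w_simps(2,3)[symmetric] s2v)
qed

lemmas normalise = commute commute[THEN left, unfolded mult.assoc] completion second.completion

text \<open>The Hadamard gate in its Euler form.\<close>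

definition h\<^sub>1 where "h\<^sub>1 = s\<^sub>1 * (v\<^sub>1 * s\<^sub>1)"
definition h\<^sub>2 where "h\<^sub>2 = s\<^sub>2 * (v\<^sub>2 * s\<^sub>2)"

text \<open>Conjugation by \<open>J\<close>, a colour change followed by the swap, fixes \<open>c\<close> and exchanges \<open>s\<^sub>1\<close> with \<open>v\<^sub>2\<close> and
  \<open>v\<^sub>1\<close> with \<open>s\<^sub>2\<close>.\<close>

definition J where "J = w * (h\<^sub>1 * h\<^sub>2)"

lemma J: "J * (J * x) = x" "J * (s\<^sub>1 * x) = v\<^sub>2 * (J * x)" "J * (v\<^sub>1 * x) = s\<^sub>2 * (J * x)"
  "J * (s\<^sub>2 * x) = v\<^sub>1 * (J * x)" "J * (v\<^sub>2 * x) = s\<^sub>1 * (J * x)"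
  unfolding J_def h\<^sub>1_def h\<^sub>2_def by (simp_all add: w_simps normalise)

text \<open>By \<open>wcw\<close> the swap and the Hadamard gates on both wires conjugate
  \<open>c\<close> to the same element, so their combination \<open>J\<close> commutes with
  \<open>c\<close>.\<close>

lemma cJ: "c * (J * x) = J * (c * x)"
proof -
  have "w * (c * (w * y)) = h\<^sub>1 * (h\<^sub>2 * (c * (h\<^sub>1 * (h\<^sub>2 * y))))" for y
    using arg_cong[OF wcw, of "\<lambda>z. z * y"] unfolding h\<^sub>1_def h\<^sub>2_def by (simp add: mult.assoc)
  from this[of "h\<^sub>1 * (h\<^sub>2 * x)"] have "w * (c * (J * x)) = h\<^sub>1 * (h\<^sub>2 * (c * x))"
    unfolding J_def h\<^sub>1_def h\<^sub>2_def by (simp add: normalise)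
  then have "w * (w * (c * (J * x))) = w * (h\<^sub>1 * (h\<^sub>2 * (c * x)))" by simp
  then show ?thesis unfolding J_def by (simp add: w_simps(1) mult.assoc)
qed

text \<open>Rules for the target are images of those for the control under conjugation by
  \<open>J\<close>. Each is proved behind two factors \<open>J\<close>, which cancel.\<close>

lemma c_simps:
  "c * (c * x) = x"
  "c * (s\<^sub>1 * x) = s\<^sub>1 * (c * x)" "c * (v\<^sub>2 * x) = v\<^sub>2 * (c * x)"
  "c * (v\<^sub>1 * (v\<^sub>1 * x)) = v\<^sub>1 * (v\<^sub>1 * (v\<^sub>2 * (v\<^sub>2 * (c * x))))"
  "c * (s\<^sub>2 * (s\<^sub>2 * x)) = s\<^sub>1 * (s\<^sub>1 * (s\<^sub>2 * (s\<^sub>2 * (c * x))))"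
  "c * (v\<^sub>1 * (c * x)) = v\<^sub>1 * (v\<^sub>2 * (h\<^sub>1 * (c * (h\<^sub>1 * x))))"
  "c * (s\<^sub>2 * (c * x)) = s\<^sub>1 * (s\<^sub>2 * (h\<^sub>2 * (c * (h\<^sub>2 * x))))"
proof -
  show "c * (c * x) = x" for x using left[OF cc] by simp
  show s: "c * (s\<^sub>1 * x) = s\<^sub>1 * (c * x)" for x using left[OF cs\<^sub>1] by (simp add: mult.assoc)
  show vv: "c * (v\<^sub>1 * (v\<^sub>1 * x)) = v\<^sub>1 * (v\<^sub>1 * (v\<^sub>2 * (v\<^sub>2 * (c * x))))" for x
    using left[OF cv\<^sub>1v\<^sub>1] by (simp add: mult.assoc)
  show v: "c * (v\<^sub>1 * (c * x)) = v\<^sub>1 * (v\<^sub>2 * (h\<^sub>1 * (c * (h\<^sub>1 * x))))" for x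
    using left[OF cv\<^sub>1c] by (simp add: mult.assoc h\<^sub>1_def)
  have "J * (J * (c * (v\<^sub>2 * x))) = J * (J * (v\<^sub>2 * (c * x)))"
    by (simp only: cJ[symmetric] J(5) s)
  then show "c * (v\<^sub>2 * x) = v\<^sub>2 * (c * x)" by (simp only: J(1))
  have "J * (J * (c * (s\<^sub>2 * (s\<^sub>2 * x)))) = J * (J * (s\<^sub>1 * (s\<^sub>1 * (s\<^sub>2 * (s\<^sub>2 * (c * x))))))"
    by (simp only: cJ[symmetric] J(4) vv) (simp add: cJ J normalise)
  then show "c * (s\<^sub>2 * (s\<^sub>2 * x)) = s\<^sub>1 * (s\<^sub>1 * (s\<^sub>2 * (s\<^sub>2 * (c * x))))" by (simp only: J(1))
  have "J * (J * (c * (s\<^sub>2 * (c * x)))) = J * (J * (s\<^sub>1 * (s\<^sub>2 * (h\<^sub>2 * (c * (h\<^sub>2 * x))))))"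
    by (simp only: cJ[symmetric] J(4) v) (simp add: cJ[symmetric] J normalise h\<^sub>1_def h\<^sub>2_def)
  then show "c * (s\<^sub>2 * (c * x)) = s\<^sub>1 * (s\<^sub>2 * (h\<^sub>2 * (c * (h\<^sub>2 * x))))" by (simp only: J(1))
qed

text \<open>Moving the swap to the left of \<open>c\<close> costs only Hadamard gates. This reduces
  the action of \<open>c\<close> on \<open>w L\<close> and \<open>w K\<close> to its action on
  \<open>L\<close> and \<open>K\<close>.\<close>

lemma cw: "c * (w * x) = w * (h\<^sub>1 * (h\<^sub>2 * (c * (h\<^sub>1 * (h\<^sub>2 * x)))))"
proof -
  have "w * (w * (c * (w * x))) = w * (h\<^sub>1 * (h\<^sub>2 * (c * (h\<^sub>1 * (h\<^sub>2 * x)))))"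
    using left[OF wcw, of x] unfolding h\<^sub>1_def h\<^sub>2_def by (simp add: mult.assoc)
  then show ?thesis by (simp only: w_simps(1))
qed

text \<open>Two controlled-nots separated by rotations on both qubits make one controlled-not and a swap: this is
  the relation cwcwc, that three controlled-nots make a swap, in disguise.\<close>

lemma cv\<^sub>1s\<^sub>2c: "c * (v\<^sub>1 * (s\<^sub>2 * (c * x))) =
  s\<^sub>1 * (s\<^sub>1 * (s\<^sub>1 * (v\<^sub>2 * (v\<^sub>2 * (v\<^sub>2 * (w * (c * (h\<^sub>1 * (h\<^sub>2 * (s\<^sub>1 * (s\<^sub>1 * (s\<^sub>1 * (v\<^sub>2 * (v\<^sub>2 * (v\<^sub>2 * x)))))))))))))))"
proof -
  have 1: "c * (w * (c * y)) = w * (c * (w * y))" for y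
  proof -
    have "c * (w * (c * (w * (c * z)))) = w * z" for z
      using left[OF cwcwc, of z] by (simp add: mult.assoc)
    from this[of "c * (w * y)"] show ?thesis by (simp only: c_simps(1) w_simps(1))
  qed
  have 2: "c * (h\<^sub>1 * (h\<^sub>2 * (c * (h\<^sub>1 * (h\<^sub>2 * y))))) = w * (c * y)" for y
  proof -
    have "h\<^sub>1 * (h\<^sub>2 * (c * (h\<^sub>1 * (h\<^sub>2 * y)))) = w * (c * (w * y))"
      using cw[of y] by (simp only: w_simps(1))
    also have "\<dots> = c * (w * (c * y))" by (simp only: 1)
    finally show ?thesis by (simp only: c_simps(1))
  qed
  \<comment> \<open>By the braid relation the second Hadamard gate can be written with
    \<open>v\<^sub>2\<close> outside, just as the first has \<open>s\<^sub>1\<close> outside. These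
    outer factors commute with \<open>c\<close>, so \<open>4\<close> can move them out on both
    sides.\<close>
  have 3: "c * (s\<^sub>1 * (v\<^sub>1 * (s\<^sub>1 * (v\<^sub>2 * (s\<^sub>2 * (v\<^sub>2 * (c * y))))))) = w * (c * (h\<^sub>1 * (h\<^sub>2 * y)))" for y
    using 2[of "h\<^sub>1 * (h\<^sub>2 * y)"] unfolding h\<^sub>1_def h\<^sub>2_def by (simp add: normalise)
  have 4: "s\<^sub>1 * (v\<^sub>2 * (c * (v\<^sub>1 * (s\<^sub>2 * (c * (s\<^sub>1 * (v\<^sub>2 * y))))))) = w * (c * (h\<^sub>1 * (h\<^sub>2 * y)))" for y
  proof -
    have "c * (v\<^sub>1 * (s\<^sub>1 * (v\<^sub>2 * z))) = v\<^sub>2 * (c * (v\<^sub>1 * (s\<^sub>1 * z)))" for z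
      unfolding c_simps(3)[symmetric] by (simp add: normalise)
    then show ?thesis
      unfolding 3[symmetric] by (simp add: c_simps(2,3) commute[THEN left, unfolded mult.assoc])
  qed
  \<comment> \<open>The cubes are inverses; they cancel the outer factors in
    \<open>4\<close>.\<close>
  have s1: "s\<^sub>1 * (v\<^sub>2 * (s\<^sub>1 * (s\<^sub>1 * (s\<^sub>1 * (v\<^sub>2 * (v\<^sub>2 * (v\<^sub>2 * y))))))) = y"
    and s2: "s\<^sub>1 * (s\<^sub>1 * (s\<^sub>1 * (v\<^sub>2 * (v\<^sub>2 * (v\<^sub>2 * (s\<^sub>1 * (v\<^sub>2 * y))))))) = y" for y
    by (simp_all add: normalise)
  show ?thesis
    unfolding 4[symmetric] s1 s2 by simp
qed

section \<open>Coset normal form and its closure under gates\<close>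

definition L where "L = generated {s\<^sub>1, v\<^sub>1, s\<^sub>2, v\<^sub>2}"

definition K where
  "K = {a * (b * (c * l)) | a b l. a \<in> {1, v\<^sub>1, s\<^sub>1 * v\<^sub>1} \<and> b \<in> {1, s\<^sub>2, v\<^sub>2 * s\<^sub>2} \<and> l \<in> L}"

definition T where "T = L \<union> (*) w ` L \<union> K \<union> (*) w ` K"

lemma L_gens: "g \<in> {s\<^sub>1, v\<^sub>1, s\<^sub>2, v\<^sub>2} \<Longrightarrow> x \<in> L \<Longrightarrow> g * x \<in> L"
  unfolding L_def by (rule generated.mult)

lemma h_L: "h\<^sub>1 \<in> L" "h\<^sub>2 \<in> L"
  unfolding h\<^sub>1_def h\<^sub>2_def L_def by (auto intro!: generated_mult intro: generated_base)

lemma L_mult: "x \<in> L \<Longrightarrow> y \<in> L \<Longrightarrow> x * y \<in> L"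
  unfolding L_def by (rule generated_mult)

lemma KI: "a \<in> {1, v\<^sub>1, s\<^sub>1 * v\<^sub>1} \<Longrightarrow> b \<in> {1, s\<^sub>2, v\<^sub>2 * s\<^sub>2} \<Longrightarrow> l \<in> L \<Longrightarrow> a * (b * (c * l)) \<in> K"
  unfolding K_def by blast

lemma c_L: "l \<in> L \<Longrightarrow> c * l \<in> K"
  using KI[of 1 1 l] by simp

text \<open>\<open>s\<^sub>1\<close> and the square of \<open>v\<^sub>1\<close> pass through
  \<open>c\<close> into \<open>L\<close>. In the one-qubit Clifford group of order 24 they generate
  a dihedral subgroup of order 8, with coset representatives \<open>1\<close>,
  \<open>v\<^sub>1\<close>, \<open>s\<^sub>1 * v\<^sub>1\<close>; a gate on the left changes the
  representative up to an element of this subgroup.\<close>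

lemma K_first:
  assumes g: "g \<in> {s\<^sub>1, v\<^sub>1}" and k: "k \<in> K"
  shows "g * k \<in> K"
proof -
  obtain a b l where abl: "a \<in> {1, v\<^sub>1, s\<^sub>1 * v\<^sub>1}" "b \<in> {1, s\<^sub>2, v\<^sub>2 * s\<^sub>2}" "l \<in> L" "k = a * (b * (c * l))"
    using k unfolding K_def by blast
  have s: "s\<^sub>1 * (b * (c * x)) = b * (c * (s\<^sub>1 * x))" for x
    using abl(2) by (auto simp: c_simps normalise)
  have vv: "v\<^sub>1 * (v\<^sub>1 * (b * (c * x))) = b * (c * (v\<^sub>1 * (v\<^sub>1 * (v\<^sub>2 * (v\<^sub>2 * x)))))" for x
    using abl(2) by (auto simp: c_simps normalise)
  have L: "s\<^sub>1 * l \<in> L" "v\<^sub>1 * (v\<^sub>1 * (v\<^sub>2 * (v\<^sub>2 * l))) \<in> L" "v\<^sub>1 * (v\<^sub>1 * (v\<^sub>2 * (v\<^sub>2 * (s\<^sub>1 * (s\<^sub>1 * l))))) \<in> L"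
    using abl(3) by (auto intro!: L_gens)
  consider "g = s\<^sub>1" "a = 1" | "g = s\<^sub>1" "a = v\<^sub>1" | "g = s\<^sub>1" "a = s\<^sub>1 * v\<^sub>1"
    | "g = v\<^sub>1" "a = 1" | "g = v\<^sub>1" "a = v\<^sub>1" | "g = v\<^sub>1" "a = s\<^sub>1 * v\<^sub>1"
    using g abl(1) by blast
  then show ?thesis
  proof cases
    case 1
    then show ?thesis using KI[of 1 b "s\<^sub>1 * l"] abl L by (simp add: s)
  next
    case 2
    then show ?thesis using KI[of "s\<^sub>1 * v\<^sub>1" b l] abl by (simp add: mult.assoc)
  next
    case 3
    \<comment> \<open>The relation \<open>s2v\<close> brings \<open>v\<^sub>1\<close> to the front
      as the new representative; what follows consists of squares and moves into
      \<open>L\<close>.\<close>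
    have "g * k = v\<^sub>1 * (v\<^sub>1 * (v\<^sub>1 * (s\<^sub>1 * (s\<^sub>1 * (b * (c * l))))))"
      unfolding 3 abl(4) base_rewrites(5) by (simp only: mult.assoc)
    also have "\<dots> = v\<^sub>1 * (b * (c * (v\<^sub>1 * (v\<^sub>1 * (v\<^sub>2 * (v\<^sub>2 * (s\<^sub>1 * (s\<^sub>1 * l))))))))"
      by (simp only: s vv)
    finally show ?thesis using KI[of v\<^sub>1 b] abl L by simp
  next
    case 4
    then show ?thesis using KI[of v\<^sub>1 b l] abl by simp
  next
    case 5
    then show ?thesis using KI[of 1 b "v\<^sub>1 * (v\<^sub>1 * (v\<^sub>2 * (v\<^sub>2 * l)))"] abl L by (simp add: vv)
  next
    case 6
    have "g * k = s\<^sub>1 * v\<^sub>1 * (b * (c * (s\<^sub>1 * l)))"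
      using 6 abl(4) base_rewrites(3)[of "b * (c * l)"] by (simp add: mult.assoc s)
    then show ?thesis using KI[of "s\<^sub>1 * v\<^sub>1" b] abl L by simp
  qed
qed

text \<open>The mirror image under \<open>J\<close>: on the target \<open>v\<^sub>2\<close> and the
  square of \<open>s\<^sub>2\<close> pass through \<open>c\<close>.\<close>

lemma K_second:
  assumes g: "g \<in> {s\<^sub>2, v\<^sub>2}" and k: "k \<in> K"
  shows "g * k \<in> K"
proof -
  obtain a b l where abl: "a \<in> {1, v\<^sub>1, s\<^sub>1 * v\<^sub>1}" "b \<in> {1, s\<^sub>2, v\<^sub>2 * s\<^sub>2}" "l \<in> L" "k = a * (b * (c * l))"
    using k unfolding K_def by blast
  have ga: "g * k = a * (g * (b * (c * l)))"
    using g abl(1,4) by (auto simp: commute[THEN left] mult.assoc)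
  have ss: "s\<^sub>2 * (s\<^sub>2 * (c * x)) = c * (s\<^sub>1 * (s\<^sub>1 * (s\<^sub>2 * (s\<^sub>2 * x))))" for x
    by (simp add: c_simps normalise)
  have L: "v\<^sub>2 * l \<in> L" "s\<^sub>1 * (s\<^sub>1 * (s\<^sub>2 * (s\<^sub>2 * l))) \<in> L" "s\<^sub>1 * (s\<^sub>1 * (s\<^sub>2 * (s\<^sub>2 * (v\<^sub>2 * (v\<^sub>2 * l))))) \<in> L"
    using abl(3) by (auto intro!: L_gens)
  consider "g = v\<^sub>2" "b = 1" | "g = v\<^sub>2" "b = s\<^sub>2" | "g = v\<^sub>2" "b = v\<^sub>2 * s\<^sub>2"
    | "g = s\<^sub>2" "b = 1" | "g = s\<^sub>2" "b = s\<^sub>2" | "g = s\<^sub>2" "b = v\<^sub>2 * s\<^sub>2"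
    using g abl(2) by blast
  then show ?thesis
  proof cases
    case 1
    then show ?thesis using KI[of a 1 "v\<^sub>2 * l"] abl L unfolding ga by (simp add: c_simps)
  next
    case 2
    then show ?thesis using KI[of a "v\<^sub>2 * s\<^sub>2" l] abl unfolding ga by (simp add: mult.assoc)
  next
    case 3
    have "g * (b * (c * l)) = s\<^sub>2 * (s\<^sub>2 * (s\<^sub>2 * (v\<^sub>2 * (v\<^sub>2 * (c * l)))))"
      using 3 by (simp add: second.base_rewrites(4) mult.assoc)
    also have "\<dots> = s\<^sub>2 * (c * (s\<^sub>1 * (s\<^sub>1 * (s\<^sub>2 * (s\<^sub>2 * (v\<^sub>2 * (v\<^sub>2 * l)))))))"
      by (simp only: c_simps(3)[symmetric] ss)
    finally show ?thesis using KI[of a s\<^sub>2] abl L unfolding ga by simp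
  next
    case 4
    then show ?thesis using KI[of a s\<^sub>2 l] abl unfolding ga by simp
  next
    case 5
    then show ?thesis using KI[of a 1 "s\<^sub>1 * (s\<^sub>1 * (s\<^sub>2 * (s\<^sub>2 * l)))"] abl L unfolding ga by (simp add: ss)
  next
    case 6
    have "g * (b * (c * l)) = v\<^sub>2 * s\<^sub>2 * (c * (v\<^sub>2 * l))"
      using 6 second.base_rewrites(3)[of "c * l"] by (simp add: mult.assoc c_simps)
    then show ?thesis using KI[of a "v\<^sub>2 * s\<^sub>2"] abl L unfolding ga by simp
  qed
qed

lemma T_cases:
  assumes "t \<in> T"
  obtains x where "x \<in> L \<union> K" "t = x" | x where "x \<in> L \<union> K" "t = w * x"
  using assms unfolding T_def by blast

lemma T_I: "x \<in> L \<union> K \<Longrightarrow> x \<in> T" "x \<in> L \<union> K \<Longrightarrow> w * x \<in> T"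
  unfolding T_def by blast+

lemma T_w: "t \<in> T \<Longrightarrow> w * t \<in> T"
  by (erule T_cases) (auto simp: w_simps(1) intro: T_I)

lemma T_gens:
  assumes g: "g \<in> {s\<^sub>1, v\<^sub>1, s\<^sub>2, v\<^sub>2}" and t: "t \<in> T"
  shows "g * t \<in> T"
proof -
  have LK: "f * x \<in> L \<union> K" if "f \<in> {s\<^sub>1, v\<^sub>1, s\<^sub>2, v\<^sub>2}" "x \<in> L \<union> K" for f x
    using that L_gens[of f x] K_first[of f x] K_second[of f x] by blast
  \<comment> \<open>Behind the swap \<open>g\<close> acts as the corresponding gate \<open>f\<close>
    of the other wire.\<close>
  obtain f where f: "f \<in> {s\<^sub>1, v\<^sub>1, s\<^sub>2, v\<^sub>2}" "\<And>x. g * (w * x) = w * (f * x)"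
    using g w_simps(2-5) by (metis insertI1 insertI2 insertE singletonD)
  from t show ?thesis
  proof (cases rule: T_cases)
    case (1 x)
    then show ?thesis using LK[OF g] T_I(1) by simp
  next
    case (2 x)
    then show ?thesis using LK[OF f(1)] f(2) T_I(2) by simp
  qed
qed

lemma T_L: "l \<in> L \<Longrightarrow> t \<in> T \<Longrightarrow> l * t \<in> T"
  unfolding L_def by (induction rule: generated.induct) (auto simp: mult.assoc intro: T_gens)

lemma T_cK:
  assumes k: "k \<in> K"
  shows "c * k \<in> T"
proof -
  obtain a b l where abl: "a \<in> {1, v\<^sub>1, s\<^sub>1 * v\<^sub>1}" "b \<in> {1, s\<^sub>2, v\<^sub>2 * s\<^sub>2}" "l \<in> L" "k = a * (b * (c * l))"
    using k unfolding K_def by blast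
  have hL: "h\<^sub>1 * l \<in> L" "h\<^sub>2 * l \<in> L" using h_L L_mult abl(3) by blast+
  \<comment> \<open>With at most one phase gate per wire between the two \<open>c\<close>,
    \<open>c_simps\<close> settles three products and \<open>cv\<^sub>1s\<^sub>2c\<close> the
    fourth.\<close>
  have base: "c * (a' * (b' * (c * l))) \<in> T" if ab: "a' \<in> {1, v\<^sub>1}" "b' \<in> {1, s\<^sub>2}" for a' b'
  proof -
    have "l \<in> T" "c * (h\<^sub>1 * l) \<in> T" "c * (h\<^sub>2 * l) \<in> T" using abl(3) hL c_L T_I(1) by blast+
    then have "c * (c * l) \<in> T" "c * (v\<^sub>1 * (c * l)) \<in> T" "c * (s\<^sub>2 * (c * l)) \<in> T"
      unfolding c_simps by (simp_all add: T_gens T_L h_L)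
    moreover have "c * (v\<^sub>1 * (s\<^sub>2 * (c * l))) \<in> T"
    proof -
      have "c * (h\<^sub>1 * (h\<^sub>2 * (s\<^sub>1 * (s\<^sub>1 * (s\<^sub>1 * (v\<^sub>2 * (v\<^sub>2 * (v\<^sub>2 * l)))))))) \<in> T"
        using abl(3) by (intro T_I(1) UnI2 c_L) (simp add: L_gens L_mult h_L)
      then show ?thesis unfolding cv\<^sub>1s\<^sub>2c by (simp add: T_gens T_w)
    qed
    ultimately show ?thesis using ab by auto
  qed
  \<comment> \<open>The leading \<open>s\<^sub>1\<close> of \<open>s\<^sub>1 * v\<^sub>1\<close>
    commutes with \<open>c\<close> and is absorbed by \<open>T\<close>, which leaves
    \<open>1\<close> and \<open>v\<^sub>1\<close>. The same happens to the leading
    \<open>v\<^sub>2\<close> of \<open>b\<close>.\<close>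
  obtain a' where a: "a' \<in> {1, v\<^sub>1}" "\<And>x. (c * (a' * x) \<in> T \<Longrightarrow> c * (a * x) \<in> T)"
  proof (cases "a = s\<^sub>1 * v\<^sub>1")
    case True
    show ?thesis by (rule that[of v\<^sub>1]) (auto simp: True mult.assoc c_simps(2) intro: T_gens)
  qed (use abl(1) that in blast)
  obtain b' where b: "b' \<in> {1, s\<^sub>2}" "\<And>x. (c * (a' * (b' * x)) \<in> T \<Longrightarrow> c * (a' * (b * x)) \<in> T)"
  proof (cases "b = v\<^sub>2 * s\<^sub>2")
    case True
    have "c * (a' * (b * x)) = v\<^sub>2 * (c * (a' * (s\<^sub>2 * x)))" for x
      using a(1) unfolding c_simps(3)[symmetric] True by (auto simp: mult.assoc commute[THEN left])
    then show ?thesis using that[of s\<^sub>2] by (auto intro: T_gens)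
  qed (use abl(2) that in blast)
  show ?thesis unfolding abl(4) by (rule a(2), rule b(2), rule base[OF a(1) b(1)])
qed

lemma L_K: "l \<in> L \<Longrightarrow> k \<in> K \<Longrightarrow> l * k \<in> K"
  unfolding L_def
proof (induction rule: generated.induct)
  case (mult g x)
  then show ?case using K_first[of g "x * k"] K_second[of g "x * k"] by (auto simp: mult.assoc)
qed simp

lemma T_c:
  assumes "t \<in> T"
  shows "c * t \<in> T"
  using assms
proof (cases rule: T_cases)
  case (1 x)
  then show ?thesis using T_cK c_L T_I(1) by blast
next
  case (2 x)
  have "c * (h\<^sub>1 * (h\<^sub>2 * x)) \<in> T"
    using 2(1)
  proof
    assume "x \<in> L"
    then show ?thesis using c_L L_mult h_L T_I(1) by blast
  next
    assume "x \<in> K"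
    then show ?thesis using T_cK L_K h_L by blast
  qed
  then show ?thesis unfolding 2(2) cw by (rule T_w[OF T_L[OF h_L(1) T_L[OF h_L(2)]]])
qed

text \<open>Gates on different wires commute, so local words can be sorted by wire; this is the
  shape of a tensor product of two one-qubit diagrams.\<close>

lemma L_eq: "L = {p * q | p q. p \<in> generated {s\<^sub>1, v\<^sub>1} \<and> q \<in> generated {s\<^sub>2, v\<^sub>2}}" (is "L = ?R")
proof
  have comm: "g * (p * q) = p * (g * q)" if "g \<in> {s\<^sub>2, v\<^sub>2}" "p \<in> generated {s\<^sub>1, v\<^sub>1}" for g p q
    using that(2)
  proof (induction arbitrary: q rule: generated.induct)
    case (mult f x)
    then show ?case using that(1) by (auto simp: mult.assoc commute[THEN left])
  qed simp
  show "L \<subseteq> ?R"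
  proof
    fix x assume "x \<in> L"
    then show "x \<in> ?R" unfolding L_def
    proof induction
      case one
      show ?case by (intro CollectI exI[of _ 1]) (simp add: generated.one)
    next
      case (mult g x)
      then obtain p q where pq: "x = p * q" "p \<in> generated {s\<^sub>1, v\<^sub>1}" "q \<in> generated {s\<^sub>2, v\<^sub>2}" by blast
      show ?case
      proof (cases "g \<in> {s\<^sub>1, v\<^sub>1}")
        case True
        then have "g * p \<in> generated {s\<^sub>1, v\<^sub>1}" using pq(2) by (rule generated.mult)
        moreover have "g * x = (g * p) * q" using pq(1) by (simp add: mult.assoc)
        ultimately show ?thesis using pq(3) by blast
      next
        case False
        then have g: "g \<in> {s\<^sub>2, v\<^sub>2}" using mult(1) by blast
        then have "g * q \<in> generated {s\<^sub>2, v\<^sub>2}" using pq(3) by (rule generated.mult)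
        then show ?thesis using comm[OF g pq(2)] pq by blast
      qed
    qed
  qed
  have "generated A \<subseteq> generated B" if "A \<subseteq> B" for A B :: "'a set"
  proof
    fix x assume "x \<in> generated A"
    then show "x \<in> generated B" by induction (use that in \<open>auto intro: generated.intros\<close>)
  qed
  then have "generated {s\<^sub>1, v\<^sub>1} \<subseteq> L" "generated {s\<^sub>2, v\<^sub>2} \<subseteq> L" unfolding L_def by simp_all
  then show "?R \<subseteq> L" using L_mult by blast
qed

end

section \<open>Two-qubit circuits modulo equivalence\<close>

definition two_qubit :: "zx_diagram \<Rightarrow> bool" where
  "two_qubit D \<longleftrightarrow> is_diagram D \<and> ins D = 2 \<and> outs D = 2"

lemma two_qubit_simps [simp]:
  "two_qubit (wire_id 2)" "two_qubit wire_swap" "two_qubit CNOT"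
  "two_qubit (gate\<^sub>1 l)" "two_qubit (gate\<^sub>2 l)"
  by (simp_all add: two_qubit_def gate\<^sub>1_def gate\<^sub>2_def is_diagram_tensor)

lemma two_qubit_comp [simp]: "two_qubit g \<Longrightarrow> two_qubit k \<Longrightarrow> two_qubit (g \<circ>\<^sub>z k)"
  by (simp add: two_qubit_def is_diagram_comp)

definition circuit_rel :: "zx_diagram \<Rightarrow> zx_diagram \<Rightarrow> bool" where
  "circuit_rel D E \<longleftrightarrow> two_qubit D \<and> two_qubit E \<and> D \<leftrightarrow>\<^sub>* E"

\<comment> \<open>The quotient is partial because \<open>zx_equiv\<close> is reflexive on ill-formed
  records too. Restricted to well-formed diagrams with two inputs and two outputs, composition is
  total and respects equivalence.\<close>
quotient_type circuit = zx_diagram / partial: circuit_rel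
proof (rule part_equivpI)
  show "\<exists>D. circuit_rel D D"
    by (rule exI[of _ "wire_id 2"]) (simp add: circuit_rel_def)
  show "symp circuit_rel" unfolding symp_def circuit_rel_def using zx_equiv_sym by blast
  show "transp circuit_rel" unfolding transp_def circuit_rel_def using zx_equiv_trans by blast
qed

lemma zx_comp_wire_id:
  assumes "two_qubit D"
  shows "D \<circ>\<^sub>z wire_id 2 \<leftrightarrow>\<^sub>* D"
proof (rule equiv_if_same_nets)
  have D: "is_diagram D" "ins D = 2" using assms by (simp_all add: two_qubit_def)
  show "is_diagram (D \<circ>\<^sub>z wire_id 2)" using D by (simp add: is_diagram_comp)
  fix N :: "zx_port set net" assume N: "realises (D \<circ>\<^sub>z wire_id 2) N"
  obtain "is" os U where eq: "N = (is, os, U)" by (cases N)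
  obtain ms V W where "U = V + W" "realises (wire_id 2) (is, ms, V)" "realises D (ms, os, W)"
    using realises_compE[OF N[unfolded eq] D(1)] D(2) by (metis diagram_simps(2) is_diagram_wire_id)
  then show "realises D N" using realises_wire_idE[of 2 "is" ms V] eq by simp
qed

instantiation circuit :: monoid_mult
begin

lift_definition one_circuit :: circuit is "wire_id 2"
  by (simp add: circuit_rel_def)

lift_definition times_circuit :: "circuit \<Rightarrow> circuit \<Rightarrow> circuit" is "(\<circ>\<^sub>z)"
proof -
  fix g g' k k' assume "circuit_rel g g'" "circuit_rel k k'"
  then have "two_qubit g" "two_qubit g'" "two_qubit k" "two_qubit k'" "g \<leftrightarrow>\<^sub>* g'" "k \<leftrightarrow>\<^sub>* k'"
    unfolding circuit_rel_def by simp_all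
  moreover from this have "g \<circ>\<^sub>z k \<leftrightarrow>\<^sub>* g \<circ>\<^sub>z k'" "g \<circ>\<^sub>z k' \<leftrightarrow>\<^sub>* g' \<circ>\<^sub>z k'"
    by (simp_all add: two_qubit_def zx_equiv_comp_left zx_equiv_comp_right)
  ultimately show "circuit_rel (g \<circ>\<^sub>z k) (g' \<circ>\<^sub>z k')"
    unfolding circuit_rel_def using zx_equiv_trans by auto
qed

instance
proof
  fix a b c :: circuit
  show "a * b * c = a * (b * c)"
    by transfer (auto simp: circuit_rel_def two_qubit_def intro!: zx_comp_assoc is_diagram_comp)
  show "1 * a = a"
  proof transfer
    fix D assume "circuit_rel D D"
    moreover from this have "wire_id 2 \<circ>\<^sub>z D = D"
      using comp_wire_id_circles[of D 2 0] by (simp add: circuit_rel_def two_qubit_def wire_id_def)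
    ultimately show "circuit_rel (wire_id 2 \<circ>\<^sub>z D) D" by simp
  qed
  show "a * 1 = a"
    by transfer (simp add: circuit_rel_def zx_comp_wire_id)
qed

end

section \<open>Classes of the gates and the verified relations\<close>

abbreviation cl :: "zx_diagram \<Rightarrow> circuit" where
  "cl \<equiv> abs_circuit"

lemma cl_eq_iff:
  assumes "two_qubit D" "two_qubit E"
  shows "cl D = cl E \<longleftrightarrow> D \<leftrightarrow>\<^sub>* E"
  using Quotient_rel[OF Quotient_circuit, of D E] assms by (simp add: circuit_rel_def)

lemma cl_comp: "two_qubit g \<Longrightarrow> two_qubit k \<Longrightarrow> cl (g \<circ>\<^sub>z k) = cl g * cl k"
  by (simp add: times_circuit.abs_eq circuit_rel_def)

lemma cl_wire_id: "cl (wire_id 2) = 1"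
  by (simp add: one_circuit.abs_eq)

lemma cl_eqI: "D \<leftrightarrow>\<^sub>* E \<Longrightarrow> two_qubit D \<Longrightarrow> two_qubit E \<Longrightarrow> cl D = cl E"
  by (simp add: cl_eq_iff)

lemma cl_gate1_fuse: "cl (gate\<^sub>1 (lab t \<alpha>)) * cl (gate\<^sub>1 (lab t \<beta>)) = cl (gate\<^sub>1 (lab t (\<beta> + \<alpha>)))"
  using cl_eqI[OF gate1_fuse] by (simp add: cl_comp)

lemma cl_gate1_zero: "cl (gate\<^sub>1 (lab t 0)) = 1"
  using cl_eqI[OF gate1_zero] by (simp add: cl_wire_id)

lemma cl_phase_gates:
  "cl (gate\<^sub>1 z_pi) = cl (gate\<^sub>1 z_p) * cl (gate\<^sub>1 z_p)"
  "cl (gate\<^sub>1 z_m) = cl (gate\<^sub>1 z_p) * (cl (gate\<^sub>1 z_p) * cl (gate\<^sub>1 z_p))"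
  "cl (gate\<^sub>1 x_pi) = cl (gate\<^sub>1 x_p) * cl (gate\<^sub>1 x_p)"
  "cl (gate\<^sub>1 x_m) = cl (gate\<^sub>1 x_p) * (cl (gate\<^sub>1 x_p) * cl (gate\<^sub>1 x_p))"
  "cl (gate\<^sub>1 Hl) = cl (gate\<^sub>1 z_p) * (cl (gate\<^sub>1 x_p) * cl (gate\<^sub>1 z_p))"
  using cl_gate1_fuse[of False 1] cl_gate1_fuse[of True 1] cl_eqI[OF gate1_euler[of False]]
  by (simp_all add: cl_comp lab_def)

lemma cl_swap_gate1: "cl wire_swap * cl (gate\<^sub>1 l) = cl (gate\<^sub>2 l) * cl wire_swap"
  using cl_eqI[OF swap_gate1] by (simp add: cl_comp)

lemma cl_swap_swap: "cl wire_swap * cl wire_swap = 1"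
  using cl_eqI[OF swap_swap] by (simp add: cl_comp cl_wire_id)

lemma cl_swap_swap_left: "cl wire_swap * (cl wire_swap * x) = x"
  by (simp add: cl_swap_swap flip: mult.assoc)

lemma cl_gate2: "cl (gate\<^sub>2 l) = cl wire_swap * (cl (gate\<^sub>1 l) * cl wire_swap)"
proof -
  have "cl (gate\<^sub>2 l) = cl (gate\<^sub>2 l) * (cl wire_swap * cl wire_swap)"
    by (simp add: cl_swap_swap)
  then show ?thesis by (simp only: mult.assoc[symmetric] cl_swap_gate1)
qed

lemma cl_phase_gates2:
  "cl (gate\<^sub>2 z_pi) = cl (gate\<^sub>2 z_p) * cl (gate\<^sub>2 z_p)"
  "cl (gate\<^sub>2 z_m) = cl (gate\<^sub>2 z_p) * (cl (gate\<^sub>2 z_p) * cl (gate\<^sub>2 z_p))"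
  "cl (gate\<^sub>2 x_pi) = cl (gate\<^sub>2 x_p) * cl (gate\<^sub>2 x_p)"
  "cl (gate\<^sub>2 x_m) = cl (gate\<^sub>2 x_p) * (cl (gate\<^sub>2 x_p) * cl (gate\<^sub>2 x_p))"
  "cl (gate\<^sub>2 Hl) = cl (gate\<^sub>2 z_p) * (cl (gate\<^sub>2 x_p) * cl (gate\<^sub>2 z_p))"
  unfolding cl_gate2 cl_phase_gates by (simp_all add: cl_swap_swap_left mult.assoc)

interpretation C: clifford_relations "cl (gate\<^sub>1 z_p)" "cl (gate\<^sub>1 x_p)" "cl (gate\<^sub>2 z_p)" "cl (gate\<^sub>2 x_p)"
  "cl CNOT" "cl wire_swap"
proof
  let ?s = "cl (gate\<^sub>1 z_p)" and ?v = "cl (gate\<^sub>1 x_p)"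
  show "?s * (?s * (?s * ?s)) = 1" "?v * (?v * (?v * ?v)) = 1"
    using cl_gate1_fuse[of False 1] cl_gate1_fuse[of True 1] cl_gate1_zero[of False] cl_gate1_zero[of True]
    by (simp_all add: lab_def net_arith)
  \<comment> \<open>The Euler forms of both colours have the class of \<open>H\<close>.\<close>
  show "?v * (?s * ?v) = ?s * (?v * ?s)"
    using cl_eqI[OF gate1_euler[of False]] cl_eqI[OF gate1_euler[of True]] by (simp add: cl_comp lab_def)
  \<comment> \<open>The angle 3 is chosen because its negative is 1: it turns into a single
    \<open>S\<close> on the other side of the \<pi> phase.\<close>
  show "?v * (?v * ?s) = ?s * (?s * (?s * (?v * ?v)))"
    using cl_eqI[OF gate1_pi[of False 3]] by (simp add: net_arith lab_def cl_comp cl_phase_gates mult.assoc)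
  show "?s * (?s * ?v) = ?v * (?v * (?v * (?s * ?s)))"
    using cl_eqI[OF gate1_pi[of True 3]] by (simp add: net_arith lab_def cl_comp cl_phase_gates mult.assoc)
  have comm0: "cl (gate\<^sub>2 l) * cl (gate\<^sub>1 l') = cl (gate\<^sub>1 l') * cl (gate\<^sub>2 l)" for l l'
    using cl_eqI[OF gate1_gate2[of l l']] by (simp add: cl_comp)
  show "cl (gate\<^sub>2 z_p) * ?s = ?s * cl (gate\<^sub>2 z_p)" "cl (gate\<^sub>2 z_p) * ?v = ?v * cl (gate\<^sub>2 z_p)"
    "cl (gate\<^sub>2 x_p) * ?s = ?s * cl (gate\<^sub>2 x_p)" "cl (gate\<^sub>2 x_p) * ?v = ?v * cl (gate\<^sub>2 x_p)"
    by (rule comm0)+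
  show "cl wire_swap * cl wire_swap = 1" by (rule cl_swap_swap)
  show "cl wire_swap * ?s = cl (gate\<^sub>2 z_p) * cl wire_swap" "cl wire_swap * ?v = cl (gate\<^sub>2 x_p) * cl wire_swap"
    by (rule cl_swap_gate1)+
  show "cl CNOT * cl CNOT = 1"
    using cl_eqI[OF CNOT_CNOT] by (simp add: cl_comp cl_wire_id)
  show "cl CNOT * ?s = ?s * cl CNOT"
    using cl_eqI[OF CNOT_Z_control] by (simp add: cl_comp)
  let ?s' = "cl (gate\<^sub>2 z_p)" and ?v' = "cl (gate\<^sub>2 x_p)" and ?c = "cl CNOT" and ?w = "cl wire_swap"
  have comm: "cl (gate\<^sub>2 l) * (cl (gate\<^sub>1 l') * x) = cl (gate\<^sub>1 l') * (cl (gate\<^sub>2 l) * x)" for l l' x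
    by (simp add: comm0 flip: mult.assoc)
  show "?c * (?v * ?v) = ?v * (?v * (?v' * (?v' * ?c)))"
    using cl_eqI[OF CNOT_X_control] by (simp add: cl_comp cl_phase_gates cl_phase_gates2 mult.assoc comm comm0)
  show "?w * (?c * ?w) = ?s * (?v * ?s) * (?s' * (?v' * ?s') * (?c * (?s * (?v * ?s) * (?s' * (?v' * ?s')))))"
    using cl_eqI[OF CNOT_H] by (simp add: cl_comp cl_phase_gates cl_phase_gates2 mult.assoc comm comm0)
  show "?c * (?v * ?c) = ?v * (?v' * (?s * (?v * ?s) * (?c * (?s * (?v * ?s)))))"
    using cl_eqI[OF CNOT_V_CNOT] by (simp add: cl_comp cl_phase_gates cl_phase_gates2 mult.assoc comm comm0)
  show "?c * (?w * (?c * (?w * ?c))) = ?w"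
    using cl_eqI[OF CNOT_swap_CNOT] by (simp add: cl_comp)
qed


section \<open>The sets of Clifford diagrams\<close>

lemma line_diagram:
  assumes "Hl \<notin> set ls"
  shows "is_diagram (line ls)" "ins (line ls) = 1" "outs (line ls) = 1"
proof -
  have "is_diagram (line ls) \<and> ins (line ls) = 1 \<and> outs (line ls) = 1"
    using assms by (induction ls rule: line.induct) (auto intro!: is_diagram_comp)
  then show "is_diagram (line ls)" "ins (line ls) = 1" "outs (line ls) = 1" by simp_all
qed

text \<open>\<open>line\<close> treats one-letter words by a clause of their own; there the rest of
  the line is a plain wire, which adds nothing to the net.\<close>

lemma realises_line_Cons:
  assumes N: "realises (line (l # ls)) (is, os, U)" and ls: "Hl \<notin> set (l # ls)"
  obtains ms V W where "U = V + W" "realises (vertex l 1 1) (is, ms, V)" "realises (line ls) (ms, os, W)"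
proof (cases ls)
  case Nil
  then have "realises (vertex l 1 1) (is, os, U)" using N by simp
  moreover from this have "length os = 1" by (auto dest: realises_length(2))
  then have "realises (line ls) (os, os, {#})" using Nil realises_wire_id[of os 1] by simp
  ultimately show ?thesis using that[of U "{#}" os] by simp
next
  case (Cons l' ls')
  have d: "is_diagram (line ls)" "is_diagram (vertex l 1 1)" "outs (vertex l 1 1) = ins (line ls)"
    using ls by (simp_all add: line_diagram)
  have "realises (line ls \<circ>\<^sub>z vertex l 1 1) (is, os, U)" using N Cons by simp
  then show ?thesis using realises_compE[OF _ d] that by metis
qed

lemma two_qubit_line: "Hl \<notin> set u \<Longrightarrow> Hl \<notin> set u' \<Longrightarrow> two_qubit (line u \<otimes>\<^sub>z line u')"
  by (simp add: two_qubit_def is_diagram_tensor line_diagram)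

text \<open>The first letter is next to the input and so becomes the rightmost factor. The second
  word is emptied before the first, which leaves \<open>cl_line_first\<close> with a plain second
  wire.\<close>

lemma cl_line_second:
  assumes u: "Hl \<notin> set u" and ls: "Hl \<notin> set (l # ls)"
  shows "cl (line u \<otimes>\<^sub>z line (l # ls)) = cl (line u \<otimes>\<^sub>z line ls) * cl (gate\<^sub>2 l)"
proof -
  have "line u \<otimes>\<^sub>z line (l # ls) \<leftrightarrow>\<^sub>* (line u \<otimes>\<^sub>z line ls) \<circ>\<^sub>z gate\<^sub>2 l"
  proof (rule equiv_if_same_nets)
    show "is_diagram (line u \<otimes>\<^sub>z line (l # ls))" using two_qubit_line[OF u ls] by (simp add: two_qubit_def)
    fix N :: "zx_port set net" assume N: "realises (line u \<otimes>\<^sub>z line (l # ls)) N"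
    obtain "is" os U where eq: "N = (is, os, U)" by (cases N)
    obtain is\<^sub>1 os\<^sub>1 V is\<^sub>2 os\<^sub>2 W where 1: "is = is\<^sub>1 @ is\<^sub>2" "os = os\<^sub>1 @ os\<^sub>2" "U = V + W"
      "realises (line u) (is\<^sub>1, os\<^sub>1, V)" "realises (line (l # ls)) (is\<^sub>2, os\<^sub>2, W)"
      using realises_tensorE[OF N[unfolded eq] line_diagram(1)[OF u] line_diagram(1)[OF ls]] by metis
    obtain ms W\<^sub>1 W\<^sub>2 where 2: "W = W\<^sub>1 + W\<^sub>2" "realises (vertex l 1 1) (is\<^sub>2, ms, W\<^sub>1)" "realises (line ls) (ms, os\<^sub>2, W\<^sub>2)"
      using realises_line_Cons[OF 1(5) ls] by metis
    have "length is\<^sub>1 = 1" using realises_length(1)[OF 1(4)] line_diagram(2)[OF u] by simp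
    from realises_comp[OF realises_tensor[OF realises_wire_id[OF this] 2(2)] realises_tensor[OF 1(4) 2(3)]]
    show "realises ((line u \<otimes>\<^sub>z line ls) \<circ>\<^sub>z gate\<^sub>2 l) N"
      unfolding eq gate\<^sub>2_def 1(1-3) 2(1) by (simp add: ac_simps)
  qed
  then show ?thesis
    using cl_eqI two_qubit_line[OF u ls] two_qubit_line[of u ls] u ls by (simp add: cl_comp)
qed

lemma cl_line_first:
  assumes ls: "Hl \<notin> set (l # ls)"
  shows "cl (line (l # ls) \<otimes>\<^sub>z line []) = cl (line ls \<otimes>\<^sub>z line []) * cl (gate\<^sub>1 l)"
proof -
  have "line (l # ls) \<otimes>\<^sub>z line [] \<leftrightarrow>\<^sub>* (line ls \<otimes>\<^sub>z line []) \<circ>\<^sub>z gate\<^sub>1 l"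
  proof (rule equiv_if_same_nets)
    show "is_diagram (line (l # ls) \<otimes>\<^sub>z line [])" using two_qubit_line[OF ls, of "[]"] by (simp add: two_qubit_def)
    fix N :: "zx_port set net" assume N: "realises (line (l # ls) \<otimes>\<^sub>z line []) N"
    obtain "is" os U where eq: "N = (is, os, U)" by (cases N)
    obtain is\<^sub>1 os\<^sub>1 V is\<^sub>2 os\<^sub>2 W where 1: "is = is\<^sub>1 @ is\<^sub>2" "os = os\<^sub>1 @ os\<^sub>2" "U = V + W"
      "realises (line (l # ls)) (is\<^sub>1, os\<^sub>1, V)" "realises (line []) (is\<^sub>2, os\<^sub>2, W)"
      using realises_tensorE[OF N[unfolded eq] line_diagram(1)[OF ls] line_diagram(1)] by (metis empty_iff list.set(1))
    obtain ms V\<^sub>1 V\<^sub>2 where 2: "V = V\<^sub>1 + V\<^sub>2" "realises (vertex l 1 1) (is\<^sub>1, ms, V\<^sub>1)" "realises (line ls) (ms, os\<^sub>1, V\<^sub>2)"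
      using realises_line_Cons[OF 1(4) ls] by metis
    have "length is\<^sub>2 = 1" using realises_length(1)[OF 1(5)] by simp
    from realises_comp[OF realises_tensor[OF 2(2) realises_wire_id[OF this]] realises_tensor[OF 2(3) 1(5)]]
    show "realises ((line ls \<otimes>\<^sub>z line []) \<circ>\<^sub>z gate\<^sub>1 l) N"
      unfolding eq gate\<^sub>1_def 1(1-3) 2(1) by (simp add: ac_simps)
  qed
  then show ?thesis
    using cl_eqI two_qubit_line[OF ls, of "[]"] two_qubit_line[of ls "[]"] ls by (simp add: cl_comp)
qed

definition phases :: "zx_label set" where
  "phases = {z_p, z_pi, z_m, x_p, x_pi, x_m}"

lemma Hl_phases: "set u \<subseteq> phases \<Longrightarrow> Hl \<notin> set u"
  by (auto simp: phases_def)

lemma cl_gate1_phase: "l \<in> phases \<Longrightarrow> cl (gate\<^sub>1 l) = C.label_value l"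
  unfolding phases_def by (auto simp: C.label_value_def cl_phase_gates)

lemma cl_gate2_value: "l \<in> phases \<Longrightarrow> cl (gate\<^sub>2 l) = C.second.label_value l"
  unfolding phases_def by (auto simp: C.second.label_value_def cl_phase_gates2)

lemma cl_lines:
  assumes "set u \<subseteq> phases" "set u' \<subseteq> phases"
  shows "cl (line u \<otimes>\<^sub>z line u') = C.word_value u * C.second.word_value u'"
  using assms(2)
proof (induction u')
  case Nil
  from assms(1) have "cl (line u \<otimes>\<^sub>z line []) = C.word_value u"
  proof (induction u)
    case Nil
    have "wire_id 2 \<leftrightarrow>\<^sub>* wire_id 1 \<otimes>\<^sub>z wire_id 1"
    proof (rule equiv_if_same_nets)
      fix N :: "zx_port set net" assume N: "realises (wire_id 2) N"
      obtain "is" os U where eq: "N = (is, os, U)" by (cases N)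
      note U = realises_wire_idE[OF N[unfolded eq]]
      then obtain x y where "is = [x, y]" by (metis length_0_conv length_Suc_conv numeral_2_eq_2)
      then show "realises (wire_id 1 \<otimes>\<^sub>z wire_id 1) N"
        using realises_tensor[OF realises_wire_id[of "[x]" 1] realises_wire_id[of "[y]" 1]] U eq by simp
    qed simp
    then show ?case
      using cl_eqI[of "wire_id 2" "wire_id 1 \<otimes>\<^sub>z wire_id 1"] two_qubit_line[of "[]" "[]"] by (simp add: cl_wire_id)
  next
    case (Cons l u)
    then show ?case using cl_line_first[of l u] Hl_phases[of "l # u"] by (simp add: cl_gate1_phase del: line.simps)
  qed
  then show ?case by simp
next
  case (Cons l u')
  then show ?case
    using cl_line_second[of u l u'] Hl_phases[OF assms(1)] Hl_phases[of "l # u'"]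
    by (simp add: cl_gate2_value mult.assoc del: line.simps)
qed

lemma Clifford1_eq: "Clifford1 = line ` clifford_words"
  unfolding Clifford1_def clifford_words_def ..

lemma clifford_words_phases: "u \<in> clifford_words \<Longrightarrow> set u \<subseteq> phases"
  unfolding clifford_words_def phases_def by auto

definition local_diagrams :: "zx_diagram set" where
  "local_diagrams = {C\<^sub>1 \<otimes>\<^sub>z C\<^sub>2 | C\<^sub>1 C\<^sub>2. C\<^sub>1 \<in> Clifford1 \<and> C\<^sub>2 \<in> Clifford1}"

lemma two_qubit_local: "X \<in> local_diagrams \<Longrightarrow> two_qubit X"
  unfolding local_diagrams_def Clifford1_eq using two_qubit_line Hl_phases clifford_words_phases by blast

text \<open>The 24 words exhaust the group of each wire by \<open>generated_words\<close>, and
  \<open>L\<close> is the product of the two groups.\<close>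

lemma cl_local: "cl ` local_diagrams = C.L"
proof -
  have "cl ` local_diagrams = {C.word_value u * C.second.word_value u' | u u'. u \<in> clifford_words \<and> u' \<in> clifford_words}"
  proof -
    have eq: "local_diagrams = {line u \<otimes>\<^sub>z line u' | u u'. u \<in> clifford_words \<and> u' \<in> clifford_words}"
      unfolding local_diagrams_def Clifford1_eq by blast
    show ?thesis
      unfolding eq image_Collect2
      by (intro Collect_cong ex_cong1) (auto simp: cl_lines[OF clifford_words_phases clifford_words_phases])
  qed
  also have "\<dots> = C.L"
    unfolding C.L_eq C.generated_words C.second.generated_words by blast
  finally show ?thesis .
qed

lemma Clifford2_eq:
  "Clifford2 = local_diagrams \<union> (\<circ>\<^sub>z) wire_swap ` local_diagrams \<union>
     {(A \<otimes>\<^sub>z B) \<circ>\<^sub>z CNOT \<circ>\<^sub>z X | A B X. A \<in> coset_A \<and> B \<in> coset_B \<and> X \<in> local_diagrams} \<union>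
     {(B \<otimes>\<^sub>z A) \<circ>\<^sub>z wire_swap \<circ>\<^sub>z CNOT \<circ>\<^sub>z X | A B X. A \<in> coset_A \<and> B \<in> coset_B \<and> X \<in> local_diagrams}"
proof -
  have image: "f ` {h x y | x y. P x \<and> Q y} = {f (h x y) | x y. P x \<and> Q y}" for f h P Q
    by blast
  have cosets: "{f A B (h x y) | A B x y. A \<in> S \<and> B \<in> R \<and> P x \<and> Q y} =
      {f A B X | A B X. A \<in> S \<and> B \<in> R \<and> X \<in> {h x y | x y. P x \<and> Q y}}"
    for f h P Q S R
    by blast
  show ?thesis
    unfolding Clifford2_def local_diagrams_def image
    using cosets[of "\<lambda>A B X. (A \<otimes>\<^sub>z B) \<circ>\<^sub>z CNOT \<circ>\<^sub>z X" "(\<otimes>\<^sub>z)"]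
      cosets[of "\<lambda>A B X. (B \<otimes>\<^sub>z A) \<circ>\<^sub>z wire_swap \<circ>\<^sub>z CNOT \<circ>\<^sub>z X" "(\<otimes>\<^sub>z)"]
    by simp
qed

lemma Clifford2_cases:
  assumes "k \<in> Clifford2"
  obtains X where "X \<in> local_diagrams" "k = X"
  | X where "X \<in> local_diagrams" "k = wire_swap \<circ>\<^sub>z X"
  | A B X where "A \<in> coset_A" "B \<in> coset_B" "X \<in> local_diagrams" "k = (A \<otimes>\<^sub>z B) \<circ>\<^sub>z CNOT \<circ>\<^sub>z X"
  | A B X where "A \<in> coset_A" "B \<in> coset_B" "X \<in> local_diagrams" "k = (B \<otimes>\<^sub>z A) \<circ>\<^sub>z wire_swap \<circ>\<^sub>z CNOT \<circ>\<^sub>z X"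
  using assms unfolding Clifford2_eq by (elim UnE) blast+

lemma Clifford2_I:
  assumes "X \<in> local_diagrams"
  shows "X \<in> Clifford2" "wire_swap \<circ>\<^sub>z X \<in> Clifford2"
    and "A \<in> coset_A \<Longrightarrow> B \<in> coset_B \<Longrightarrow> (A \<otimes>\<^sub>z B) \<circ>\<^sub>z CNOT \<circ>\<^sub>z X \<in> Clifford2"
    and "A \<in> coset_A \<Longrightarrow> B \<in> coset_B \<Longrightarrow> (B \<otimes>\<^sub>z A) \<circ>\<^sub>z wire_swap \<circ>\<^sub>z CNOT \<circ>\<^sub>z X \<in> Clifford2"
  using assms unfolding Clifford2_eq by blast+

lemma coset_cases:
  assumes "A \<in> coset_A" "B \<in> coset_B"
  obtains a b where "a \<in> {[], [x_p], [x_p, z_p]}" "b \<in> {[], [z_p], [z_p, x_p]}" "A = line a" "B = line b"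
  using assms unfolding coset_A_def coset_B_def by blast

text \<open>Moved to the left, the swap exchanges the wires of the outer gates. This is why the
  forms with a swap in \<open>Clifford2\<close> carry \<open>B\<close> on the first wire and still
  have classes in \<open>w K\<close>.\<close>

lemma cl_AB:
  assumes "a \<in> {[], [x_p], [x_p, z_p]}" "b \<in> {[], [z_p], [z_p, x_p]}"
  shows "two_qubit (line a \<otimes>\<^sub>z line b)" "two_qubit (line b \<otimes>\<^sub>z line a)"
    and "cl (line a \<otimes>\<^sub>z line b) = C.word_value a * C.second.word_value b"
    and "cl (line b \<otimes>\<^sub>z line a) * (cl wire_swap * x) = cl wire_swap * (C.word_value a * (C.second.word_value b * x))"
proof -
  have ph: "set a \<subseteq> phases" "set b \<subseteq> phases" using assms by (auto simp: phases_def)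
  then show "two_qubit (line a \<otimes>\<^sub>z line b)" "two_qubit (line b \<otimes>\<^sub>z line a)"
    using two_qubit_line Hl_phases by simp_all
  show "cl (line a \<otimes>\<^sub>z line b) = C.word_value a * C.second.word_value b"
    using ph by (rule cl_lines)
  show "cl (line b \<otimes>\<^sub>z line a) * (cl wire_swap * x) = cl wire_swap * (C.word_value a * (C.second.word_value b * x))"
    unfolding cl_lines[OF ph(2,1)] using assms
    by (auto simp: C.label_value_def C.second.label_value_def C.w_simps C.commute[THEN C.left] mult.assoc)
qed

lemma coset_values:
  "C.word_value ` {[], [x_p], [x_p, z_p]} = {1, cl (gate\<^sub>1 x_p), cl (gate\<^sub>1 z_p) * cl (gate\<^sub>1 x_p)}"
  "C.second.word_value ` {[], [z_p], [z_p, x_p]} = {1, cl (gate\<^sub>2 z_p), cl (gate\<^sub>2 x_p) * cl (gate\<^sub>2 z_p)}"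
  by (simp_all add: C.label_value_def C.second.label_value_def)

section \<open>Correspondence between \<open>Clifford2\<close> and \<open>T\<close>\<close>

lemma Clifford2_class:
  assumes "k \<in> Clifford2"
  shows "two_qubit k \<and> cl k \<in> C.T"
  using assms
proof (cases rule: Clifford2_cases)
  case (1 X)
  then show ?thesis using two_qubit_local cl_local C.T_I(1) by blast
next
  case (2 X)
  then have "cl X \<in> C.L" using cl_local by blast
  then show ?thesis using 2 two_qubit_local[of X] C.T_I(2)[of "cl X"] by (simp add: cl_comp)
next
  case (3 A B X)
  obtain a b where ab: "a \<in> {[], [x_p], [x_p, z_p]}" "b \<in> {[], [z_p], [z_p, x_p]}" "A = line a" "B = line b"
    using coset_cases[OF 3(1,2)] by metis
  note cl_AB = cl_AB[OF ab(1,2)]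
  have "C.word_value a * (C.second.word_value b * (cl CNOT * cl X)) \<in> C.K"
    using coset_values ab(1,2) 3(3) cl_local by (intro C.KI) blast+
  then show ?thesis
    using 3 ab(3,4) cl_AB two_qubit_local[of X] C.T_I(1) by (simp add: cl_comp mult.assoc)
next
  case (4 A B X)
  obtain a b where ab: "a \<in> {[], [x_p], [x_p, z_p]}" "b \<in> {[], [z_p], [z_p, x_p]}" "A = line a" "B = line b"
    using coset_cases[OF 4(1,2)] by metis
  note cl_AB = cl_AB[OF ab(1,2)]
  have "C.word_value a * (C.second.word_value b * (cl CNOT * cl X)) \<in> C.K"
    using coset_values ab(1,2) 4(3) cl_local by (intro C.KI) blast+
  then show ?thesis
    using 4 ab(3,4) cl_AB two_qubit_local[of X] C.T_I(2) by (simp add: cl_comp mult.assoc)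
qed

text \<open>The converse of \<open>Clifford2_class\<close>: it leads from a computation in the
  monoid back to a diagram in normal form.\<close>

lemma T_class:
  assumes "t \<in> C.T"
  shows "\<exists>k\<in>Clifford2. cl k = t"
proof -
  have K: "\<exists>k\<in>Clifford2. cl k = x" "\<exists>k\<in>Clifford2. cl k = cl wire_swap * x" if x: "x \<in> C.K" for x
  proof -
    obtain a' b' l where abl: "x = a' * (b' * (cl CNOT * l))" "l \<in> C.L"
      "a' \<in> C.word_value ` {[], [x_p], [x_p, z_p]}" "b' \<in> C.second.word_value ` {[], [z_p], [z_p, x_p]}"
      using x unfolding C.K_def coset_values by blast
    from abl(3) obtain a where a: "a' = C.word_value a" "a \<in> {[], [x_p], [x_p, z_p]}" by (rule imageE)
    from abl(4) obtain b where b: "b' = C.second.word_value b" "b \<in> {[], [z_p], [z_p, x_p]}" by (rule imageE)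
    from abl(2) obtain X where X: "l = cl X" "X \<in> local_diagrams" unfolding cl_local[symmetric] by (rule imageE)
    have AB: "line a \<in> coset_A" "line b \<in> coset_B"
      unfolding coset_A_def coset_B_def by (rule imageI[OF a(2)], rule imageI[OF b(2)])
    note cl_AB = cl_AB[OF a(2) b(2)]
    have "cl ((line a \<otimes>\<^sub>z line b) \<circ>\<^sub>z CNOT \<circ>\<^sub>z X) = x"
      "cl ((line b \<otimes>\<^sub>z line a) \<circ>\<^sub>z wire_swap \<circ>\<^sub>z CNOT \<circ>\<^sub>z X) = cl wire_swap * x"
      using abl(1) a(1) b(1) X cl_AB two_qubit_local[of X] by (simp_all add: cl_comp mult.assoc)
    then show "\<exists>k\<in>Clifford2. cl k = x" "\<exists>k\<in>Clifford2. cl k = cl wire_swap * x"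
      using Clifford2_I(3,4)[OF X(2) AB] by blast+
  qed
  have L: "\<exists>k\<in>Clifford2. cl k = x" "\<exists>k\<in>Clifford2. cl k = cl wire_swap * x" if x: "x \<in> C.L" for x
  proof -
    from x obtain X where X: "x = cl X" "X \<in> local_diagrams" unfolding cl_local[symmetric] by (rule imageE)
    moreover have "cl (wire_swap \<circ>\<^sub>z X) = cl wire_swap * x" using X two_qubit_local by (simp add: cl_comp)
    ultimately show "\<exists>k\<in>Clifford2. cl k = x" "\<exists>k\<in>Clifford2. cl k = cl wire_swap * x"
      using Clifford2_I(1,2)[OF X(2)] by blast+
  qed
  from assms show ?thesis by (cases rule: C.T_cases) (use K L in blast)+
qed

text \<open>Hadamard and \<pi> gates are products of S and V, so \<open>T_gens\<close> applies to
  them; gates on the second wire are conjugates by the swap of those on the first.\<close>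

lemma generator_class:
  assumes "g \<in> Clifford2_generators" "t \<in> C.T"
  shows "two_qubit g \<and> cl g * t \<in> C.T"
proof -
  let ?U = "{z_p, x_p, z_pi, x_pi, Hl}"
  have gates: "cl (gate\<^sub>1 l) * t \<in> C.T \<and> cl (gate\<^sub>2 l) * t \<in> C.T" if "l \<in> ?U" for l
  proof -
    have "cl (gate\<^sub>2 l) * t = cl wire_swap * (cl (gate\<^sub>1 l) * (cl wire_swap * t))"
      unfolding cl_gate2[of l] by (simp only: mult.assoc)
    moreover have "cl (gate\<^sub>1 l) * t' \<in> C.T" if "t' \<in> C.T" for t'
      using \<open>l \<in> ?U\<close> that by (auto simp: cl_phase_gates mult.assoc C.T_gens)
    ultimately show ?thesis using assms(2) by (simp add: C.T_w)
  qed
  have "g \<in> gate\<^sub>1 ` ?U \<union> gate\<^sub>2 ` ?U \<union> {CNOT, wire_swap}"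
    using assms(1) unfolding Clifford2_generators_def Clifford1_generators_def gate\<^sub>1_def gate\<^sub>2_def by auto
  then consider l where "l \<in> ?U" "g = gate\<^sub>1 l" | l where "l \<in> ?U" "g = gate\<^sub>2 l" | "g = CNOT" | "g = wire_swap"
    by blast
  then show ?thesis
  proof cases
    case 1
    then show ?thesis using gates[OF 1(1)] by simp
  next
    case 2
    then show ?thesis using gates[OF 2(1)] by simp
  qed (simp_all add: C.T_c C.T_w assms(2))
qed

theorem proposition4p7:
  assumes "k \<in> Clifford2" and "g \<in> Clifford2_generators"
  shows "\<exists>k'\<in>Clifford2. g \<circ>\<^sub>z k \<leftrightarrow>\<^sub>* k'"
proof -
  have k: "two_qubit k" "cl k \<in> C.T" using Clifford2_class[OF assms(1)] by simp_all
  have g: "two_qubit g" "cl g * cl k \<in> C.T" using generator_class[OF assms(2) k(2)] by simp_all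
  obtain k' where k': "k' \<in> Clifford2" "cl k' = cl g * cl k" using T_class[OF g(2)] by blast
  then have "g \<circ>\<^sub>z k \<leftrightarrow>\<^sub>* k'"
    using Clifford2_class[OF k'(1)] g(1) k(1) by (simp add: cl_comp flip: cl_eq_iff)
  then show ?thesis using k'(1) by blast
qed

end
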